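(* Let $q$ be a prime power and let $\mathcal{U}$ be a unital in the Desarguesian projective plane $\mathrm{PG}(2,q^2)$. Let $M$ be the group of projectivities of $\mathrm{PG}(2,q^2)$ (i.e. the subgroup of $\mathrm{PGL}(3,q^2)$) which preserve $\mathcal{U}$. If $\mathcal{U}$ has two distinct points $P,Q$ such that the stabiliser $G=M_{P,Q}$ (the subgroup of $M$ fixing both $P$ and $Q$) has order $q^2-1$, then $\mathcal{U}$ is classical.
   Context: A unital in $\mathrm{PG}(2,q^2)$ is a set of $q^3+1$ points meeting every line of $\mathrm{PG}(2,q^2)$ in either $1$ or $q+1$ points. A unital is classical (Hermitian) if it is the set of absolute points of a non-degenerate unitary polarity of $\mathrm{PG}(2,q^2)$, i.e. the set of $\mathrm{GF}(q^2)$-rational points of a non-degenerate Hermitian curve. *)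

theory Defs
  imports
    "HOL-Analysis.Analysis"
    "HOL-Algebra.Bij"
    "HOL-Algebra.Coset"
    "HOL-Number_Theory.Prime_Powers"
begin

text \<open>
  For a field of type \<open>'a\<close>, the plane \<open>PG(2,'a)\<close> has the one-dimensional subspaces of \<open>'a^3\<close> as
  points and the two-dimensional ones as lines; incidence is inclusion. If \<open>CARD('a) = q\<^sup>2\<close>
  then \<open>'a\<close> is a copy of \<open>GF(q\<^sup>2)\<close>, and this plane is \<open>PG(2,q\<^sup>2)\<close>.
\<close>

definition pg_points :: "('a::field ^ 3) set set" where
  "pg_points = {P. vec.subspace P \<and> vec.dim P = 1}"

definition pg_lines :: "('a::field ^ 3) set set" where
  "pg_lines = {L. vec.subspace L \<and> vec.dim L = 2}"

definition is_unital :: "nat \<Rightarrow> ('a::field ^ 3) set set \<Rightarrow> bool" where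
  "is_unital q U \<longleftrightarrow>
     U \<subseteq> pg_points \<and> card U = q ^ 3 + 1 \<and>
     (\<forall>L\<in>pg_lines. card {P\<in>U. P \<subseteq> L} \<in> {1, q + 1})"

text \<open>
  Projectivities are the maps induced by invertible matrices on points. They are restricted to
  \<open>pg_points\<close> so that proportional matrices give the same element, as in \<open>PGL(3,'a)\<close>.
\<close>

definition projectivity_of :: "'a::field ^ 3 ^ 3 \<Rightarrow> ('a ^ 3) set \<Rightarrow> ('a ^ 3) set" where
  "projectivity_of A = (\<lambda>P\<in>pg_points. (*v) A ` P)"

definition PGL3 :: "(('a::field ^ 3) set \<Rightarrow> ('a ^ 3) set) monoid" where
  "PGL3 = (BijGroup pg_points)\<lparr>carrier := projectivity_of ` {A. invertible A}\<rparr>"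

definition preserving_group ::
    "('a::field ^ 3) set set \<Rightarrow> (('a ^ 3) set \<Rightarrow> ('a ^ 3) set) monoid" where
  "preserving_group U = PGL3\<lparr>carrier := {g \<in> carrier PGL3. g ` U = U}\<rparr>"

definition two_point_stabiliser ::
    "('p \<Rightarrow> 'p) monoid \<Rightarrow> 'p \<Rightarrow> 'p \<Rightarrow> ('p \<Rightarrow> 'p) monoid" where
  "two_point_stabiliser M P Q = M\<lparr>carrier := {g \<in> carrier M. g P = P \<and> g Q = Q}\<rparr>"

text \<open>
  Hermitian forms are taken with respect to the involution \<open>x \<mapsto> x ^ q\<close> of a field with \<open>q\<^sup>2\<close>
  elements.
\<close>

definition hermitian_matrix :: "nat \<Rightarrow> 'a::field ^ 3 ^ 3 \<Rightarrow> bool" where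
  "hermitian_matrix q H \<longleftrightarrow> (\<forall>i j. H $ j $ i = (H $ i $ j) ^ q)"

definition hermitian_form :: "nat \<Rightarrow> 'a::field ^ 3 ^ 3 \<Rightarrow> 'a ^ 3 \<Rightarrow> 'a ^ 3 \<Rightarrow> 'a" where
  "hermitian_form q H v w = (\<Sum>i\<in>UNIV. \<Sum>j\<in>UNIV. v $ i * H $ i $ j * (w $ j) ^ q)"

definition hermitian_perp :: "nat \<Rightarrow> 'a::field ^ 3 ^ 3 \<Rightarrow> ('a ^ 3) set \<Rightarrow> ('a ^ 3) set" where
  "hermitian_perp q H S = {v. \<forall>w\<in>S. hermitian_form q H v w = 0}"

definition unitary_polarity :: "nat \<Rightarrow> (('a::field ^ 3) set \<Rightarrow> ('a ^ 3) set) \<Rightarrow> bool" where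
  "unitary_polarity q \<rho> \<longleftrightarrow>
     (\<exists>H. hermitian_matrix q H \<and> invertible H \<and>
          (\<forall>S. vec.subspace S \<longrightarrow> \<rho> S = hermitian_perp q H S))"

definition absolute_points :: "(('a::field ^ 3) set \<Rightarrow> ('a ^ 3) set) \<Rightarrow> ('a ^ 3) set set" where
  "absolute_points \<rho> = {P \<in> pg_points. P \<subseteq> \<rho> P}"

definition classical_unital :: "nat \<Rightarrow> ('a::field ^ 3) set set \<Rightarrow> bool" where
  "classical_unital q U \<longleftrightarrow> (\<exists>\<rho>. unitary_polarity q \<rho> \<and> U = absolute_points \<rho>)"

lemma mult_image_in_points:
  fixes A :: "'a::field ^ 3 ^ 3"
  assumes "invertible A" "P \<in> pg_points"
  shows "(*v) A ` P \<in> pg_points"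
proof -
  have "inj ((*v) A)"
    using assms(1) matrix_left_invertible_injective invertible_left_inverse by blast
  hence "vec.dim ((*v) A ` P) = vec.dim P"
    by (intro vec.dim_image_eq) (auto intro: inj_on_subset)
  moreover have "vec.subspace ((*v) A ` P)"
    using assms(2) vec.subspace_image by (auto simp: pg_points_def)
  ultimately show ?thesis
    using assms(2) by (simp add: pg_points_def)
qed

lemma projectivity_of_mult:
  fixes A B :: "'a::field ^ 3 ^ 3"
  assumes "invertible B"
  shows "compose pg_points (projectivity_of A) (projectivity_of B) = projectivity_of (A ** B)"
  using mult_image_in_points[OF assms]
  by (auto simp: compose_def projectivity_of_def fun_eq_iff image_image
      matrix_vector_mul_assoc)

lemma projectivity_of_1: "projectivity_of (mat 1 :: 'a::field ^ 3 ^ 3) = (\<lambda>P\<in>pg_points. P)"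
  by (auto simp: projectivity_of_def fun_eq_iff)

lemma projectivity_of_inverse:
  fixes A :: "'a::field ^ 3 ^ 3"
  assumes "invertible A"
  obtains B where "invertible B"
    "compose pg_points (projectivity_of A) (projectivity_of B) = (\<lambda>P\<in>pg_points. P)"
    "compose pg_points (projectivity_of B) (projectivity_of A) = (\<lambda>P\<in>pg_points. P)"
proof -
  obtain B where B: "A ** B = mat 1" "B ** A = mat 1"
    using assms by (auto simp: invertible_def)
  hence "invertible B"
    by (auto simp: invertible_def)
  with B assms that show thesis
    by (simp add: projectivity_of_mult projectivity_of_1)
qed

lemma projectivity_of_Bij:
  fixes A :: "'a::field ^ 3 ^ 3"
  assumes "invertible A"
  shows "projectivity_of A \<in> Bij pg_points"
proof -
  obtain B where B: "invertible B"
    "compose pg_points (projectivity_of A) (projectivity_of B) = (\<lambda>P\<in>pg_points. P)"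
    "compose pg_points (projectivity_of B) (projectivity_of A) = (\<lambda>P\<in>pg_points. P)"
    using projectivity_of_inverse[OF assms] by blast
  have "bij_betw (projectivity_of A) pg_points pg_points"
  proof (rule bij_betw_byWitness[where f' = "projectivity_of B"])
    show "\<forall>P\<in>pg_points. projectivity_of B (projectivity_of A P) = P"
      using B(3) by (metis compose_eq restrict_apply')
    show "\<forall>P\<in>pg_points. projectivity_of A (projectivity_of B P) = P"
      using B(2) by (metis compose_eq restrict_apply')
  qed (use mult_image_in_points assms B(1) in \<open>auto simp: projectivity_of_def\<close>)
  thus ?thesis
    by (simp add: Bij_def projectivity_of_def)
qed

lemma subgroup_projectivities:
  "subgroup (projectivity_of ` {A. invertible A}) (BijGroup (pg_points :: ('a::field ^ 3) set set))"
proof (rule group.subgroupI[OF group_BijGroup])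
  let ?G = "BijGroup (pg_points :: ('a ^ 3) set set)"
  show "projectivity_of ` {A. invertible A} \<subseteq> carrier ?G"
    by (auto simp: BijGroup_def projectivity_of_Bij)
  show "projectivity_of ` {A :: 'a ^ 3 ^ 3. invertible A} \<noteq> {}"
  proof -
    have "invertible (mat 1 :: 'a ^ 3 ^ 3)"
      by (auto simp: invertible_def intro!: exI[of _ "mat 1"])
    thus ?thesis by blast
  qed
next
  let ?G = "BijGroup (pg_points :: ('a ^ 3) set set)"
  fix g :: "('a ^ 3) set \<Rightarrow> ('a ^ 3) set"
  assume "g \<in> projectivity_of ` {A. invertible A}"
  then obtain A where A: "g = projectivity_of A" "invertible A" by blast
  then obtain B where B: "invertible B"
    "compose pg_points (projectivity_of B) (projectivity_of A) = (\<lambda>P\<in>pg_points. P)"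
    using projectivity_of_inverse by metis
  have "m_inv ?G g = projectivity_of B"
    by (rule group.inv_equality[OF group_BijGroup])
       (use A B in \<open>auto simp: BijGroup_def projectivity_of_Bij\<close>)
  thus "m_inv ?G g \<in> projectivity_of ` {A. invertible A}"
    using B by blast
next
  let ?G = "BijGroup (pg_points :: ('a ^ 3) set set)"
  fix g h :: "('a ^ 3) set \<Rightarrow> ('a ^ 3) set"
  assume "g \<in> projectivity_of ` {A. invertible A}" "h \<in> projectivity_of ` {A. invertible A}"
  then obtain A B where "g = projectivity_of A" "invertible A" "h = projectivity_of B" "invertible B"
    by blast
  thus "mult ?G g h \<in> projectivity_of ` {A. invertible A}"
    by (auto simp: BijGroup_def projectivity_of_Bij projectivity_of_mult invertible_mult)
qed

lemma group_PGL3: "group PGL3"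
  unfolding PGL3_def
  by (rule group.subgroup_imp_group[OF group_BijGroup subgroup_projectivities])

lemma PGL3_mult_apply:
  assumes "g \<in> carrier PGL3" "h \<in> carrier PGL3" "P \<in> pg_points"
  shows "mult PGL3 g h P = g (h P)"
  using assms by (auto simp: PGL3_def BijGroup_def projectivity_of_Bij compose_def)

lemma PGL3_one_apply: "P \<in> pg_points \<Longrightarrow> one PGL3 P = P"
  by (simp add: PGL3_def BijGroup_def)

lemma PGL3_inv_apply:
  assumes "g \<in> carrier PGL3" "P \<in> pg_points"
  shows "m_inv PGL3 g (g P) = P"
  using PGL3_mult_apply[OF group.inv_closed[OF group_PGL3 assms(1)] assms]
  by (simp add: assms group.l_inv[OF group_PGL3] PGL3_one_apply)

lemma subgroup_preserving:
  assumes "U \<subseteq> pg_points"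
  shows "subgroup {g \<in> carrier PGL3. g ` U = U} PGL3"
proof (rule group.subgroupI[OF group_PGL3])
  have "one PGL3 ` U = U"
    using assms by (auto simp: PGL3_one_apply subset_iff image_iff)
  thus "{g \<in> carrier PGL3. g ` U = U} \<noteq> {}"
    using monoid.one_closed[OF group.is_monoid[OF group_PGL3]] by blast
next
  fix g assume g: "g \<in> {g \<in> carrier PGL3. g ` U = U}"
  have "m_inv PGL3 g ` U = m_inv PGL3 g ` (g ` U)"
    using g by simp
  also have "\<dots> = U"
  proof -
    have "m_inv PGL3 g (g P) = P" if "P \<in> U" for P
      using PGL3_inv_apply[of g P] assms g that by blast
    thus ?thesis by (simp add: image_image)
  qed
  finally show "m_inv PGL3 g \<in> {g \<in> carrier PGL3. g ` U = U}"
    using g by (simp add: group.inv_closed[OF group_PGL3])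
next
  fix g h assume gh: "g \<in> {g \<in> carrier PGL3. g ` U = U}" "h \<in> {g \<in> carrier PGL3. g ` U = U}"
  have "mult PGL3 g h ` U = g ` (h ` U)"
  proof -
    have "mult PGL3 g h P = g (h P)" if "P \<in> U" for P
      using PGL3_mult_apply[of g h P] assms gh that by blast
    thus ?thesis by (simp add: image_image)
  qed
  thus "mult PGL3 g h \<in> {g \<in> carrier PGL3. g ` U = U}"
    using gh by (simp add: monoid.m_closed[OF group.is_monoid[OF group_PGL3]])
qed auto

lemma group_preserving_group: "U \<subseteq> pg_points \<Longrightarrow> group (preserving_group U)"
  unfolding preserving_group_def
  by (rule group.subgroup_imp_group[OF group_PGL3 subgroup_preserving])

lemma group_two_point_stabiliser:
  assumes "U \<subseteq> pg_points" "P \<in> U" "Q \<in> U"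
  shows "group (two_point_stabiliser (preserving_group U) P Q)"
proof -
  have pts: "P \<in> pg_points" "Q \<in> pg_points" using assms by auto
  have M: "carrier (preserving_group U) = {g \<in> carrier PGL3. g ` U = U}"
      "mult (preserving_group U) = mult PGL3" "one (preserving_group U) = one PGL3"
    by (simp_all add: preserving_group_def)
  note G = group_preserving_group[OF assms(1)]
  have minv: "m_inv (preserving_group U) g = m_inv PGL3 g" if "g \<in> carrier (preserving_group U)" for g
    using group.m_inv_consistent[OF group_PGL3 subgroup_preserving[OF assms(1)]] that
    by (simp add: preserving_group_def)
  have "subgroup {g \<in> carrier (preserving_group U). g P = P \<and> g Q = Q} (preserving_group U)"
  proof (rule group.subgroupI[OF G])
    show "{g \<in> carrier (preserving_group U). g P = P \<and> g Q = Q} \<noteq> {}"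
    proof -
      have "one (preserving_group U) P = P" "one (preserving_group U) Q = Q"
        by (simp_all only: M(3) PGL3_one_apply[OF pts(1)] PGL3_one_apply[OF pts(2)])
      thus ?thesis
        using monoid.one_closed[OF group.is_monoid[OF G]] by blast
    qed
  next
    fix g assume g: "g \<in> {g \<in> carrier (preserving_group U). g P = P \<and> g Q = Q}"
    hence "m_inv PGL3 g P = P" "m_inv PGL3 g Q = Q"
      using PGL3_inv_apply[of g P] PGL3_inv_apply[of g Q] pts M(1) by auto
    thus "m_inv (preserving_group U) g \<in> {g \<in> carrier (preserving_group U). g P = P \<and> g Q = Q}"
      using g minv group.inv_closed[OF G, of g] by simp
  next
    fix g h assume "g \<in> {g \<in> carrier (preserving_group U). g P = P \<and> g Q = Q}"
      "h \<in> {g \<in> carrier (preserving_group U). g P = P \<and> g Q = Q}"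
    thus "mult (preserving_group U) g h \<in> {g \<in> carrier (preserving_group U). g P = P \<and> g Q = Q}"
      using monoid.m_closed[OF group.is_monoid[OF G], of g h] pts PGL3_mult_apply[of g h] M
      by auto
  qed auto
  thus ?thesis
    unfolding two_point_stabiliser_def by (rule group.subgroup_imp_group[OF G])
qed

end

theory Submission
  imports Defs "HOL-Computational_Algebra.Polynomial"
begin

text \<open>
  Coordinates are chosen so that \<open>P\<close> and \<open>Q\<close> are basis points and the tangents at them meet in the
  third one. The stabiliser of \<open>P\<close> and \<open>Q\<close> is then diagonal, and its order forces the affine part
  of the unital to be a curve \<open>x ^ (q + 1) = f y\<close> with \<open>f\<close> semi-invariant under \<open>GF(q)\<close>.
  Lines through a point off the unital meet it in \<open>1\<close> modulo \<open>q\<close> points, so certain products of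
  linear factors are \<open>1\<close> modulo \<open>t ^ q\<close>; this gives power sum identities which locate the point
  of contact of every tangent and show that the tangents form a curve \<open>x ^ (q + 1) = dual y\<close> of the
  same kind, with \<open>f y * dual (y ^ q) = - ((y ^ q - y)\<^sup>2)\<close>. The same identities restrict the
  exponents occurring in \<open>f\<close> and \<open>dual\<close>, and comparing coefficients of \<open>y\<^sup>2\<close> shows that \<open>f\<close>
  is homogeneous of degree \<open>1\<close> over \<open>GF(q)\<close>. A further power sum argument
  shows that \<open>{y. f y = 1}\<close> is a coset of \<open>GF(q)\<close>, so \<open>f y = k * (y - y ^ q)\<close>, which is a Hermitian
  curve.
\<close>

section \<open>Finite fields of square order\<close>

text \<open>The order q^2 - 1 is the largest that a group of such diagonal maps can have, and
  attaining it fixes the group of multipliers of x and of y. What remains unknown is the factor c(t)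
  in f (t * y) = c(t) * f y, and most of the work goes into c(t) = t. Replacing y by t * y in the
  sum of f y * y^(q^2 - 2) multiplies it by c(t) / t, so it is enough that this sum, up to sign the
  coefficient of y in \<open>f\<close>, is not zero. The line property of \<open>f\<close> alone
  does not show this, but the tangents yield a second function with the same property, and the
  product of the two is known explicitly, with -1 as coefficient of y^2. For e at least 1, the
  moment with exponent q^2 - 1 - e is minus the coefficient of y^e, so every power sum identity is a
  statement about the exponents that occur. The value q = 2 is excluded from these identities
  because a line then has too few points off the unital; there GF(q) has no scalars but 0 and 1, so
  c(t) = t is trivial, and the level set argument covers it again.\<close>

locale square_field =
  fixes q :: nat and F :: "'a::{field,finite} itself"
  assumes primepow_q: "primepow q" and card_F: "CARD('a) = q\<^sup>2"
begin

lemma q_gt_1: "q > 1"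
  using primepow_gt_Suc_0[OF primepow_q] by simp

lemma prime_char: "prime CHAR('a)"
  using finite_imp_CHAR_pos[where ?'a = 'a] by (intro prime_CHAR_semidom) auto

text \<open>Translation by 1 permutes the field, so the sums of x + 1 and of x agree and the field
  size vanishes in the field. Hence the characteristic is the prime of which \<open>q\<close> is a
  power.\<close>

lemma q_char_power: obtains n where "n > 0" "q = CHAR('a) ^ n"
proof -
  obtain p k where pk: "prime p" "k > 0" "q = p ^ k"
    using primepow_q by (auto simp: primepow_def)
  have "(\<Sum>x\<in>UNIV. x + 1) = (\<Sum>x\<in>UNIV. x :: 'a)"
    by (rule sum.reindex_bij_witness[of _ "\<lambda>x. x - 1" "\<lambda>x. x + 1"]) auto
  hence "of_nat CARD('a) = (0 :: 'a)" by (simp add: sum.distrib)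
  hence "CHAR('a) dvd p ^ (k * 2)"
    unfolding of_nat_eq_0_iff_char_dvd using pk(3) card_F by (simp only: power_mult)
  hence "CHAR('a) dvd p"
    using prime_char prime_dvd_power by blast
  hence "CHAR('a) = p"
    using pk(1) prime_char primes_dvd_imp_eq by blast
  with pk that show thesis by blast
qed

lemma of_nat_q [simp]: "of_nat q = (0 :: 'a)"
proof -
  obtain n where "n > 0" "q = CHAR('a) ^ n" by (rule q_char_power)
  thus ?thesis by (simp add: of_nat_eq_0_iff_char_dvd dvd_power)
qed

lemma frob_add: "(x + y :: 'a) ^ q = x ^ q + y ^ q"
proof -
  obtain n where "q = CHAR('a) ^ n" by (rule q_char_power)
  thus ?thesis using freshmans_dream'[OF prime_char] by blast
qed

lemma frob_add_poly: "(x + y :: 'a poly) ^ q = x ^ q + y ^ q"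
proof -
  obtain n where "q = CHAR('a) ^ n" by (rule q_char_power)
  thus ?thesis using freshmans_dream'[where ?'a = "'a poly", of q n x y] prime_char by simp
qed

lemma frob_minus: "(- x :: 'a) ^ q = - (x ^ q)"
proof -
  have "x ^ q + (- x) ^ q = 0"
    using frob_add[of x "- x"] q_gt_1 by (simp add: power_0_left)
  thus ?thesis by (simp add: eq_neg_iff_add_eq_0 add.commute)
qed

lemma frob_diff: "(x - y :: 'a) ^ q = x ^ q - y ^ q"
  using frob_add[of x "- y"] by (simp add: frob_minus)

lemma frob_sum: "(\<Sum>i\<in>I. g i :: 'a) ^ q = (\<Sum>i\<in>I. g i ^ q)"
proof -
  obtain n where "q = CHAR('a) ^ n" by (rule q_char_power)
  thus ?thesis using freshmans_dream_sum'[OF prime_char] by blast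
qed

lemma power_card_minus_1: "x \<noteq> 0 \<Longrightarrow> (x :: 'a) ^ (q\<^sup>2 - 1) = 1"
proof -
  assume x: "x \<noteq> 0"
  have "(\<Prod>y\<in>UNIV-{0}. x * y) = (\<Prod>y\<in>UNIV-{0}. y)"
    by (rule prod.reindex_bij_witness[of _ "\<lambda>y. y / x" "\<lambda>y. x * y"]) (use x in auto)
  moreover have "(\<Prod>y\<in>UNIV-{0}. x * y) = x ^ (q\<^sup>2 - 1) * (\<Prod>y\<in>UNIV-{0}. y)"
    by (simp add: prod.distrib card_F)
  ultimately show ?thesis by simp
qed

lemma q2_gt: "q\<^sup>2 > q + 1 \<or> q = 2" "q\<^sup>2 \<ge> 4" "q\<^sup>2 > q"
proof -
  have "q = 2 \<or> q \<ge> 3" using q_gt_1 by linarith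
  moreover have "q \<ge> 3 \<Longrightarrow> q * q \<ge> 3 * q" by simp
  ultimately have "q\<^sup>2 \<ge> 3 * q \<or> q = 2"
    by (auto simp: power2_eq_square)
  thus "q\<^sup>2 > q + 1 \<or> q = 2" "q\<^sup>2 \<ge> 4" "q\<^sup>2 > q"
    using q_gt_1 by (auto simp del: power2_eq_square)
qed

lemma power_q2 [simp]: "(x :: 'a) ^ (q\<^sup>2) = x"
proof (cases "x = 0")
  case False
  have "x ^ (q\<^sup>2) = x ^ (q\<^sup>2 - 1) * x"
    using q2_gt by (metis power_minus_mult zero_less_numeral order_less_le_trans)
  thus ?thesis using power_card_minus_1[OF False] by simp
qed (use q_gt_1 in auto)

lemma power_q_q [simp]: "((x :: 'a) ^ q) ^ q = x"
  using power_q2[of x] by (simp add: power2_eq_square power_mult)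

lemma power_q_eq_iff [simp]: "(x :: 'a) ^ q = y ^ q \<longleftrightarrow> x = y"
  by (metis power_q_q)

text \<open>Reduce \<open>n\<close> to its nonzero remainder r modulo q^2 - 1; the polynomial t^r -
  1 has too few roots to vanish at all nonzero elements. No primitive element is needed.\<close>

lemma exists_power_neq_1:
  assumes "\<not> (q\<^sup>2 - 1) dvd n"
  shows "\<exists>a :: 'a. a \<noteq> 0 \<and> a ^ n \<noteq> 1"
proof (rule ccontr)
  assume "\<not> ?thesis"
  hence *: "a ^ n = 1" if "a \<noteq> 0" for a :: 'a using that by blast
  define r where "r = n mod (q\<^sup>2 - 1)"
  have r: "r > 0" "r < q\<^sup>2 - 1"
    using assms q2_gt by (auto simp: r_def dvd_eq_mod_eq_0)
  have "a ^ r = 1" if "a \<noteq> 0" for a :: 'a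
  proof -
    have "a ^ n = a ^ ((q\<^sup>2 - 1) * (n div (q\<^sup>2 - 1)) + r)"
      by (simp add: r_def)
    also have "\<dots> = a ^ r"
      using power_card_minus_1[OF that] by (simp add: power_add power_mult)
    finally show ?thesis using * that by auto
  qed
  hence "UNIV - {0} \<subseteq> {a :: 'a. poly (monom 1 r - 1) a = 0}"
    by (auto simp: poly_monom)
  hence "card (UNIV - {0 :: 'a}) \<le> card {a :: 'a. poly (monom 1 r - 1) a = 0}"
    by (intro card_mono) auto
  also have "\<dots> \<le> degree (monom 1 r - 1 :: 'a poly)"
  proof (rule card_poly_roots_bound)
    have "poly (monom 1 r - 1) (0::'a) \<noteq> 0" using r by (simp add: poly_monom power_0_left)
    thus "monom 1 r - 1 \<noteq> (0 :: 'a poly)" by auto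
  qed
  also have "\<dots> \<le> r"
    by (rule order_trans[OF degree_diff_le_max]) (simp add: degree_monom_le)
  finally show False using r card_F by simp
qed

text \<open>If a^n is not 1, substituting a * x multiplies the sum by a^n, so it is 0. The exponent
  0 behaves differently from the other multiples of q^2 - 1 because 0^0 = 1 adds one more
  term.\<close>

lemma sum_power_UNIV:
  "(\<Sum>x\<in>UNIV. (x :: 'a) ^ n) = (if n > 0 \<and> (q\<^sup>2 - 1) dvd n then - 1 else 0)"
proof (cases "(q\<^sup>2 - 1) dvd n")
  case True
  show ?thesis
  proof (cases "n = 0")
    case True thus ?thesis by (simp add: card_F power2_eq_square)
  next
    case False
    from \<open>(q\<^sup>2 - 1) dvd n\<close> obtain k where k: "n = (q\<^sup>2 - 1) * k" by auto
    have "(\<Sum>x\<in>UNIV. (x :: 'a) ^ n) = (\<Sum>x\<in>UNIV. if (x::'a) = 0 then 0 else 1)"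
      using False power_card_minus_1 by (intro sum.cong) (auto simp: k power_mult)
    also have "\<dots> = of_nat (card (UNIV - {0::'a}))"
      by (simp add: sum.If_cases Compl_eq_Diff_UNIV)
    also have "\<dots> = - 1"
    proof -
      have "card (UNIV - {0::'a}) + 1 = q * q"
        using q2_gt by (simp add: card_F power2_eq_square)
      hence "of_nat (card (UNIV - {0::'a})) + 1 = (0::'a)"
        by (metis mult_zero_left of_nat_1 of_nat_add of_nat_mult of_nat_q)
      thus ?thesis by (simp add: eq_neg_iff_add_eq_0)
    qed
    finally show ?thesis using True False by simp
  qed
next
  case False
  then obtain a :: 'a where a: "a \<noteq> 0" "a ^ n \<noteq> 1" using exists_power_neq_1 by blast
  have "(\<Sum>x\<in>UNIV. (x :: 'a) ^ n) = (\<Sum>x\<in>UNIV. (a * x) ^ n)"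
    by (rule sum.reindex_bij_witness[of _ "\<lambda>x. a * x" "\<lambda>x. x / a"]) (use a in auto)
  also have "\<dots> = a ^ n * (\<Sum>x\<in>UNIV. x ^ n)"
    by (simp add: power_mult_distrib sum_distrib_left)
  finally have "(1 - a ^ n) * (\<Sum>x\<in>UNIV. x ^ n) = 0" by (simp add: algebra_simps)
  thus ?thesis using a False by auto
qed

section \<open>The subfield GF(q) and the norm onto it\<close>

definition base :: "'a set" where "base = {t. t ^ q = t}"

lemma base_iff: "t \<in> base \<longleftrightarrow> t ^ q = t" by (simp add: base_def)

lemma norm_in_base: "(x :: 'a) ^ (q + 1) \<in> base"
proof -
  have "(x ^ (q + 1)) ^ q = (x ^ q) ^ q * x ^ q"
    by (simp add: power_add power_mult_distrib mult.commute)
  thus ?thesis by (simp add: base_iff power_add)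
qed

lemma card_roots_power_le:
  assumes "n > 0" shows "card {x :: 'a. x ^ n = c} \<le> n"
proof -
  have "degree (monom 1 n - [:c:]) = n"
    using assms degree_add_eq_left[of "- [:c:]" "monom 1 n"]
    unfolding diff_conv_add_uminus by (simp add: degree_monom_eq)
  moreover have "monom 1 n - [:c:] \<noteq> 0"
    using calculation assms by auto
  ultimately have "card {x. poly (monom 1 n - [:c:]) x = 0} \<le> n"
    using card_poly_roots_bound[of "monom 1 n - [:c:]"] by simp
  thus ?thesis by (simp add: poly_monom)
qed

text \<open>A squeeze: the q^2 - 1 nonzero elements have norms in \<open>base - {0}\<close>, which
  has at most q - 1 elements, and each fibre has at most q + 1, both by counting roots. The product
  of the bounds is exactly q^2 - 1, so both are attained; this yields the size of the subfield and
  surjectivity of the norm at once.\<close>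

lemma card_norm_fibre_base:
  "card (base - {0}) = q - 1 \<and> (\<forall>c\<in>base - {0}. card {x. x ^ (q + 1) = c} = q + 1)"
proof -
  have le: "card {x :: 'a. x ^ (q + 1) = c} \<le> q + 1" for c
    by (rule card_roots_power_le) simp
  have "base - {0} \<subseteq> {t. t ^ (q - 1) = 1}"
  proof
    fix t assume t: "t \<in> base - {0}"
    have "t ^ (q - 1) * t = t ^ q"
      using q_gt_1 by (intro power_minus_mult) simp
    hence "t ^ (q - 1) * t = 1 * t" using t by (simp add: base_iff)
    thus "t \<in> {t. t ^ (q - 1) = 1}" using t mult_right_cancel by blast
  qed
  hence "card (base - {0}) \<le> card {t :: 'a. t ^ (q - 1) = 1}"
    by (intro card_mono) auto
  also have "\<dots> \<le> q - 1" using q_gt_1 by (intro card_roots_power_le) simp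
  finally have b: "card (base - {0}) \<le> q - 1" .
  have tot: "(\<Sum>c\<in>base - {0}. card {x \<in> UNIV - {0}. x ^ (q + 1) = c}) = q\<^sup>2 - 1"
  proof -
    have "(\<Sum>c\<in>base - {0}. \<Sum>x\<in>{x \<in> UNIV - {0}. x ^ (q + 1) = c}. 1) = (\<Sum>x\<in>UNIV - {0::'a}. 1 :: nat)"
      by (rule sum.group) (use norm_in_base in auto)
    thus ?thesis by (simp add: card_F)
  qed
  have eq: "{x \<in> UNIV - {0}. x ^ (q + 1) = c} = {x. x ^ (q + 1) = c}" if "c \<in> base - {0}" for c
    using that by auto
  have tot': "(\<Sum>c\<in>base - {0}. card {x. x ^ (q + 1) = c}) = (q - 1) * (q + 1)"
  proof -
    have "(\<Sum>c\<in>base - {0}. card {x. x ^ (q + 1) = c}) = q\<^sup>2 - 1"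
      unfolding tot[symmetric] by (rule sum.cong[OF refl]) (simp only: eq)
    also have "\<dots> = (q - 1) * (q + 1)"
      using q_gt_1 by (simp add: power2_eq_square algebra_simps)
    finally show ?thesis .
  qed
  have "(q - 1) * (q + 1) \<le> card (base - {0}) * (q + 1)"
    using sum_bounded_above[of "base - {0}" "\<lambda>c. card {x. x ^ (q + 1) = c}" "q + 1"] le tot' by simp
  hence "q - 1 \<le> card (base - {0})" by (subst (asm) mult_le_cancel2) simp
  hence bq: "card (base - {0}) = q - 1" using b by (rule le_antisym[rotated])
  moreover have "card {x. x ^ (q + 1) = c} = q + 1" if c: "c \<in> base - {0}" for c
  proof (rule ccontr)
    assume "card {x. x ^ (q + 1) = c} \<noteq> q + 1"
    hence "card {x. x ^ (q + 1) = c} < q + 1" using le[of c] by linarith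
    hence "(\<Sum>c\<in>base - {0}. card {x. x ^ (q + 1) = c}) < (\<Sum>c\<in>base - {0}. q + 1)"
      using c le by (intro sum_strict_mono_ex1) auto
    thus False using tot' bq by simp
  qed
  ultimately show ?thesis by blast
qed

lemma zero_in_base [simp]: "0 \<in> base" using q_gt_1 by (simp add: base_iff)

lemma card_base: "card base = q"
proof -
  have "card base = Suc (card (base - {0}))" by (rule card.remove) auto
  thus ?thesis using card_norm_fibre_base q_gt_1 by simp
qed

lemma card_norm_fibre: "c \<in> base \<Longrightarrow> card {x. x ^ (q + 1) = c} = (if c = 0 then 1 else q + 1)"
proof (cases "c = 0")
  case True
  have "{x :: 'a. x ^ (q + 1) = 0} = {0}" by auto
  thus ?thesis using True by simp
qed (use card_norm_fibre_base in auto)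

lemma power_q_minus_1_base: "t \<in> base \<Longrightarrow> t \<noteq> 0 \<Longrightarrow> t ^ (q - 1) = 1"
proof -
  assume t: "t \<in> base" "t \<noteq> 0"
  have "t ^ (q - 1) * t = t ^ q"
    using q_gt_1 by (intro power_minus_mult) simp
  hence "t ^ (q - 1) * t = 1 * t" using t by (simp add: base_iff)
  thus ?thesis using t(2) mult_right_cancel by blast
qed

lemma base_eq_roots: "base - {0} = {t. t ^ (q - 1) = 1}"
proof (rule card_seteq)
  show "base - {0} \<subseteq> {t. t ^ (q - 1) = 1}" using power_q_minus_1_base by auto
  show "card {t::'a. t ^ (q - 1) = 1} \<le> card (base - {0})"
    using card_norm_fibre_base card_roots_power_le[of "q - 1" "1::'a"] q_gt_1 by simp
qed simp

lemma exists_base_power_neq_1: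
  assumes "\<not> (q - 1) dvd n"
  shows "\<exists>t\<in>base. t \<noteq> 0 \<and> t ^ n \<noteq> 1"
proof (rule ccontr)
  assume *: "\<not> ?thesis"
  have q1: "q - 1 > 0" using q_gt_1 by simp
  define r where "r = n mod (q - 1)"
  have r: "r > 0" "r < q - 1"
    using assms q1 by (auto simp: r_def dvd_eq_mod_eq_0)
  have "a ^ r = 1" if "a \<in> base" "a \<noteq> 0" for a
  proof -
    have "a ^ n = a ^ ((q - 1) * (n div (q - 1)) + r)"
      by (simp add: r_def)
    also have "\<dots> = a ^ r"
      using power_q_minus_1_base[OF that] by (simp add: power_add power_mult)
    finally show ?thesis using * that by auto
  qed
  hence "base - {0} \<subseteq> {a. a ^ r = 1}" by auto
  hence "card (base - {0}) \<le> card {a :: 'a. a ^ r = 1}" by (intro card_mono) auto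
  also have "\<dots> \<le> r" using r by (intro card_roots_power_le)
  finally show False using r card_norm_fibre_base by simp
qed

lemma base_diff: "s \<in> base \<Longrightarrow> t \<in> base \<Longrightarrow> s - t \<in> base" by (simp add: base_iff frob_diff)
lemma base_mult: "s \<in> base \<Longrightarrow> t \<in> base \<Longrightarrow> s * t \<in> base" by (simp add: base_iff power_mult_distrib)
lemma base_divide: "s \<in> base \<Longrightarrow> t \<in> base \<Longrightarrow> s / t \<in> base" by (simp add: base_iff power_divide)

lemma sum_power_base:
  assumes "n \<le> q - 1"
  shows "(\<Sum>c\<in>base. c ^ n) = (if n = q - 1 then - 1 else 0)"
proof (cases "n = 0")
  case True
  thus ?thesis using card_base q_gt_1 by simp
next
  case n0: False
  show ?thesis
  proof (cases "n = q - 1")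
    case True
    have "(\<Sum>c\<in>base. c ^ n) = (\<Sum>c\<in>base. if c = 0 then 0 else 1)"
      using n0 True power_q_minus_1_base by (intro sum.cong) auto
    also have "\<dots> = (\<Sum>c\<in>base - {0}. 1)"
      by (rule sum.mono_neutral_cong_right) auto
    also have "\<dots> = of_nat (card (base - {0}))" by simp
    also have "\<dots> = - 1"
      using card_norm_fibre_base q_gt_1 by (simp add: of_nat_diff)
    finally show ?thesis using True by simp
  next
    case False
    have "\<not> (q - 1) dvd n" using False n0 assms by (auto dest: dvd_imp_le)
    then obtain a where a: "a \<in> base" "a \<noteq> 0" "a ^ n \<noteq> 1" using exists_base_power_neq_1 by blast
    have "(\<Sum>x\<in>base. x ^ n) = (\<Sum>x\<in>base. (a * x) ^ n)"
      by (rule sum.reindex_bij_witness[of _ "\<lambda>x. a * x" "\<lambda>x. x / a"])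
        (use a base_mult base_divide in auto)
    also have "\<dots> = a ^ n * (\<Sum>x\<in>base. x ^ n)"
      by (simp add: power_mult_distrib sum_distrib_left)
    finally have "(1 - a ^ n) * (\<Sum>x\<in>base. x ^ n) = 0" by (simp add: algebra_simps)
    thus ?thesis using a False by auto
  qed
qed

end

section \<open>Products of linear factors along a line\<close>

lemma dvd_prod_diff:
  fixes a b :: "'i \<Rightarrow> 'a::comm_ring_1"
  assumes "\<And>i. i \<in> I \<Longrightarrow> m dvd a i - b i"
  shows "m dvd (\<Prod>i\<in>I. a i) - (\<Prod>i\<in>I. b i)"
  using assms
proof (induction I rule: infinite_finite_induct)
  case (insert i I)
  have "(\<Prod>j\<in>insert i I. a j) - (\<Prod>j\<in>insert i I. b j) =
      (a i - b i) * (\<Prod>j\<in>I. a j) + b i * ((\<Prod>j\<in>I. a j) - (\<Prod>j\<in>I. b j))"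
    using insert.hyps by (simp add: algebra_simps)
  thus ?case using insert by simp
qed auto

text \<open>Treat the product of 1 + (u_i + d * v_i) * t as a polynomial in the parameter d. Being 1
  modulo t^n for n values of d makes it 1 modulo t^n identically in d. The part linear in d is the
  sum of v_i * t times the product of the other 1 + u_j * t, and that product is congruent to 1 / (1
  + u_i * t); its coefficients are the power sums.\<close>

lemma prod_linear_cong_1_imp:
  fixes u v :: "'i \<Rightarrow> 'a::field"
  assumes "finite I" "finite D" "card D \<ge> n"
    and *: "\<And>d. d \<in> D \<Longrightarrow> monom 1 n dvd (\<Prod>i\<in>I. [:1, u i + d * v i:]) - 1"
    and j: "j + 2 \<le> n"
  shows "(\<Sum>i\<in>I. v i * u i ^ j) = 0"
proof -
  \<comment> \<open>The outer variable is the parameter d, the inner one is t.\<close>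
  define \<Phi> where "\<Phi> = (\<Prod>i\<in>I. [:[:1, u i:], [:0, v i:]:])"
  \<comment> \<open>Each factor brings at most one d, and always together with a t, so the
    coefficient of t^k has degree at most k in d.\<close>
  have low: "coeff (coeff \<Phi> i) k = 0" if "k < i" for i k
  proof -
    have "\<forall>i k. k < i \<longrightarrow> coeff (coeff (\<Prod>i\<in>J. [:[:1, u i:], [:0, v i:]:]) i) k = 0" if "finite J" for J
      using that
    proof (induction J rule: finite_induct)
      case empty
      show ?case by (auto simp: coeff_pCons split: nat.splits)
    next
      case (insert x J)
      define R where "R = (\<Prod>i\<in>J. [:[:1, u i:], [:0, v i:]:])"
      have IH: "\<And>i k. k < i \<Longrightarrow> coeff (coeff R i) k = 0" using insert.IH unfolding R_def by blast
      have "coeff (coeff ([:[:1, u x:], [:0, v x:]:] * R) i) k = 0" if "k < i" for i k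
        using that IH by (cases i; cases k) (auto simp: mult_pCons_left coeff_pCons)
      thus ?case using insert.hyps by (simp add: R_def)
    qed
    thus ?thesis using assms(1) that by (simp add: \<Phi>_def)
  qed
  have ev: "poly \<Phi> [:d:] = (\<Prod>i\<in>I. [:1, u i + d * v i:])" for d
    by (simp add: \<Phi>_def poly_prod mult.commute)
  have cf: "coeff (coeff \<Phi> i) k = (if i = 0 \<and> k = 0 then 1 else 0)" if k: "k < n" for i k
  proof (cases "i \<le> k")
    case False
    thus ?thesis using low[of k i] by auto
  next
    case True
    \<comment> \<open>The coefficient of t^k as a polynomial in d, minus the expected value. Its
      degree is at most k < n and it vanishes on \<open>D\<close>, so it is zero.\<close>
    define R where "R = (\<Sum>i\<le>k. monom (coeff (coeff \<Phi> i) k) i) - [:if k = 0 then 1 else 0:]"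
    have "degree R \<le> k" unfolding R_def
      by (intro degree_diff_le degree_sum_le) (auto intro: order_trans[OF degree_monom_le])
    moreover have "poly R d = 0" if "d \<in> D" for d
    proof -
      have "coeff (poly \<Phi> [:d:]) k = coeff 1 k"
        using *[OF that] k by (auto simp: monom_1_dvd_iff' ev)
      moreover have "coeff (poly \<Phi> [:d:]) k = (\<Sum>i\<le>degree \<Phi>. coeff (coeff \<Phi> i) k * d ^ i)"
        by (simp add: poly_altdef coeff_sum poly_const_pow mult.commute)
      moreover have "(\<Sum>i\<le>degree \<Phi>. coeff (coeff \<Phi> i) k * d ^ i) = (\<Sum>i\<le>max k (degree \<Phi>). coeff (coeff \<Phi> i) k * d ^ i)"
        by (rule sum.mono_neutral_left) (auto simp: coeff_eq_0)
      moreover have "(\<Sum>i\<le>k. coeff (coeff \<Phi> i) k * d ^ i) = (\<Sum>i\<le>max k (degree \<Phi>). coeff (coeff \<Phi> i) k * d ^ i)"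
        by (rule sum.mono_neutral_left) (auto simp: low)
      ultimately show ?thesis
        by (simp add: R_def poly_sum poly_monom)
    qed
    ultimately have "R = 0"
      using poly_eqI_degree[of D R 0] assms(3) k by simp
    hence "coeff R i = 0" by simp
    thus ?thesis using True by (auto simp: R_def coeff_sum coeff_pCons split: if_splits nat.splits)
  qed
  define P where "P = (\<Prod>i\<in>I. [:1, u i:])"
  define G where "G i = (\<Sum>k<n. monom ((- u i) ^ k) k)" for i
  have P1: "monom 1 n dvd P - 1"
  proof -
    have "coeff \<Phi> 0 = P"
      using ev[of 0] by (simp add: P_def poly_0_coeff_0)
    thus ?thesis using cf[of _ 0] by (auto simp: monom_1_dvd_iff' coeff_pCons split: nat.splits)
  qed
  \<comment> \<open>\<open>G i\<close> is the geometric series of 1 / (1 + u_i * t) cut off at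
    t^n.\<close>
  have geo: "[:1, u i:] * G i = 1 - monom ((- u i) ^ n) n" for i
  proof -
    have "(\<Sum>k<m. monom ((- u i) ^ k) k) * [:1, u i:] = 1 - monom ((- u i) ^ m) m" for m
    proof (induction m)
      case (Suc m)
      have "monom ((- u i) ^ m) m * [:1, u i:] = monom ((- u i) ^ m) m - monom ((- u i) ^ Suc m) (Suc m)"
        by (rule poly_eqI) (auto simp: coeff_monom_mult coeff_pCons split: nat.splits)
      thus ?case by (simp only: sum.lessThan_Suc distrib_right Suc) simp
    qed simp
    thus ?thesis by (simp add: G_def mult.commute)
  qed
  have rest: "monom 1 n dvd (\<Prod>j\<in>I - {i}. [:1, u j:]) - G i" if "i \<in> I" for i
  proof -
    define Pi where "Pi = (\<Prod>j\<in>I - {i}. [:1, u j:])"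
    have "P = [:1, u i:] * Pi" unfolding P_def Pi_def using assms(1) that by (rule prod.remove)
    hence "P * G i = Pi * (1 - monom ((- u i) ^ n) n)" by (metis geo mult.assoc mult.commute)
    hence "Pi - G i = (P - 1) * G i + Pi * monom ((- u i) ^ n) n" by (simp add: algebra_simps)
    moreover have "monom 1 n dvd monom ((- u i) ^ n) n" by (simp add: monom_1_dvd_iff')
    ultimately show ?thesis using P1 unfolding Pi_def by (metis dvd_add dvd_mult dvd_mult2)
  qed
  \<comment> \<open>The linear coefficient in d is the derivative at d = 0, to which the product
    rule applies.\<close>
  have c1: "coeff \<Phi> 1 = (\<Sum>i\<in>I. (\<Prod>j\<in>I - {i}. [:1, u j:]) * [:0, v i:])"
  proof -
    have "coeff \<Phi> 1 = poly (pderiv \<Phi>) 0" by (simp add: coeff_pderiv poly_0_coeff_0)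
    also have "\<dots> = (\<Sum>i\<in>I. (\<Prod>j\<in>I - {i}. [:1, u j:]) * [:0, v i:])"
      by (simp add: \<Phi>_def pderiv_prod poly_sum poly_prod pderiv_pCons)
    finally show ?thesis .
  qed
  have "monom 1 n dvd coeff \<Phi> 1" using cf by (simp add: monom_1_dvd_iff')
  moreover have "monom 1 n dvd (\<Sum>i\<in>I. ((\<Prod>j\<in>I - {i}. [:1, u j:]) - G i) * [:0, v i:])"
    using rest by (intro dvd_sum dvd_mult2)
  ultimately have "monom 1 n dvd coeff \<Phi> 1 - (\<Sum>i\<in>I. ((\<Prod>j\<in>I - {i}. [:1, u j:]) - G i) * [:0, v i:])"
    by (rule dvd_diff)
  hence "monom 1 n dvd (\<Sum>i\<in>I. G i * [:0, v i:])"
    unfolding c1 sum_subtractf[symmetric] left_diff_distrib[symmetric] by simp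
  hence "coeff (\<Sum>i\<in>I. G i * [:0, v i:]) (Suc j) = 0"
    using j by (simp add: monom_1_dvd_iff')
  moreover have "coeff (G i * [:0, v i:]) (Suc j) = (-1) ^ j * (v i * u i ^ j)" for i
  proof -
    have "coeff (G i * [:0, v i:]) (Suc j) = coeff (smult (v i) (G i)) j" by simp
    also have "\<dots> = v i * (- u i) ^ j" using j by (simp add: G_def coeff_sum)
    also have "\<dots> = (-1) ^ j * (v i * u i ^ j)" by (subst power_minus) simp
    finally show ?thesis .
  qed
  ultimately have "(-1) ^ j * (\<Sum>i\<in>I. v i * u i ^ j) = 0"
    by (simp only: coeff_sum sum_distrib_left)
  thus ?thesis by simp
qed

context square_field
begin

text \<open>Both sides have degree below the size of the field, so values decide; at every nonzero x
  both are 0, at 0 both are 1.\<close>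

lemma prod_nonzero_linear: "(\<Prod>d\<in>UNIV - {0}. [:1, d:]) = 1 - monom (1::'a) (q\<^sup>2 - 1)"
proof (rule poly_eqI_degree[of UNIV])
  fix x :: 'a
  show "poly (\<Prod>d\<in>UNIV - {0}. [:1, d:]) x = poly (1 - monom (1::'a) (q\<^sup>2 - 1)) x"
  proof (cases "x = 0")
    case True
    thus ?thesis using q2_gt by (simp add: poly_prod poly_monom power_0_left)
  next
    case False
    have "poly (\<Prod>d\<in>UNIV - {0}. [:1, d:]) x = 0"
      unfolding poly_prod using False by (intro prod_zero bexI[of _ "- 1 / x"]) auto
    thus ?thesis using power_card_minus_1[OF False] by (simp add: poly_monom)
  qed
next
  have "degree (\<Prod>d\<in>UNIV - {0::'a}. [:1, d:]) \<le> (\<Sum>d\<in>UNIV - {0::'a}. degree [:1, d:])"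
    using degree_prod_sum_le[of "UNIV - {0::'a}" "\<lambda>d. [:1, d:]"] by (simp add: comp_def)
  also have "\<dots> \<le> (\<Sum>d\<in>UNIV - {0::'a}. 1)" by (intro sum_mono) simp
  also have "\<dots> < card (UNIV :: 'a set)" using q2_gt by (simp add: card_F)
  finally show "degree (\<Prod>d\<in>UNIV - {0::'a}. [:1, d:]) < card (UNIV :: 'a set)" .
  have "degree (1 - monom (1::'a) (q\<^sup>2 - 1)) \<le> q\<^sup>2 - 1"
    by (intro degree_diff_le degree_monom_le) simp
  thus "degree (1 - monom (1::'a) (q\<^sup>2 - 1)) < card (UNIV :: 'a set)" using q2_gt by (simp add: card_F)
qed

lemma monom_dvd_power_q: "monom (1::'a) q dvd [:1, c:] ^ q - 1"
proof -
  have "[:1, c:] = 1 + [:0, c:]" by (simp add: one_pCons)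
  hence "[:1, c:] ^ q - 1 = [:0, c:] ^ q" by (simp only: frob_add_poly) simp
  also have "[:0, c:] = smult c (monom 1 1)" by (simp add: monom_altdef)
  also have "\<dots> ^ q = smult (c ^ q) (monom 1 q)" by (simp add: smult_power monom_power)
  finally show ?thesis by (simp add: dvd_smult)
qed

text \<open>Lines through the vertex with \<open>1\<close> and with \<open>q + 1\<close> points contribute the same factor
  modulo \<open>t ^ q\<close>, so the product is that over all slopes.\<close>

lemma prod_from_vertex:
  fixes B :: "('a \<times> 'a) set"
  assumes lines: "\<And>m b. card {x. (x, m * x + b) \<in> B} \<in> {1, q + 1}"
    and vertex: "(x1, 0) \<notin> B" and "c \<noteq> 0"
  shows "monom 1 q dvd (\<Prod>(x, w)\<in>{(x, w)\<in>B. w \<noteq> 0}. [:1, c * (x - x1) / w:]) - 1"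
proof -
  let ?h = "\<lambda>(x, w). [:1, c * (x - x1) / w:]"
  let ?g = "\<lambda>(x, w). w / (x - x1)"
  let ?I = "{(x, w)\<in>B. w \<noteq> 0 \<and> x \<noteq> x1}"
  \<comment> \<open>A point with \<open>x = x1\<close> has no finite slope from the vertex, but its
    factor is 1. All others are grouped by slope.\<close>
  have "(\<Prod>X\<in>{(x, w)\<in>B. w \<noteq> 0}. ?h X) = (\<Prod>X\<in>?I. ?h X)"
    by (rule prod.mono_neutral_right) (auto intro: finite_subset[OF _ finite_class.finite_UNIV])
  also have "\<dots> = (\<Prod>z\<in>UNIV - {0}. \<Prod>X\<in>{X \<in> ?I. ?g X = z}. ?h X)"
    by (rule prod.group[symmetric]) (auto intro: finite_subset[OF _ finite_class.finite_UNIV])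
  also have "\<dots> = (\<Prod>z\<in>UNIV - {0}. [:1, c / z:] ^ card {x. (x, z * x + (- z * x1)) \<in> B})"
  proof (rule prod.cong)
    fix z :: 'a assume z: "z \<in> UNIV - {0}"
    have "(\<Prod>X\<in>{X \<in> ?I. ?g X = z}. ?h X) = (\<Prod>X\<in>{X \<in> ?I. ?g X = z}. [:1, c / z:])"
      by (rule prod.cong) auto
    also have "\<dots> = [:1, c / z:] ^ card {X \<in> ?I. ?g X = z}" by simp
    also have "card {X \<in> ?I. ?g X = z} = card {x. (x, z * x + (- z * x1)) \<in> B}"
    proof (rule bij_betw_same_card[of fst], rule bij_betw_byWitness[where f' = "\<lambda>x. (x, z * x + (- z * x1))"])
      have "x \<noteq> x1" if "(x, z * x + (- z * x1)) \<in> B" for x using that vertex by auto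
      thus "(\<lambda>x. (x, z * x + (- z * x1))) ` {x. (x, z * x + (- z * x1)) \<in> B} \<subseteq> {X \<in> ?I. ?g X = z}"
        using z vertex by (auto simp: field_simps)
      have "w = z * x + (- z * x1)" if "w / (x - x1) = z" "x \<noteq> x1" for x w
        using that by (auto simp: field_simps)
      thus "\<forall>X\<in>{X \<in> ?I. ?g X = z}. (fst X, z * fst X + (- z * x1)) = X"
        "fst ` {X \<in> ?I. ?g X = z} \<subseteq> {x. (x, z * x + (- z * x1)) \<in> B}" by force+
    qed auto
    finally show "(\<Prod>X\<in>{X \<in> ?I. ?g X = z}. ?h X) = [:1, c / z:] ^ card {x. (x, z * x + (- z * x1)) \<in> B}" .
  qed simp
  finally have eq: "(\<Prod>X\<in>{(x, w)\<in>B. w \<noteq> 0}. ?h X) = 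
    (\<Prod>z\<in>UNIV - {0}. [:1, c / z:] ^ card {x. (x, z * x + (- z * x1)) \<in> B})" .
  have "monom 1 q dvd (\<Prod>z\<in>UNIV - {0}. [:1, c / z:] ^ card {x. (x, z * x + (- z * x1)) \<in> B})
      - (\<Prod>z\<in>UNIV - {0}. [:1, c / z:])"
  proof (rule dvd_prod_diff)
    fix z
    consider "card {x. (x, z * x + (- z * x1)) \<in> B} = 1" | "card {x. (x, z * x + (- z * x1)) \<in> B} = q + 1"
      using lines[of z "- z * x1"] by auto
    thus "monom 1 q dvd [:1, c / z:] ^ card {x. (x, z * x + (- z * x1)) \<in> B} - [:1, c / z:]"
    proof cases
      case 2
      have "[:1, c / z:] ^ (q + 1) - [:1, c / z:] = ([:1, c / z:] ^ q - 1) * [:1, c / z:]"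
        by (simp only: power_add power_one_right left_diff_distrib mult_1)
      thus ?thesis unfolding 2 using monom_dvd_power_q by (metis dvd_mult2)
    qed simp
  qed
  moreover have "(\<Prod>z\<in>UNIV - {0}. [:1, c / z:]) = (\<Prod>d\<in>UNIV - {0}. [:1, d:])"
    by (rule prod.reindex_bij_witness[of _ "\<lambda>d. c / d" "\<lambda>d. c / d"]) (use \<open>c \<noteq> 0\<close> in auto)
  moreover have "monom 1 q dvd monom (1::'a) (q\<^sup>2 - 1)" using q2_gt by (auto simp: monom_1_dvd_iff')
  ultimately have "monom 1 q dvd (\<Prod>z\<in>UNIV - {0}. [:1, c / z:] ^ card {x. (x, z * x + (- z * x1)) \<in> B})
      - (1 - monom 1 (q\<^sup>2 - 1)) - monom 1 (q\<^sup>2 - 1)"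
    by (simp only: prod_nonzero_linear) (rule dvd_diff)
  thus ?thesis unfolding eq by simp
qed

text \<open>Negative powers as ordinary powers. With \<open>inverse 0 = 0\<close> this also holds at
  0, so that points on the line itself drop out of the sums below.\<close>

lemma power_minus_eq_inverse:
  fixes d :: 'a assumes "0 < n" "n < q\<^sup>2 - 1"
  shows "d ^ (q\<^sup>2 - 1 - n) = inverse d ^ n"
proof (cases "d = 0")
  case False
  have "d ^ (q\<^sup>2 - 1 - n) * d ^ n = 1"
    using power_card_minus_1[OF False] assms by (simp flip: power_add)
  thus ?thesis using False by (simp add: field_simps)
qed (use assms in \<open>auto simp: power_0_left\<close>)

lemma q2_ge: assumes "q \<ge> 3" shows "q\<^sup>2 \<ge> 2 * q + 3"
proof -
  have "q * q \<ge> 3 * q" using assms by simp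
  thus ?thesis using assms unfolding power2_eq_square by linarith
qed

text \<open>Every point (x1, 0) off \<open>B\<close> gives one congruence with factors built from (x
  - x1) / w. As an affine function of x1 this is linear in a parameter in two ways, and the two
  choices of which part carries the parameter give the two families of sums.\<close>

lemma line_sums:
  fixes B :: "('a \<times> 'a) set"
  assumes lines: "\<And>m b. card {x. (x, m * x + b) \<in> B} \<in> {1, q + 1}"
    and q3: "q \<ge> 3" and n: "0 < n" "n < q"
  shows "(\<Sum>(x, w)\<in>B. x * w ^ (q\<^sup>2 - 1 - n)) = 0"
    and "(\<Sum>(x, w)\<in>B. x ^ (n - 1) * w ^ (q\<^sup>2 - 1 - n)) = 0"
proof -
  let ?I = "{(x, w)\<in>B. w \<noteq> 0}"
  have n': "n < q\<^sup>2 - 1" using n q2_ge[OF q3] by linarith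
  have pw: "w ^ (q\<^sup>2 - 1 - n) = 1 / w * (1 / w) ^ (n - 1)" for w :: 'a
    unfolding power_minus_eq_inverse[OF n(1) n'] using n by (simp add: power_eq_if inverse_eq_divide)
  have fin: "finite ?I" by (rule finite_subset[OF _ finite_class.finite_UNIV]) auto
  have "card {x. (x, 0) \<in> B} \<le> q + 1" using lines[of 0 0] by auto
  moreover have "card {x. (x, 0) \<notin> B} = q\<^sup>2 - card {x. (x, 0) \<in> B}"
    using card_Diff_subset[of "{x. (x, 0) \<in> B}" UNIV]
    by (simp add: card_F Collect_neg_eq Compl_eq_Diff_UNIV)
  \<comment> \<open>This is where q at least 3 matters: \<open>q\<close> vertices are needed, and
    the first sum has to discard x1 = 0.\<close>
  ultimately have good: "card {x. (x, 0) \<notin> B} \<ge> q + 1" using q2_ge[OF q3] by linarith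
  have "(\<Sum>X\<in>?I. (case X of (x, w) \<Rightarrow> x / w) * (case X of (x, w) \<Rightarrow> 1 / w) ^ (n - 1)) = 0"
  \<comment> \<open>Here u = 1 / w, v = x / w and d = - 1 / x1, because (1 - x / x1) / w = (- 1 /
    x1) * (x - x1) / w.\<close>
  proof (rule prod_linear_cong_1_imp[OF fin, of "(\<lambda>x1. - 1 / x1) ` ({x. (x, 0) \<notin> B} - {0})" q])
    have "card ((\<lambda>x1. - 1 / x1) ` ({x. (x, 0) \<notin> B} - {0})) = card ({x. (x, 0) \<notin> B} - {0})"
      by (rule card_image) (auto simp: inj_on_def)
    also have "\<dots> \<ge> card {x. (x, 0) \<notin> B} - 1" by (simp add: card_Diff_singleton_if)
    finally show "q \<le> card ((\<lambda>x1. - 1 / x1) ` ({x. (x, 0) \<notin> B} - {0}))" using good by linarith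
    fix d assume "d \<in> (\<lambda>x1. - 1 / x1) ` ({x. (x, 0) \<notin> B} - {0})"
    then obtain x1 where x1: "(x1, 0) \<notin> B" "x1 \<noteq> 0" "d = - 1 / x1" by auto
    have "(\<Prod>i\<in>?I. [:1, (case i of (x, w) \<Rightarrow> 1 / w) + d * (case i of (x, w) \<Rightarrow> x / w):]) =
       (\<Prod>(x, w)\<in>?I. [:1, (- 1 / x1) * (x - x1) / w:])"
      using x1 by (intro prod.cong) (auto simp: field_simps)
    thus "monom 1 q dvd (\<Prod>i\<in>?I. [:1, (case i of (x, w) \<Rightarrow> 1 / w) + d * (case i of (x, w) \<Rightarrow> x / w):]) - 1"
      using prod_from_vertex[OF lines x1(1), of "- 1 / x1"] x1(2) by simp
  qed (use n in auto)
  also have "(\<Sum>X\<in>?I. (case X of (x, w) \<Rightarrow> x / w) * (case X of (x, w) \<Rightarrow> 1 / w) ^ (n - 1)) =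
      (\<Sum>X\<in>?I. (case X of (x, w) \<Rightarrow> x * w ^ (q\<^sup>2 - 1 - n)))"
    unfolding pw by (rule sum.cong) (auto simp: power_divide)
  also have "\<dots> = (\<Sum>X\<in>B. (case X of (x, w) \<Rightarrow> x * w ^ (q\<^sup>2 - 1 - n)))"
    by (rule sum.mono_neutral_left) (use n' in \<open>auto intro: finite_subset[OF _ finite_class.finite_UNIV]\<close>)
  finally show "(\<Sum>(x, w)\<in>B. x * w ^ (q\<^sup>2 - 1 - n)) = 0" by simp
  have "(\<Sum>X\<in>?I. (case X of (x, w) \<Rightarrow> 1 / w) * (case X of (x, w) \<Rightarrow> x / w) ^ (n - 1)) = 0"
  \<comment> \<open>Now u = x / w, v = 1 / w and d = - x1.\<close>
  proof (rule prod_linear_cong_1_imp[OF fin, of "uminus ` {x. (x, 0) \<notin> B}" q])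
    show "q \<le> card (uminus ` {x. (x, 0) \<notin> B})" using good by (simp add: card_image)
    fix d assume "d \<in> uminus ` {x. (x, 0) \<notin> B}"
    then obtain x1 where x1: "(x1, 0) \<notin> B" "d = - x1" by auto
    have "(\<Prod>i\<in>?I. [:1, (case i of (x, w) \<Rightarrow> x / w) + d * (case i of (x, w) \<Rightarrow> 1 / w):]) =
       (\<Prod>(x, w)\<in>?I. [:1, 1 * (x - x1) / w:])"
      using x1 by (intro prod.cong) (auto simp: field_simps)
    thus "monom 1 q dvd (\<Prod>i\<in>?I. [:1, (case i of (x, w) \<Rightarrow> x / w) + d * (case i of (x, w) \<Rightarrow> 1 / w):]) - 1"
      using prod_from_vertex[OF lines x1(1), of 1] by simp
  qed (use n in auto)
  also have "(\<Sum>X\<in>?I. (case X of (x, w) \<Rightarrow> 1 / w) * (case X of (x, w) \<Rightarrow> x / w) ^ (n - 1)) =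
      (\<Sum>X\<in>?I. (case X of (x, w) \<Rightarrow> x ^ (n - 1) * w ^ (q\<^sup>2 - 1 - n)))"
    unfolding pw by (rule sum.cong) (auto simp: power_divide)
  also have "\<dots> = (\<Sum>X\<in>B. (case X of (x, w) \<Rightarrow> x ^ (n - 1) * w ^ (q\<^sup>2 - 1 - n)))"
    by (rule sum.mono_neutral_left) (use n' in \<open>auto intro: finite_subset[OF _ finite_class.finite_UNIV]\<close>)
  finally show "(\<Sum>(x, w)\<in>B. x ^ (n - 1) * w ^ (q\<^sup>2 - 1 - n)) = 0" by simp
qed

end

section \<open>Binomial coefficients and moments\<close>

context square_field
begin

lemma minus_one_power_q: "(- 1 :: 'a) ^ q = - 1"
  using frob_minus[of 1] by simp

lemma minus_one_power_q2: "(- 1 :: 'a) ^ (q\<^sup>2 - 1) = 1"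
  by (rule power_card_minus_1) simp

lemma minus_one_power_q_minus_1: "(- 1 :: 'a) ^ (q - 1) = 1"
  by (rule power_q_minus_1_base) (auto simp: base_iff minus_one_power_q)

text \<open>The r-th power of (1 + t)^q = 1 + t^q has no terms of degree strictly between 0 and
  q.\<close>

lemma binomial_mult_q: 
  assumes "0 < k" "k < q" shows "of_nat ((q * r) choose k) = (0::'a)"
proof -
  have "[:1, 1:] ^ q - 1 dvd ([:1, 1:] ^ q) ^ r - (1::'a poly) ^ r"
    by (simp only: power_diff_sumr2) (rule dvd_triv_left)
  hence "monom (1::'a) q dvd [:1, 1:] ^ (q * r) - 1"
    using monom_dvd_power_q[of 1] by (auto simp: power_mult intro: dvd_trans)
  hence "coeff ([:1, 1::'a:] ^ (q * r)) k = 0"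
    using assms by (auto simp: monom_1_dvd_iff' coeff_1)
  thus ?thesis
    by (cases "k \<le> q * r") (simp_all add: coeff_linear_poly_power binomial_eq_0)
qed

text \<open>Pascal's rule together with the vanishing of the row above makes consecutive entries
  negatives of each other.\<close>

lemma binomial_mult_q_minus_1:
  assumes "r > 0" "k < q" shows "of_nat ((q * r - 1) choose k) = (- 1 :: 'a) ^ k"
  using assms(2)
proof (induction k)
  case (Suc k)
  obtain n where n: "q * r = Suc n" using assms(1) q_gt_1 by (cases "q * r") auto
  have "of_nat ((q * r) choose Suc k) = (0 :: 'a)" using Suc.prems by (intro binomial_mult_q) auto
  hence "of_nat (n choose k) + of_nat (n choose Suc k) = (0 :: 'a)" by (simp add: n)
  thus ?case using Suc by (simp add: n add_eq_0_iff)
qed simp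

lemma binomial_q2_minus_1:
  assumes "k < q\<^sup>2" shows "of_nat ((q\<^sup>2 - 1) choose k) = (- 1 :: 'a) ^ k"
  using assms
proof (induction k)
  case (Suc k)
  obtain n where n: "q\<^sup>2 = Suc n" using q_gt_1 by (cases "q\<^sup>2") auto
  have "[:1, 1:] ^ (q\<^sup>2) = 1 + monom (1::'a) (q\<^sup>2)"
  proof -
    have "[:1, 1:] ^ q = 1 + monom (1::'a) q"
    proof -
      have "[:1, 1:] = 1 + monom (1::'a) 1" by (simp add: monom_altdef one_pCons)
      thus ?thesis by (simp only: frob_add_poly) (simp add: monom_power)
    qed
    hence "([:1, 1:] ^ q) ^ q = (1 + monom (1::'a) q) ^ q" by simp
    thus ?thesis by (simp only: frob_add_poly power2_eq_square power_mult) (simp add: monom_power)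
  qed
  hence "coeff ([:1, 1::'a:] ^ (q\<^sup>2)) (Suc k) = 0"
    using Suc.prems by (simp add: coeff_1)
  hence "of_nat ((q\<^sup>2) choose Suc k) = (0 :: 'a)" using Suc.prems by (simp add: coeff_linear_poly_power)
  hence "of_nat (n choose k) + of_nat (n choose Suc k) = (0 :: 'a)" by (simp add: n)
  thus ?case using Suc by (simp add: n add_eq_0_iff)
qed simp

text \<open>A case of Lucas' congruence, but with the whole number \<open>r\<close> rather than a
  base p digit: the low part \<open>s\<close> drops out by Vandermonde, and absorption turns the
  rest into r times an entry equal to (-1)^(q - 1) = 1.\<close>

lemma binomial_choose_q:
  assumes "s < q" shows "of_nat ((q * r + s) choose q) = (of_nat r :: 'a)"
proof -
  have "((q * r + s) choose q) = (\<Sum>k\<le>q. ((q * r) choose k) * (s choose (q - k)))"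
    by (rule vandermonde[symmetric])
  hence "of_nat ((q * r + s) choose q) = (\<Sum>k\<le>q. of_nat ((q * r) choose k) * of_nat (s choose (q - k)) :: 'a)"
    by simp
  also have "\<dots> = (\<Sum>k\<in>{q}. of_nat ((q * r) choose k) * of_nat (s choose (q - k)))"
  proof (rule sum.mono_neutral_right)
    show "\<forall>k\<in>{..q} - {q}. of_nat ((q * r) choose k) * of_nat (s choose (q - k)) = (0 :: 'a)"
    proof
      fix k assume k: "k \<in> {..q} - {q}"
      show "of_nat ((q * r) choose k) * of_nat (s choose (q - k)) = (0 :: 'a)"
        using k assms binomial_mult_q[of k r] by (cases "k = 0") (auto simp: binomial_eq_0)
    qed
  qed auto
  also have "\<dots> = of_nat ((q * r) choose q)" by simp
  also have "\<dots> = of_nat r"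
  proof (cases "r = 0")
    case False
    have "q * ((q * r) choose q) = (q * r) * ((q * r - 1) choose (q - 1))"
      using q_gt_1 False times_binomial_minus1_eq[of q "q * r"] by simp
    hence "((q * r) choose q) = r * ((q * r - 1) choose (q - 1))" using q_gt_1 by simp
    thus ?thesis using binomial_mult_q_minus_1[of r "q - 1"] False q_gt_1 minus_one_power_q_minus_1 by simp
  qed (use q_gt_1 in \<open>simp add: binomial_eq_0\<close>)
  finally show ?thesis .
qed

text \<open>Multiplying by \<open>x ^ j\<close> and summing over \<open>x\<close> turns inverse power sums at all poles into
  moments.\<close>

lemma moments_from_inverse_powers:
  fixes h p :: "'i \<Rightarrow> 'a"
  assumes "finite I" and sums: "\<And>x. (\<Sum>i\<in>I. h i * (p i - x) ^ (q\<^sup>2 - 1 - n)) = \<rho>"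
    and n: "0 < n" "n < q\<^sup>2 - 1" and j: "n \<le> j" "j \<le> q\<^sup>2 - 1"
  shows "(- 1) ^ n * of_nat (j choose n) * (\<Sum>i\<in>I. h i * p i ^ (j - n)) = - \<rho> * (\<Sum>x\<in>UNIV. x ^ j)"
proof -
  have inner: "(\<Sum>x\<in>UNIV. x ^ j * (y - x) ^ (q\<^sup>2 - 1 - n)) = - ((- 1) ^ n * of_nat (j choose n) * y ^ (j - n))" for y :: 'a
  proof -
    have "(\<Sum>x\<in>UNIV. x ^ j * (y - x) ^ (q\<^sup>2 - 1 - n)) = (\<Sum>d\<in>UNIV. (- d + y) ^ j * d ^ (q\<^sup>2 - 1 - n))"
      by (rule sum.reindex_bij_witness[of _ "\<lambda>d. y - d" "\<lambda>x. y - x"]) auto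
    also have "\<dots> = (\<Sum>d\<in>UNIV. \<Sum>k\<le>j. (- 1) ^ k * of_nat (j choose k) * y ^ (j - k) * d ^ (k + (q\<^sup>2 - 1 - n)))"
    proof (rule sum.cong[OF refl])
      fix d :: 'a
      have "(- d + y) ^ j = (\<Sum>k\<le>j. of_nat (j choose k) * ((- 1) ^ k * d ^ k) * y ^ (j - k))"
        by (simp only: binomial_ring power_minus[of d])
      thus "(- d + y) ^ j * d ^ (q\<^sup>2 - 1 - n) =
          (\<Sum>k\<le>j. (- 1) ^ k * of_nat (j choose k) * y ^ (j - k) * d ^ (k + (q\<^sup>2 - 1 - n)))"
        by (simp only: sum_distrib_right sum_distrib_left power_add mult_ac)
    qed
    also have "\<dots> = (\<Sum>k\<le>j. (- 1) ^ k * of_nat (j choose k) * y ^ (j - k) * (\<Sum>d\<in>UNIV. d ^ (k + (q\<^sup>2 - 1 - n))))"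
      by (subst sum.swap) (simp add: sum_distrib_left)
    also have "\<dots> = (\<Sum>k\<in>{n}. (- 1) ^ k * of_nat (j choose k) * y ^ (j - k) * (\<Sum>d\<in>UNIV. d ^ (k + (q\<^sup>2 - 1 - n))))"
    \<comment> \<open>A power sum over the field survives only at positive multiples of q^2 - 1. The
      exponent equals q^2 - 1 exactly for k = n, and the bound on \<open>j\<close> keeps it below
      twice that.\<close>
    proof (rule sum.mono_neutral_right)
      have "\<not> (q\<^sup>2 - 1) dvd k + (q\<^sup>2 - 1 - n)" if k: "k \<le> j" "k \<noteq> n" for k
      proof
        assume "(q\<^sup>2 - 1) dvd k + (q\<^sup>2 - 1 - n)"
        then obtain c where c: "k + (q\<^sup>2 - 1 - n) = (q\<^sup>2 - 1) * c" by auto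
        have "c \<noteq> 0" using c n by (intro notI) simp
        moreover have "c \<noteq> 1" using c k n by auto
        ultimately have "c \<ge> 2" by linarith
        hence "(q\<^sup>2 - 1) * c \<ge> (q\<^sup>2 - 1) * 2" by (rule mult_le_mono2)
        thus False using c n j k by linarith
      qed
      thus "\<forall>k\<in>{..j} - {n}. (- 1) ^ k * of_nat (j choose k) * y ^ (j - k) * (\<Sum>d\<in>UNIV. d ^ (k + (q\<^sup>2 - 1 - n))) = 0"
        by (auto simp: sum_power_UNIV)
    qed (use j in auto)
    also have "\<dots> = - ((- 1) ^ n * of_nat (j choose n) * y ^ (j - n))"
      using n by (simp add: sum_power_UNIV)
    finally show ?thesis .
  qed
  have "\<rho> * (\<Sum>x\<in>UNIV. x ^ j) = (\<Sum>x\<in>UNIV. x ^ j * (\<Sum>i\<in>I. h i * (p i - x) ^ (q\<^sup>2 - 1 - n)))"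
    unfolding sums by (simp add: sum_distrib_left mult.commute)
  also have "\<dots> = (\<Sum>i\<in>I. h i * (\<Sum>x\<in>UNIV. x ^ j * (p i - x) ^ (q\<^sup>2 - 1 - n)))"
    by (simp add: sum_distrib_left mult_ac) (rule sum.swap)
  also have "\<dots> = - ((- 1) ^ n * of_nat (j choose n) * (\<Sum>i\<in>I. h i * p i ^ (j - n)))"
    unfolding inner by (simp add: sum_distrib_left sum_negf mult_ac)
  finally show ?thesis by simp
qed

text \<open>The choice j = q * r - 1 makes the binomial factor a sign, so the moment itself must
  vanish.\<close>

lemma moments_from_inverse_powers_0:
  fixes h p :: "'i \<Rightarrow> 'a"
  assumes "finite I" and sums: "\<And>x. (\<Sum>i\<in>I. h i * (p i - x) ^ (q\<^sup>2 - 1 - n)) = 0"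
    and n: "0 < n" "n < q" and q3: "q \<ge> 3" and r: "0 < r" "r \<le> q"
  shows "(\<Sum>i\<in>I. h i * p i ^ (q * r - 1 - n)) = 0"
proof -
  have n': "n < q\<^sup>2 - 1" using n q2_ge[OF q3] by linarith
  have "q * r \<ge> q * 1" using r by (intro mult_le_mono2) simp
  hence j: "n \<le> q * r - 1" using n by linarith
  have j': "q * r - 1 \<le> q\<^sup>2 - 1" using r by (simp add: power2_eq_square diff_le_mono)
  have "(- 1) ^ n * of_nat ((q * r - 1) choose n) * (\<Sum>i\<in>I. h i * p i ^ (q * r - 1 - n)) = 0"
    using moments_from_inverse_powers[OF assms(1) sums n(1) n' j j'] by simp
  thus ?thesis using binomial_mult_q_minus_1[OF r(1) n(2)] by simp
qed

text \<open>This is 1 - (y - z)^(q^2 - 1); the binomial coefficients are signs that cancel those of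
  the powers of - z. It serves for interpolation.\<close>

lemma indicator_expand: 
  "(if y = z then 1 else 0 :: 'a) = 1 - (\<Sum>e\<le>q\<^sup>2 - 1. z ^ (q\<^sup>2 - 1 - e) * y ^ e)"
proof -
  have "(\<Sum>e\<le>q\<^sup>2 - 1. z ^ (q\<^sup>2 - 1 - e) * y ^ e) = (y - z) ^ (q\<^sup>2 - 1)"
  proof -
    have "(y + (- z)) ^ (q\<^sup>2 - 1) = (\<Sum>e\<le>q\<^sup>2 - 1. of_nat ((q\<^sup>2 - 1) choose e) * y ^ e * (- z) ^ (q\<^sup>2 - 1 - e))"
      by (rule binomial_ring)
    also have "\<dots> = (\<Sum>e\<le>q\<^sup>2 - 1. z ^ (q\<^sup>2 - 1 - e) * y ^ e)"
    proof (rule sum.cong)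
      fix e assume e: "e \<in> {..q\<^sup>2 - 1}"
      have "(- 1 :: 'a) ^ e * (- 1) ^ (q\<^sup>2 - 1 - e) = (- 1) ^ (q\<^sup>2 - 1)"
        using e by (metis atMost_iff le_add_diff_inverse power_add)
      hence "(- 1 :: 'a) ^ e * (- z) ^ (q\<^sup>2 - 1 - e) = z ^ (q\<^sup>2 - 1 - e)"
        by (subst power_minus) (simp only: mult.assoc[symmetric] minus_one_power_q2 mult_1)
      moreover have "of_nat ((q\<^sup>2 - 1) choose e) = (- 1 :: 'a) ^ e"
        using e q2_gt by (intro binomial_q2_minus_1) auto
      ultimately show "of_nat ((q\<^sup>2 - 1) choose e) * y ^ e * (- z) ^ (q\<^sup>2 - 1 - e) = z ^ (q\<^sup>2 - 1 - e) * y ^ e"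
        by (metis mult.assoc mult.commute)
    qed simp
    finally show ?thesis by simp
  qed
  thus ?thesis using power_card_minus_1[of "y - z"] q2_gt by (auto simp: power_0_left)
qed

text \<open>Up to sign the logarithmic derivative of X^q - X, the polynomial with root set
  \<open>base\<close>, at b; its derivative is the constant -1.\<close>

lemma sum_inverse_base:
  assumes "b \<notin> base"
  shows "(\<Sum>c\<in>base. 1 / (c - b)) = 1 / (b ^ q - b)"
proof -
  have w: "b ^ q - b \<noteq> 0" using assms by (simp add: base_iff)
  have "1 / (c - b) = (1 - (c - b) ^ (q - 1)) / (b ^ q - b)" if c: "c \<in> base" for c
  proof -
    have nz: "c - b \<noteq> 0" using c assms by auto
    have "(c - b) ^ (q - 1) * (c - b) = (c - b) ^ q" using q_gt_1 by (intro power_minus_mult) simp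
    also have "\<dots> = (c - b) - (b ^ q - b)" using c by (simp add: frob_diff base_iff)
    finally have "(1 - (c - b) ^ (q - 1)) * (c - b) = b ^ q - b" by (simp add: algebra_simps)
    thus ?thesis using nz w by (simp add: field_simps)
  qed
  hence "(\<Sum>c\<in>base. 1 / (c - b)) = (\<Sum>c\<in>base. 1 - (c - b) ^ (q - 1)) / (b ^ q - b)"
    by (simp add: sum_divide_distrib)
  also have "(\<Sum>c\<in>base. 1 - (c - b) ^ (q - 1)) = - (\<Sum>c\<in>base. (c - b) ^ (q - 1))"
    by (simp add: sum_subtractf card_base)
  also have "(\<Sum>c\<in>base. (c + (- b)) ^ (q - 1)) = (\<Sum>c\<in>base. \<Sum>k\<le>q - 1. of_nat ((q - 1) choose k) * c ^ k * (- b) ^ (q - 1 - k))"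
    by (simp only: binomial_ring)
  hence "(\<Sum>c\<in>base. (c - b) ^ (q - 1)) = (\<Sum>k\<le>q - 1. of_nat ((q - 1) choose k) * (- b) ^ (q - 1 - k) * (\<Sum>c\<in>base. c ^ k))"
    by (subst (asm) sum.swap) (simp add: sum_distrib_left sum_distrib_right mult_ac)
  also have "\<dots> = (\<Sum>k\<in>{q - 1}. of_nat ((q - 1) choose k) * (- b) ^ (q - 1 - k) * (\<Sum>c\<in>base. c ^ k))"
    by (rule sum.mono_neutral_right) (auto simp: sum_power_base)
  also have "\<dots> = - 1" by (simp add: sum_power_base)
  finally show ?thesis by simp
qed

end

section \<open>Exponents of a norm function\<close>

text \<open>The properties shared by \<open>f\<close> and by \<open>dual\<close>. The restrictions
  on exponents derived here then apply to both factors of the product in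
  \<open>f_dual\<close>.\<close>

locale norm_function = square_field q F for q and F :: "'a::{field,finite} itself" +
  fixes f :: "'a \<Rightarrow> 'a"
  assumes f_base: "f y \<in> base" and f_zero: "f y = 0 \<longleftrightarrow> y \<in> base"
    and f_line: "card {x. x ^ (q + 1) = f (m * x + b)} \<in> {1, q + 1}"
begin

definition arc :: "('a \<times> 'a) set" where
  "arc = {(x, y). x ^ (q + 1) = f y}"

lemma arc_line_sums:
  assumes "q \<ge> 3" "0 < n" "n < q"
  shows "(\<Sum>(x, y)\<in>arc. x * (y - (m * x + b)) ^ (q\<^sup>2 - 1 - n)) = 0"
    and "(\<Sum>(x, y)\<in>arc. x ^ (n - 1) * (y - (m * x + b)) ^ (q\<^sup>2 - 1 - n)) = 0"
proof -
  define B where "B = {(x, w). (x, m * x + b + w) \<in> arc}"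
  have lines: "card {x. (x, k * x + c) \<in> B} \<in> {1, q + 1}" for k c
    using f_line[of "m + k" "b + c"] by (simp add: B_def arc_def algebra_simps)
  have tr: "(\<Sum>(x, y)\<in>arc. g x (y - (m * x + b))) = (\<Sum>(x, w)\<in>B. g x w)" for g :: "'a \<Rightarrow> 'a \<Rightarrow> 'a"
    by (rule sum.reindex_bij_witness[of _ "\<lambda>(x, w). (x, m * x + b + w)" "\<lambda>(x, y). (x, y - (m * x + b))"])
      (auto simp: B_def)
  show "(\<Sum>(x, y)\<in>arc. x * (y - (m * x + b)) ^ (q\<^sup>2 - 1 - n)) = 0"
    using tr[of "\<lambda>x w. x * w ^ (q\<^sup>2 - 1 - n)"] line_sums(1)[OF lines assms] by simp
  show "(\<Sum>(x, y)\<in>arc. x ^ (n - 1) * (y - (m * x + b)) ^ (q\<^sup>2 - 1 - n)) = 0"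
    using tr[of "\<lambda>x w. x ^ (n - 1) * w ^ (q\<^sup>2 - 1 - n)"] line_sums(2)[OF lines assms] by simp
qed

text \<open>Each ordinate carries 1 or q + 1 points of the arc, and both numbers are 1 in the
  field.\<close>

lemma sum_arc_norm: "(\<Sum>(x, y)\<in>arc. g (x ^ (q + 1)) y) = (\<Sum>y\<in>UNIV. g (f y) y :: 'a)"
proof -
  have "(\<Sum>X\<in>arc. (case X of (x, y) \<Rightarrow> g (x ^ (q + 1)) y)) =
      (\<Sum>y\<in>UNIV. \<Sum>X\<in>{X \<in> arc. snd X = y}. case X of (x, y) \<Rightarrow> g (x ^ (q + 1)) y)"
    by (rule sum.group[symmetric]) (auto intro: finite_subset[OF _ finite_class.finite_UNIV])
  also have "\<dots> = (\<Sum>y\<in>UNIV. g (f y) y)"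
  proof (rule sum.cong[OF refl])
    fix y
    have "(\<Sum>X\<in>{X \<in> arc. snd X = y}. case X of (x, y) \<Rightarrow> g (x ^ (q + 1)) y) =
        (\<Sum>X\<in>{X \<in> arc. snd X = y}. g (f y) y)"
      by (rule sum.cong) (auto simp: arc_def)
    also have "\<dots> = of_nat (card {X \<in> arc. snd X = y}) * g (f y) y" by simp
    also have "card {X \<in> arc. snd X = y} = card {x. x ^ (q + 1) = f y}"
      by (rule bij_betw_same_card[of fst], rule bij_betw_byWitness[where f' = "\<lambda>x. (x, y)"])
        (auto simp: arc_def)
    also have "of_nat \<dots> = (1::'a)" using card_norm_fibre[OF f_base, of y] by simp
    finally show "(\<Sum>X\<in>{X \<in> arc. snd X = y}. case X of (x, y) \<Rightarrow> g (x ^ (q + 1)) y) = g (f y) y" by simp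
  qed
  finally show ?thesis .
qed

text \<open>Moments of the inverse powers at all intercepts give a sum over the arc of x * (y - m *
  x)^e that vanishes for every slope m. As a polynomial in m it has degree e < q^2, so every
  coefficient is 0; the one of m^q contains x^(q + 1), which is f y on the arc.\<close>

lemma moment_eq_0_1:
  assumes q3: "q \<ge> 3" and a: "0 < a" "a < q" and b: "0 < b" "b < q" and nz: "of_nat b \<noteq> (0::'a)"
  shows "(\<Sum>y\<in>UNIV. f y * y ^ (q\<^sup>2 - 1 - (a + q * b))) = 0"
proof -
  \<comment> \<open>The exponent q * r - 1 - a with r = q - b + 1. Then e - q is the exponent
    wanted, and e choose q equals q - b, that is - b, in the field.\<close>
  define e where "e = q * (q - b) + (q - 1 - a)"
  have e: "e = q * (q - b + 1) - 1 - a" using a by (simp add: e_def)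
  have qb: "q * (q - b) \<ge> q * 1" using b by (intro mult_le_mono2) simp
  have eq: "q \<le> e" using qb unfolding e_def by linarith
  have "q * (q - b + 1) \<le> q * q" using b by (intro mult_le_mono2) simp
  hence e_less: "e < q\<^sup>2" using a qb by (simp add: e power2_eq_square)
  have e_minus: "e - q = q\<^sup>2 - 1 - (a + q * b)"
  proof -
    obtain c where c: "q = b + Suc c" using b(2) less_imp_Suc_add by auto
    have "q * q = q * b + q * Suc c" by (subst (2) c) (simp only: distrib_left)
    moreover have "q - b = Suc c" using c by simp
    ultimately show ?thesis using a by (simp add: e_def power2_eq_square)
  qed
  have van: "(\<Sum>(x, y)\<in>arc. x * (y - m * x) ^ e) = 0" for m
  proof -
    have "(\<Sum>X\<in>arc. fst X * (snd X - m * fst X) ^ (q * (q - b + 1) - 1 - a)) = 0"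
    proof (rule moments_from_inverse_powers_0[OF _ _ a q3])
      show "(\<Sum>X\<in>arc. fst X * (snd X - m * fst X - x) ^ (q\<^sup>2 - 1 - a)) = 0" for x
        using arc_line_sums(1)[OF q3 a, of m x] by (simp add: case_prod_unfold diff_diff_eq)
    qed (use b in \<open>auto intro: finite_subset[OF _ finite_class.finite_UNIV]\<close>)
    thus ?thesis by (simp add: e case_prod_unfold)
  qed
  define R where "R = (\<Sum>k\<le>e. monom (of_nat (e choose k) * (- 1) ^ k * (\<Sum>(x, y)\<in>arc. x ^ (k + 1) * y ^ (e - k))) k)"
  have "R = 0"
  proof (rule poly_eqI_degree[of UNIV])
    fix m :: 'a
    have "poly R m = (\<Sum>k\<le>e. (\<Sum>X\<in>arc. of_nat (e choose k) * (- 1) ^ k * (fst X ^ (k + 1) * snd X ^ (e - k)) * m ^ k))"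
      by (simp add: R_def poly_sum poly_monom case_prod_unfold sum_distrib_left sum_distrib_right)
    also have "\<dots> = (\<Sum>X\<in>arc. \<Sum>k\<le>e. of_nat (e choose k) * (- 1) ^ k * (fst X ^ (k + 1) * snd X ^ (e - k)) * m ^ k)"
      by (rule sum.swap)
    also have "\<dots> = (\<Sum>X\<in>arc. fst X * (snd X - m * fst X) ^ e)"
    proof (rule sum.cong[OF refl])
      fix X :: "'a \<times> 'a"
      have "(- (m * fst X) + snd X) ^ e = (\<Sum>k\<le>e. of_nat (e choose k) * ((- 1) ^ k * (m ^ k * fst X ^ k)) * snd X ^ (e - k))"
        by (simp only: binomial_ring power_minus[of "m * fst X"] power_mult_distrib)
      thus "(\<Sum>k\<le>e. of_nat (e choose k) * (- 1) ^ k * (fst X ^ (k + 1) * snd X ^ (e - k)) * m ^ k) = fst X * (snd X - m * fst X) ^ e"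
        by (simp add: sum_distrib_left mult_ac)
    qed
    finally show "poly R m = poly 0 m" using van[of m] by (simp add: case_prod_unfold)
  next
    have "degree R \<le> e" unfolding R_def
      by (intro degree_sum_le) (auto intro: order_trans[OF degree_monom_le])
    thus "degree R < card (UNIV :: 'a set)" using e_less by (simp add: card_F)
  qed (use q_gt_1 in \<open>simp add: card_F\<close>)
  hence "coeff R q = 0" by simp
  hence "of_nat (e choose q) * (- 1) ^ q * (\<Sum>(x, y)\<in>arc. x ^ (q + 1) * y ^ (e - q)) = 0"
    using eq by (simp add: R_def coeff_sum)
  moreover have "of_nat (e choose q) = (- of_nat b :: 'a)"
    using binomial_choose_q[of "q - 1 - a" "q - b"] a b by (simp add: e_def of_nat_diff)
  ultimately have "(\<Sum>(x, y)\<in>arc. x ^ (q + 1) * y ^ (e - q)) = 0"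
    using nz by simp
  thus ?thesis using sum_arc_norm[of "\<lambda>v y. v * y ^ (e - q)"] by (simp add: e_minus)
qed

text \<open>The Frobenius map fixes the values of \<open>f\<close> and exchanges the two digits of
  an exponent in base \<open>q\<close>, since y^(q^2) = y.\<close>

lemma moment_conj:
  assumes a: "a < q" and b: "b < q"
  shows "(\<Sum>y\<in>UNIV. f y * y ^ (q\<^sup>2 - 1 - (b + q * a))) = (\<Sum>y\<in>UNIV. f y * y ^ (q\<^sup>2 - 1 - (a + q * b))) ^ q"
proof -
  have ex: "q\<^sup>2 - 1 - (a + q * b) = (q - 1 - a) + q * (q - 1 - b)" if ab: "a < q" "b < q" for a b
  proof -
    obtain c where c: "q = Suc (b + c)" using ab(2) less_imp_Suc_add by auto
    have "q * q = q * b + q * c + q" by (subst (2) c) (simp add: algebra_simps)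
    moreover have "q - 1 - b = c" using c by simp
    ultimately show ?thesis using ab(1) by (simp add: power2_eq_square)
  qed
  have "(\<Sum>y\<in>UNIV. f y * y ^ (q\<^sup>2 - 1 - (a + q * b))) ^ q = (\<Sum>y\<in>UNIV. f y * (y ^ (q\<^sup>2 - 1 - (a + q * b))) ^ q)"
    using f_base by (simp add: frob_sum power_mult_distrib base_iff)
  also have "\<dots> = (\<Sum>y\<in>UNIV. f y * y ^ (q\<^sup>2 - 1 - (b + q * a)))"
  proof (rule sum.cong[OF refl])
    fix y :: 'a
    have "(y ^ (q\<^sup>2 - 1 - (a + q * b))) ^ q = (y ^ (q - 1 - a)) ^ q * ((y ^ (q - 1 - b)) ^ q) ^ q"
      unfolding ex[OF a b] mult.commute[of q "q - 1 - b"] by (simp only: power_add power_mult_distrib power_mult)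
    also have "\<dots> = y ^ (q\<^sup>2 - 1 - (b + q * a))"
      unfolding ex[OF b a] mult.commute[of q "q - 1 - a"] power_q_q by (simp only: power_add power_mult) (rule mult.commute)
    finally show "f y * (y ^ (q\<^sup>2 - 1 - (a + q * b))) ^ q = f y * y ^ (q\<^sup>2 - 1 - (b + q * a))" by simp
  qed
  finally show ?thesis by simp
qed

lemma moment_eq_0:
  assumes q3: "q \<ge> 3" and a: "0 < a" "a < q" and b: "0 < b" "b < q" 
    and nz: "of_nat a \<noteq> (0::'a) \<or> of_nat b \<noteq> (0::'a)"
  shows "(\<Sum>y\<in>UNIV. f y * y ^ (q\<^sup>2 - 1 - (a + q * b))) = 0"
proof (cases "of_nat b = (0::'a)")
  case True
  hence "(\<Sum>y\<in>UNIV. f y * y ^ (q\<^sup>2 - 1 - (b + q * a))) = 0" using nz assms by (intro moment_eq_0_1) auto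
  thus ?thesis unfolding moment_conj[OF a(2) b(2)] using q_gt_1 by simp
qed (use moment_eq_0_1[OF q3 a b] in auto)

text \<open>Interpolation by indicators. The constant term cancels because f 0 = 0 allows the factor
  z^(q^2 - 1) in the sum of all values.\<close>

lemma f_expand: "f y = - (\<Sum>e\<in>{1..q\<^sup>2 - 1}. (\<Sum>z\<in>UNIV. f z * z ^ (q\<^sup>2 - 1 - e)) * y ^ e)"
proof -
  have *: "f y = (\<Sum>z\<in>UNIV. f z) - (\<Sum>e\<le>q\<^sup>2 - 1. (\<Sum>z\<in>UNIV. f z * z ^ (q\<^sup>2 - 1 - e)) * y ^ e)" for y
  proof -
    have "f y = (\<Sum>z\<in>UNIV. f z * (if y = z then 1 else 0))" by (simp add: if_distrib cong: if_cong)
    also have "\<dots> = (\<Sum>z\<in>UNIV. f z - (\<Sum>e\<le>q\<^sup>2 - 1. f z * z ^ (q\<^sup>2 - 1 - e) * y ^ e))"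
      by (simp only: indicator_expand right_diff_distrib sum_distrib_left mult_1_right mult.assoc)
    also have "\<dots> = (\<Sum>z\<in>UNIV. f z) - (\<Sum>e\<le>q\<^sup>2 - 1. (\<Sum>z\<in>UNIV. f z * z ^ (q\<^sup>2 - 1 - e)) * y ^ e)"
      by (simp only: sum_subtractf sum_distrib_right) (simp only: sum.swap[of _ UNIV])
    finally show ?thesis .
  qed
  have split: "(\<Sum>e\<le>q\<^sup>2 - 1. g e) = g 0 + (\<Sum>e\<in>{1..q\<^sup>2 - 1}. g e)" for g :: "nat \<Rightarrow> 'a"
    by (simp add: sum.head_if[symmetric] atMost_atLeast0 sum.atLeast_Suc_atMost)
  have "(\<Sum>z\<in>UNIV. f z) = (\<Sum>z\<in>UNIV. f z * z ^ (q\<^sup>2 - 1))"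
  proof (rule sum.cong[OF refl])
    fix z show "f z = f z * z ^ (q\<^sup>2 - 1)"
      using f_zero[of 0] power_card_minus_1[of z] by (cases "z = 0") auto
  qed
  thus ?thesis using *[of y] unfolding split by simp
qed

end

section \<open>Tangents and the dual function\<close>

text \<open>The fibre condition counts the affine points of the vertical lines. In the application
  these pass through a point of the unital at infinity, which accounts for \<open>q\<close> instead
  of q + 1.\<close>

locale unital_function = norm_function +
  assumes f_fibre: "card {y. f y = x ^ (q + 1)} = q"
begin

text \<open>The formula is forced by contact at ordinate b^q: a tangent of slope m and intercept b
  then touches where m * x = b^q - b, and taking norms gives m^(q + 1) * f (b^q) = - ((b^q - b)^2).
  For b in \<open>base\<close> this reads 0 / 0, which is 0.\<close>

definition dual :: "'a \<Rightarrow> 'a" where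
  "dual b = - ((b ^ q - b)\<^sup>2) / f (b ^ q)"

text \<open>Count incident pairs of a slope and a point of the arc in two ways. Each abscissa other
  than x0 meets the arc in q points, each joined to the centre by one slope; the abscissa x0
  contributes q^2 or nothing.\<close>

lemma card_tangents_through:
  "card {m. card {x. x ^ (q + 1) = f (m * x + (y0 - m * x0))} = 1} = (if x0 ^ (q + 1) = f y0 then 1 else q + 1)"
proof -
  define N where "N m = card {x. x ^ (q + 1) = f (m * x + (y0 - m * x0))}" for m
  define T where "T = {m. N m = 1}"
  have "(\<Sum>m\<in>UNIV. N m) = (\<Sum>m\<in>UNIV. \<Sum>x\<in>UNIV. if x ^ (q + 1) = f (m * x + (y0 - m * x0)) then 1 else 0)"
    unfolding N_def by (simp add: sum.If_cases)
  also have "\<dots> = (\<Sum>x\<in>UNIV. \<Sum>m\<in>UNIV. if x ^ (q + 1) = f (m * x + (y0 - m * x0)) then 1 else 0)"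
    by (rule sum.swap)
  also have "\<dots> = (\<Sum>x\<in>UNIV. card {m. x ^ (q + 1) = f (m * x + (y0 - m * x0))})"
    by (simp add: sum.If_cases)
  also have "\<dots> = card {m::'a. x0 ^ (q + 1) = f y0} + (\<Sum>x\<in>UNIV - {x0}. card {m. x ^ (q + 1) = f (m * x + (y0 - m * x0))})"
    by (subst sum.remove[of UNIV x0]) auto
  also have "(\<Sum>x\<in>UNIV - {x0}. card {m. x ^ (q + 1) = f (m * x + (y0 - m * x0))}) = (\<Sum>x\<in>UNIV - {x0}. q)"
  proof (rule sum.cong[OF refl])
    fix x assume x: "x \<in> UNIV - {x0}"
    have e: "m * x + (y0 - m * x0) = m * (x - x0) + y0" for m by (simp add: algebra_simps)
    have "card {m. x ^ (q + 1) = f (m * x + (y0 - m * x0))} = card {y. f y = x ^ (q + 1)}"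
      unfolding e
      by (rule bij_betw_same_card[of "\<lambda>m. m * (x - x0) + y0"],
          rule bij_betw_byWitness[where f' = "\<lambda>y. (y - y0) / (x - x0)"])
        (use x in auto)
    thus "card {m. x ^ (q + 1) = f (m * x + (y0 - m * x0))} = q" using f_fibre by simp
  qed
  finally have sN: "(\<Sum>m\<in>UNIV. N m) = (if x0 ^ (q + 1) = f y0 then q\<^sup>2 else 0) + (q\<^sup>2 - 1) * q"
    by (simp add: card_F)
  have "N m = (if m \<in> T then 1 else q + 1)" for m
    using f_line[of m "y0 - m * x0"] by (auto simp: T_def N_def)
  hence "(\<Sum>m\<in>UNIV. N m) = (\<Sum>m\<in>UNIV. if m \<in> T then 1 else q + 1)" by simp
  also have "\<dots> = card T + card (- T) * (q + 1)"
    by (simp add: sum.If_cases)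
  also have "card (- T) = q\<^sup>2 - card T"
    using card_Diff_subset[of T UNIV] by (simp add: card_F Compl_eq_Diff_UNIV)
  finally have E: "card T + (q\<^sup>2 - card T) * (q + 1) = (if x0 ^ (q + 1) = f y0 then q\<^sup>2 else 0) + (q\<^sup>2 - 1) * q"
    using sN by simp
  have "card T \<le> q\<^sup>2" using card_mono[of UNIV T] by (simp add: card_F)
  then obtain j where j: "q\<^sup>2 = card T + j" using le_Suc_ex by blast
  have "card T + (q\<^sup>2 - card T) * (q + 1) = q\<^sup>2 + j * q" using j by simp
  moreover have "(q\<^sup>2 - 1) * q + q = (card T + j) * q"
  proof -
    obtain l where "q\<^sup>2 = Suc l" using q2_gt by (cases "q\<^sup>2") auto
    thus ?thesis using j by simp
  qed
  ultimately have "q\<^sup>2 + q = (if x0 ^ (q + 1) = f y0 then q\<^sup>2 else 0) + card T * q"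
    using E unfolding distrib_right by linarith
  hence *: "q * q + q = (if x0 ^ (q + 1) = f y0 then q * q else 0) + card T * q"
    by (simp only: power2_eq_square)
  have "card T = (if x0 ^ (q + 1) = f y0 then 1 else q + 1)"
  proof (cases "x0 ^ (q + 1) = f y0")
    case True
    have "q * q + q = q * q + card T * q" using * unfolding if_P[OF True] .
    hence "card T = 1" using q_gt_1 by simp
    thus ?thesis unfolding if_P[OF True] .
  next
    case False
    have "q * q + q = 0 + card T * q" using * unfolding if_not_P[OF False] .
    hence "card T * q = (q + 1) * q" by simp
    hence "card T = q + 1" using q_gt_1 by (subst (asm) mult_cancel2) simp
    thus ?thesis unfolding if_not_P[OF False] .
  qed
  thus ?thesis by (simp add: T_def N_def split: if_splits)
qed

text \<open>Meant for tangents: with a single point the sum is 1 / x, so m * x = b^q - b and the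
  ordinate of the point of contact is b^q. The proof finds all power sums, weighted by 1 / x, of the
  slopes at which the arc is seen from (0, b), and interpolates at the slope m.\<close>

lemma sum_inverse_on_line:
  assumes q3: "q \<ge> 3" and b: "b \<notin> base"
  shows "(\<Sum>x\<in>{x. x ^ (q + 1) = f (m * x + b)}. 1 / x) = m / (b ^ q - b)"
proof -
  define I where "I = {(x, y)\<in>arc. x \<noteq> 0}"
  define h where "h X = 1 / fst X" for X :: "'a \<times> 'a"
  define p where "p X = (snd X - b) / fst X" for X :: "'a \<times> 'a"
  define S where "S e = (\<Sum>X\<in>I. h X * p X ^ e)" for e
  \<comment> \<open>Points with \<open>x = 0\<close> are excluded from \<open>I\<close>. They enter
    the full sum only through x^(n - 1) with n = 1, where 0^0 = 1, and there they contribute the sum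
    of 1 / (c - b) over \<open>base\<close>; \<open>\<rho>\<close> is the negative of that
    contribution.\<close>
  define \<rho> where "\<rho> n = (if n = 1 then - 1 / (b ^ q - b) else 0)" for n :: nat
  have fin: "finite I" by (rule finite_subset[OF _ finite_class.finite_UNIV]) auto
  have Q: "q\<^sup>2 \<ge> 2 * q + 3" by (rule q2_ge[OF q3])
  have sums: "(\<Sum>X\<in>I. h X * (p X - m) ^ (q\<^sup>2 - 1 - n)) = \<rho> n" if n: "0 < n" "n < q" for n m
  proof -
    let ?g = "\<lambda>(x, y). x ^ (n - 1) * (y - (m * x + b)) ^ (q\<^sup>2 - 1 - n)"
    let ?J = "{(x, y)\<in>arc. x = 0}"
    have "0 = (\<Sum>X\<in>arc. ?g X)" using arc_line_sums(2)[OF q3 n] by simp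
    also have "arc = I \<union> ?J" by (auto simp: I_def)
    also have "(\<Sum>X\<in>I \<union> ?J. ?g X) = (\<Sum>X\<in>I. ?g X) + (\<Sum>X\<in>?J. ?g X)"
      by (rule sum.union_disjoint) (auto simp: I_def intro: finite_subset[OF _ finite_class.finite_UNIV])
    also have "(\<Sum>X\<in>I. ?g X) = (\<Sum>X\<in>I. h X * (p X - m) ^ (q\<^sup>2 - 1 - n))"
    proof (rule sum.cong[OF refl])
      fix X assume X: "X \<in> I"
      obtain x y where xy: "X = (x, y)" by (cases X)
      have x: "x \<noteq> 0" using X by (auto simp: I_def xy)
      have "x ^ (n - 1) * x ^ (q\<^sup>2 - 1 - n) = x ^ (q\<^sup>2 - 1 - 1)"
      proof -
        have "n - 1 + (q\<^sup>2 - 1 - n) = q\<^sup>2 - 1 - 1" using n Q by linarith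
        thus ?thesis by (metis power_add)
      qed
      also have "\<dots> = 1 / x" using power_minus_eq_inverse[of 1 x] Q by (simp add: inverse_eq_divide)
      finally have e: "x ^ (n - 1) * x ^ (q\<^sup>2 - 1 - n) = 1 / x" .
      have "y - (m * x + b) = x * (p X - m)" using x by (simp add: p_def xy field_simps)
      hence "?g X = x ^ (n - 1) * x ^ (q\<^sup>2 - 1 - n) * (p X - m) ^ (q\<^sup>2 - 1 - n)"
        by (simp add: xy power_mult_distrib)
      thus "?g X = h X * (p X - m) ^ (q\<^sup>2 - 1 - n)" unfolding e by (simp add: h_def xy)
    qed
    also have "(\<Sum>X\<in>?J. ?g X) = - \<rho> n"
    proof (cases "n = 1")
      case True
      have "(\<Sum>X\<in>?J. ?g X) = (\<Sum>c\<in>base. 1 / (c - b))"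
      proof (rule sum.reindex_bij_witness[of _ "\<lambda>c. (0, c)" snd])
        fix X assume "X \<in> ?J"
        thus "1 / (snd X - b) = ?g X"
          using power_minus_eq_inverse[of 1 "snd X - b"] Q True by (auto simp: inverse_eq_divide)
      qed (auto simp: arc_def f_zero[symmetric])
      thus ?thesis using True sum_inverse_base[OF b] by (simp add: \<rho>_def)
    next
      case False
      have "(\<Sum>X\<in>?J. ?g X) = (\<Sum>X\<in>?J. 0)" using False n by (intro sum.cong) (auto simp: power_0_left)
      thus ?thesis using False by (simp add: \<rho>_def)
    qed
    finally show ?thesis by (simp add: add_eq_0_iff)
  qed
  \<comment> \<open>The inverse power sums reach all exponents except those congruent to -1 modulo
    \<open>q\<close>. The only nonzero value comes from n = 1 and r = q, where the sum of x^(q^2 -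
    1) over the field is -1.\<close>
  have S1: "S (q * r - 1 - n) = (if n = 1 \<and> r = q then - 1 / (b ^ q - b) else 0)"
    if n: "0 < n" "n < q" and r: "0 < r" "r \<le> q" for n r
  proof (cases "n = 1")
    case False
    thus ?thesis using moments_from_inverse_powers_0[OF fin _ n q3 r, of h p] sums[OF n]
      by (simp add: S_def \<rho>_def)
  next
    case True
    have "q * r \<ge> q * 1" using r by (intro mult_le_mono2) simp
    hence j: "1 \<le> q * r - 1" using q_gt_1 q3 by linarith
    have j': "q * r - 1 \<le> q\<^sup>2 - 1" using r by (simp add: power2_eq_square diff_le_mono)
    have "(- 1) ^ 1 * of_nat ((q * r - 1) choose 1) * (\<Sum>X\<in>I. h X * p X ^ (q * r - 1 - 1)) = - \<rho> 1 * (\<Sum>x\<in>UNIV. x ^ (q * r - 1))"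
      using sums[of 1] q_gt_1 Q by (intro moments_from_inverse_powers[OF fin _ _ _ j j']) auto
    moreover have "of_nat ((q * r - 1) choose 1) = (- 1 :: 'a) ^ 1" by (rule binomial_mult_q_minus_1) (use r q_gt_1 in auto)
    ultimately have "S (q * r - 1 - 1) = - \<rho> 1 * (\<Sum>x\<in>UNIV. x ^ (q * r - 1))"
      by (simp add: S_def) (metis add.inverse_inverse)
    moreover have "(q\<^sup>2 - 1) dvd (q * r - 1) \<longleftrightarrow> r = q"
    proof
      assume "(q\<^sup>2 - 1) dvd (q * r - 1)"
      hence "q\<^sup>2 - 1 \<le> q * r - 1" using j by (intro dvd_imp_le) auto
      hence "q * q \<le> q * r" using j Q unfolding power2_eq_square by linarith
      thus "r = q" using r q_gt_1 by simp
    qed (simp add: power2_eq_square)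
    moreover have "Suc 0 < q * q" using Q unfolding power2_eq_square by linarith
    ultimately show ?thesis using True j by (simp add: \<rho>_def sum_power_UNIV)
  qed
  \<comment> \<open>For the remaining exponents symmetry is used: multiplying x by w of norm 1
    permutes \<open>I\<close> and multiplies the summand by w^(- q * k). As k is at most q, some of
    the q + 1 elements of norm 1 have w^k different from 1.\<close>
  have S2: "S (q * k - 1) = 0" if k: "0 < k" "k \<le> q" for k
  proof -
    have "card {w::'a. w ^ k = 1} \<le> k" using k by (intro card_roots_power_le)
    moreover have "card {w::'a. w ^ (q + 1) = 1} = q + 1" using card_norm_fibre[of 1] by (simp add: base_iff)
    ultimately have "\<not> {w::'a. w ^ (q + 1) = 1} \<subseteq> {w. w ^ k = 1}"
      using card_mono[of "{w::'a. w ^ k = 1}" "{w. w ^ (q + 1) = 1}"] k by auto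
    then obtain w :: 'a where w: "w ^ (q + 1) = 1" "w ^ k \<noteq> 1" by blast
    have w0: "w \<noteq> 0" using w(1) by auto
    have wq: "w ^ (q * k) \<noteq> 1"
      using w(2) power_q_eq_iff[of "w ^ k" 1] by (simp add: mult.commute power_mult)
    have qk: "q * k > 0" using k q_gt_1 by simp
    have "S (q * k - 1) = (\<Sum>X\<in>I. h (w * fst X, snd X) * p (w * fst X, snd X) ^ (q * k - 1))"
      unfolding S_def
      by (rule sum.reindex_bij_witness[of _ "\<lambda>X. (w * fst X, snd X)" "\<lambda>X. (fst X / w, snd X)"])
        (use w w0 in \<open>auto simp: I_def arc_def power_mult_distrib power_divide simp del: power_Suc power_Suc2 power_add\<close>)
    also have "\<dots> = (\<Sum>X\<in>I. (1 / w) ^ (q * k) * (h X * p X ^ (q * k - 1)))"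
    proof (rule sum.cong[OF refl])
      fix X
      have "(1 / w) ^ (q * k) = 1 / w * (1 / w) ^ (q * k - 1)" using qk by (simp add: power_eq_if)
      moreover have "h (w * fst X, snd X) = 1 / w * h X" "p (w * fst X, snd X) = 1 / w * p X"
        by (simp_all add: h_def p_def)
      ultimately show "h (w * fst X, snd X) * p (w * fst X, snd X) ^ (q * k - 1) = (1 / w) ^ (q * k) * (h X * p X ^ (q * k - 1))"
        by (simp only: power_mult_distrib mult_ac)
    qed
    also have "\<dots> = (1 / w) ^ (q * k) * S (q * k - 1)" by (simp only: S_def sum_distrib_left)
    finally have "(1 - (1 / w) ^ (q * k)) * S (q * k - 1) = 0" by (simp add: algebra_simps)
    thus ?thesis using wq w0 by (simp add: power_divide)
  qed
  have S: "S e = (if e = q\<^sup>2 - 2 then - 1 / (b ^ q - b) else 0)" if e: "e \<le> q\<^sup>2 - 1" for e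
  proof -
    define r where "r = e div q + 1"
    have "e < q * q" using e Q by (simp add: power2_eq_square)
    hence r: "0 < r" "r \<le> q" using less_mult_imp_div_less[of e q q] by (auto simp: r_def)
    have eq: "e = q * r - 1 - (q - 1 - e mod q)"
    proof -
      have "e = q * (e div q) + e mod q" by simp
      moreover have "e mod q < q" using q_gt_1 by simp
      ultimately show ?thesis unfolding r_def by (simp add: distrib_left)
    qed
    show ?thesis
    proof (cases "e mod q = q - 1")
      case True
      hence e': "e = q * r - 1" using eq by simp
      have "e \<noteq> q\<^sup>2 - 2"
      proof
        assume "e = q\<^sup>2 - 2"
        hence "q * r - 1 = q * q - 2" using e' by (simp add: power2_eq_square)
        moreover have "q * r \<ge> 1" using r q_gt_1 by simp
        moreover have "q * q \<ge> 2" using Q unfolding power2_eq_square by linarith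
        ultimately have "q * r + 1 = q * q" by linarith
        hence "q dvd q * r + 1" by simp
        hence "q dvd 1" by (subst (asm) dvd_add_right_iff) auto
        thus False using q_gt_1 by simp
      qed
      thus ?thesis using S2[OF r] e' by simp
    next
      case False
      have n: "0 < q - 1 - e mod q" "q - 1 - e mod q < q"
        using False q_gt_1 mod_less_divisor[of q e] by linarith+
      have "e = q\<^sup>2 - 2 \<longleftrightarrow> q - 1 - e mod q = 1 \<and> r = q"
      proof
        assume e2: "e = q\<^sup>2 - 2"
        have "q\<^sup>2 - 2 = q * (q - 1) + (q - 2)"
          using q3 by (simp add: power2_eq_square diff_mult_distrib2)
        hence "e = q * (q - 1) + (q - 2)" using e2 by simp
        hence e': "e = (q - 2) + q * (q - 1)" by (simp only: add.commute)
        have "e div q = (q - 1) + (q - 2) div q" "e mod q = (q - 2) mod q"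
          unfolding e' using q3 by (simp_all only: div_mult_self2 mod_mult_self2)
        hence "e div q = q - 1" "e mod q = q - 2" using q3 by simp_all
        thus "q - 1 - e mod q = 1 \<and> r = q" using q3 by (simp add: r_def)
      next
        assume "q - 1 - e mod q = 1 \<and> r = q"
        thus "e = q\<^sup>2 - 2" using eq by (simp add: power2_eq_square)
      qed
      thus ?thesis using S1[OF n r] eq by simp
    qed
  qed
  \<comment> \<open>The points on the line are those seen from (0, b) under slope m; none has x = 0
    because b is not in \<open>base\<close>.\<close>
  have "(\<Sum>x\<in>{x. x ^ (q + 1) = f (m * x + b)}. 1 / x) = (\<Sum>X\<in>{X\<in>I. p X = m}. h X)"
  proof (rule sum.reindex_bij_witness[of _ fst "\<lambda>x. (x, m * x + b)"])
    fix x assume x: "x \<in> {x. x ^ (q + 1) = f (m * x + b)}"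
    have "x \<noteq> 0"
    proof
      assume "x = 0"
      thus False using x f_zero[of b] b by simp
    qed
    thus "(x, m * x + b) \<in> {X\<in>I. p X = m}" using x by (auto simp: I_def arc_def p_def)
  qed (auto simp: I_def arc_def p_def h_def)
  also have "\<dots> = (\<Sum>X\<in>I. h X * (if m = p X then 1 else 0))"
    by (rule sum.mono_neutral_cong_left) (use fin in auto)
  also have "\<dots> = (\<Sum>X\<in>I. h X - (\<Sum>e\<le>q\<^sup>2 - 1. h X * p X ^ (q\<^sup>2 - 1 - e) * m ^ e))"
    by (simp only: indicator_expand right_diff_distrib sum_distrib_left mult_1_right mult.assoc)
  also have "\<dots> = S 0 - (\<Sum>e\<le>q\<^sup>2 - 1. S (q\<^sup>2 - 1 - e) * m ^ e)"
    by (simp only: S_def sum_subtractf sum_distrib_right power_0 mult_1_right) (simp only: sum.swap[of _ I])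
  also have "(\<Sum>e\<le>q\<^sup>2 - 1. S (q\<^sup>2 - 1 - e) * m ^ e) = (\<Sum>e\<in>{1}. S (q\<^sup>2 - 1 - e) * m ^ e)"
    by (rule sum.mono_neutral_right) (use Q in \<open>auto simp: S\<close>)
  also have "\<dots> = S (q\<^sup>2 - 2) * m"
  proof -
    have "q\<^sup>2 - 1 - 1 = q\<^sup>2 - 2" by simp
    thus ?thesis by (simp del: diff_diff_left)
  qed
  also have "S (q\<^sup>2 - 2) = - 1 / (b ^ q - b)" using S[of "q\<^sup>2 - 2"] by simp
  also have "S 0 = 0" using S[of 0] Q by simp
  finally show ?thesis by simp
qed

lemma dual_base: "dual b \<in> base"
proof -
  have "(b ^ q - b) ^ q = - (b ^ q - b)" by (simp add: frob_diff)
  hence "((b ^ q - b)\<^sup>2) ^ q = (b ^ q - b)\<^sup>2"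
    by (metis power2_minus power_mult mult.commute)
  thus ?thesis using f_base[of "b ^ q"] by (simp add: dual_def base_iff power_divide frob_minus)
qed

lemma dual_zero: "dual b = 0 \<longleftrightarrow> b \<in> base"
  using f_zero[of "b ^ q"] by (auto simp: dual_def base_iff)

text \<open>For b outside \<open>base\<close> the contact formula gives one inclusion, and both sets
  of slopes have q + 1 elements. For b in \<open>base\<close> the point (0, b) is on the arc, its
  only non-vertical tangent is the horizontal line, and \<open>dual b\<close> is 0.\<close>

lemma tangent_iff:
  assumes q3: "q \<ge> 3"
  shows "card {x. x ^ (q + 1) = f (m * x + b)} = 1 \<longleftrightarrow> m ^ (q + 1) = dual b"
proof (cases "b \<in> base")
  case False
  let ?T = "{m. card {x. x ^ (q + 1) = f (m * x + b)} = 1}"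
  have fb: "f b \<noteq> 0" "f (b ^ q) \<noteq> 0" "b ^ q - b \<noteq> 0" using False f_zero[of b] f_zero[of "b ^ q"] by (auto simp: base_iff)
  have "?T = {m. m ^ (q + 1) = dual b}"
  proof (rule card_seteq)
    show "?T \<subseteq> {m. m ^ (q + 1) = dual b}"
    proof
      fix m assume "m \<in> ?T"
      then obtain x where x: "{x. x ^ (q + 1) = f (m * x + b)} = {x}" by (auto simp: card_1_singleton_iff simp del: power_Suc)
      hence x1: "x ^ (q + 1) = f (m * x + b)" by blast
      have "1 / x = m / (b ^ q - b)" using sum_inverse_on_line[OF q3 False, of m] unfolding x by simp
      moreover have x0: "x \<noteq> 0" using x1 fb by auto
      ultimately have mx: "m * x = b ^ q - b" using fb by (simp add: field_simps)
      have fx: "f (b ^ q) = x ^ (q + 1)" using x1 mx by simp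
      have "m ^ (q + 1) * f (b ^ q) = (m * x) ^ (q + 1)" by (simp only: fx power_mult_distrib)
      also have "\<dots> = (b ^ q - b) ^ q * (b ^ q - b)" unfolding mx by simp
      also have "\<dots> = - ((b ^ q - b)\<^sup>2)" by (simp add: frob_diff power2_eq_square algebra_simps)
      finally show "m \<in> {m. m ^ (q + 1) = dual b}" using fb by (simp add: dual_def field_simps)
    qed
    have "card {m. m ^ (q + 1) = dual b} = q + 1"
      using card_norm_fibre[OF dual_base, of b] dual_zero[of b] False by simp
    moreover have "card ?T = q + 1"
      using card_tangents_through[of b 0] fb by simp
    ultimately show "card {m. m ^ (q + 1) = dual b} \<le> card ?T" by simp
  qed simp
  thus ?thesis by blast
next
  case True
  let ?T = "{m. card {x. x ^ (q + 1) = f (m * x + b)} = 1}"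
  have fb: "f b = 0" using True f_zero by simp
  have cT: "card ?T = 1" using card_tangents_through[of b 0] fb by simp
  have "0 \<in> ?T"
  proof -
    have "{x :: 'a. x ^ (q + 1) = 0} = {0}" by auto
    thus ?thesis using fb by (simp del: power_Suc)
  qed
  moreover from cT obtain z where "?T = {z}" by (rule card_1_singletonE)
  ultimately have "?T = {0}" by (simp del: power_Suc mem_Collect_eq)
  hence "card {x. x ^ (q + 1) = f (m * x + b)} = 1 \<longleftrightarrow> m = 0" by blast
  moreover have "dual b = 0" using True dual_zero by simp
  ultimately show ?thesis using q_gt_1 by auto
qed

text \<open>The points of the dual arc on a line correspond to the tangents through a point: slope x
  and intercept m * x + b describe the lines through (- m, b).\<close>

lemma norm_function_dual:
  assumes q3: "q \<ge> 3" shows "norm_function q dual"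
proof
  fix m b
  have "{x. x ^ (q + 1) = dual (m * x + b)} = {x. card {z. z ^ (q + 1) = f (x * z + (b - x * (- m)))} = 1}"
  proof (rule Collect_cong)
    fix x
    have e: "x * z + (b - x * (- m)) = x * z + (m * x + b)" for z by (simp add: algebra_simps)
    show "x ^ (q + 1) = dual (m * x + b) \<longleftrightarrow> card {z. z ^ (q + 1) = f (x * z + (b - x * (- m)))} = 1"
      unfolding e using tangent_iff[OF q3, of x "m * x + b"] by blast
  qed
  thus "card {x. x ^ (q + 1) = dual (m * x + b)} \<in> {1, q + 1}"
    using card_tangents_through[of b "- m"] by simp
qed (simp_all add: dual_base dual_zero)

lemma f_dual: "f y * dual (y ^ q) = - ((y ^ q - y)\<^sup>2)"
proof (cases "y \<in> base")
  case False
  thus ?thesis using f_zero[of y] by (simp add: dual_def power2_commute)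
qed (use f_zero[of y] in \<open>simp add: base_iff\<close>)

text \<open>The coefficient of \<open>y\<^sup>2\<close> in the product of \<open>f y\<close> and \<open>dual (y ^ q)\<close> can only come from the
  coefficient of \<open>y\<close> in \<open>f\<close>; every other pair of exponents violates the divisibility in
  \<open>moment_eq_0\<close> for one of the factors.\<close>

lemma linear_coefficient_neq_0:
  assumes q3: "q \<ge> 3"
  shows "(\<Sum>y\<in>UNIV. f y * y ^ (q\<^sup>2 - 2)) \<noteq> 0"
proof
  assume c1: "(\<Sum>y\<in>UNIV. f y * y ^ (q\<^sup>2 - 2)) = 0"
  interpret d: norm_function q F dual by (rule norm_function_dual[OF q3])
  have Q: "q\<^sup>2 \<ge> 2 * q + 3" by (rule q2_ge[OF q3])
  have cq: "of_nat (q - 1) \<noteq> (0::'a)" using q_gt_1 by (simp add: of_nat_diff)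
  define c where "c e = (\<Sum>z\<in>UNIV. f z * z ^ (q\<^sup>2 - 1 - e))" for e
  define d where "d e = (\<Sum>z\<in>UNIV. dual z * z ^ (q\<^sup>2 - 1 - e))" for e
  let ?E = "{1..q\<^sup>2 - 1}"
  \<comment> \<open>The power y^(q^2 - 3) selects the exponents m + q * n that are congruent to 2
    modulo q^2 - 1.\<close>
  have zero: "c m * d n * (\<Sum>y\<in>UNIV. (y::'a) ^ (m + q * n + (q\<^sup>2 - 3))) = 0"
    if mn: "m \<in> ?E" "n \<in> ?E" for m n
  proof (rule ccontr)
    assume "\<not> ?thesis"
    hence cm: "c m \<noteq> 0" and dn: "d n \<noteq> 0" and dv: "(q\<^sup>2 - 1) dvd (m + q * n + (q\<^sup>2 - 3))"
      by (auto simp: sum_power_UNIV split: if_splits)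
    define a b a' b' where "a = m mod q" and "b = m div q" and "a' = n mod q" and "b' = n div q"
    have m: "m = a + q * b" and n: "n = a' + q * b'" by (simp_all add: a_def b_def a'_def b'_def)
    have "m < q * q" "n < q * q" using mn Q by (auto simp: power2_eq_square)
    hence lt: "a < q" "b < q" "a' < q" "b' < q"
      using q_gt_1 by (auto simp: a_def b_def a'_def b'_def less_mult_imp_div_less)
    have cond1: "of_nat a = (0::'a) \<and> of_nat b = (0::'a)" if "0 < a" "0 < b"
      using moment_eq_0[OF q3 that(1) lt(1) that(2) lt(2)] cm by (auto simp: c_def m)
    have cond2: "of_nat a' = (0::'a) \<and> of_nat b' = (0::'a)" if "0 < a'" "0 < b'"
      using d.moment_eq_0[OF q3 that(1) lt(3) that(2) lt(4)] dn by (auto simp: d_def n)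
    \<comment> \<open>Multiplying n by q exchanges its digits modulo q^2 - 1, so m + q * n is
      congruent to s + q * t. Carries are possible, as s and t may reach 2 * (q - 1).\<close>
    define s t where "s = a + b'" and "t = b + a'"
    have "m + q * n + (q\<^sup>2 - 3) + 2 = s + q * t + (q\<^sup>2 - 1) * (b' + 1)"
    proof -
      have "q * n = q * a' + q\<^sup>2 * b'" by (simp add: n distrib_left power2_eq_square)
      moreover have "3 \<le> q\<^sup>2" using Q by linarith
      then obtain k where "q\<^sup>2 = 3 + k" using le_Suc_ex by blast
      ultimately show ?thesis by (simp add: m s_def t_def algebra_simps)
    qed
    moreover from dv obtain k where "m + q * n + (q\<^sup>2 - 3) = (q\<^sup>2 - 1) * k" by auto
    ultimately have k: "s + q * t + (q\<^sup>2 - 1) * (b' + 1) = (q\<^sup>2 - 1) * k + 2" by simp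
    have "s \<le> 2 * (q - 1)" "t \<le> 2 * (q - 1)" using lt by (auto simp: s_def t_def)
    hence "s + q * t \<le> 2 * (q - 1) + q * (2 * (q - 1))" by (intro add_mono mult_le_mono2) auto
    also have "\<dots> = 2 * (q\<^sup>2 - 1)" using q_gt_1 by (cases q) (simp_all add: power2_eq_square)
    finally have st_le: "s + q * t \<le> 2 * (q\<^sup>2 - 1)" .
    have "s + q * t = 2 \<or> s + q * t = q\<^sup>2 + 1"
    proof -
      have "b' + 1 \<le> k" if "S + w * (b' + 1) = w * k + 2" "w > 2" for S w :: nat
      proof (rule ccontr)
        assume "\<not> b' + 1 \<le> k"
        hence "w * (k + 1) \<le> w * (b' + 1)" by (intro mult_le_mono2) simp
        thus False using that unfolding distrib_left by linarith
      qed
      moreover have "2 < q\<^sup>2 - 1" using Q q3 by linarith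
      ultimately have "b' + 1 \<le> k" using k by blast
      then obtain l where l: "k = b' + 1 + l" using le_Suc_ex by blast
      have st: "s + q * t = (q\<^sup>2 - 1) * l + 2" using k by (simp add: l distrib_left)
      have "l < 2"
      proof (rule ccontr)
        assume "\<not> l < 2"
        hence "(q\<^sup>2 - 1) * 2 \<le> (q\<^sup>2 - 1) * l" by (intro mult_le_mono2) simp
        thus False using st st_le by linarith
      qed
      hence "l = 0 \<or> l = 1" by linarith
      thus ?thesis using st Q by auto
    qed
    thus False
    proof
      assume st: "s + q * t = 2"
      have "t = 0"
      proof (rule ccontr)
        assume "t \<noteq> 0"
        hence "q * 1 \<le> q * t" by (intro mult_le_mono2) simp
        thus False using st q3 by linarith
      qed
      hence "b = 0" "a' = 0" "a + b' = 2" using st by (auto simp: s_def t_def)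
      moreover have "a \<noteq> 0" "b' \<noteq> 0" using mn m n calculation by auto
      ultimately have "m = 1" using m by simp
      moreover have "q\<^sup>2 - 1 - 1 = q\<^sup>2 - 2" by simp
      ultimately have "c m = 0" using c1 by (simp only: c_def)
      thus False using cm by contradiction
    next
      \<comment> \<open>The case with a carry. If s = 1, one of the factors has a digit 1 next to a
        positive digit. If s = q + 1, then b and a' both vanish in the field although their sum is q
        - 1.\<close>
      assume st: "s + q * t = q\<^sup>2 + 1"
      have "(1 + q * q) mod q = 1 mod q" by (rule mod_mult_self2)
      hence "(s + q * t) mod q = 1" unfolding st power2_eq_square using q_gt_1 by (simp only: add.commute) simp
      hence "s mod q = 1" by simp
      moreover have "s < 2 * q" using lt by (simp add: s_def)
      then have "s div q < 2" by (simp add: less_mult_imp_div_less)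
      hence "s div q = 0 \<or> s div q = 1" by linarith
      ultimately have "s = 1 \<or> s = q + 1" using div_mult_mod_eq[of s q] by auto
      thus False
      proof
        assume s: "s = 1"
        hence "q * t = q * q" using st by (simp add: power2_eq_square)
        hence "t = q" using q_gt_1 by simp
        hence pos: "0 < b" "0 < a'" using lt by (auto simp: t_def)
        from s consider "a = 1" | "b' = 1" by (auto simp: s_def add_is_1)
        thus False using cond1 cond2 pos by cases auto
      next
        assume s: "s = q + 1"
        hence "q * (t + 1) = q * q" using st by (simp add: power2_eq_square)
        hence "t + 1 = q" using q_gt_1 by (subst (asm) nat_mult_eq_cancel1) auto
        hence t: "b + a' = q - 1" by (simp add: t_def)
        have pos: "0 < a" "0 < b'" using s lt by (auto simp: s_def)
        have "of_nat b = (0::'a)" using cond1 pos by (cases "b = 0") auto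
        moreover have "of_nat a' = (0::'a)" using cond2 pos by (cases "a' = 0") auto
        ultimately have "of_nat (q - 1) = (0::'a)" unfolding t[symmetric] of_nat_add by simp
        thus False using cq by simp
      qed
    qed
  qed
  have "(\<Sum>y\<in>UNIV. f y * dual (y ^ q) * y ^ (q\<^sup>2 - 3)) =
     (\<Sum>y\<in>UNIV. \<Sum>m\<in>?E. \<Sum>n\<in>?E. c m * d n * y ^ (m + q * n + (q\<^sup>2 - 3)))"
  proof (rule sum.cong[OF refl])
    fix y
    have "f y * dual (y ^ q) = (\<Sum>m\<in>?E. c m * y ^ m) * (\<Sum>n\<in>?E. d n * (y ^ q) ^ n)"
      using f_expand[of y] d.f_expand[of "y ^ q"] by (simp add: c_def d_def)
    also have "\<dots> = (\<Sum>m\<in>?E. \<Sum>n\<in>?E. c m * y ^ m * (d n * (y ^ q) ^ n))" by (rule sum_product)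
    finally show "f y * dual (y ^ q) * y ^ (q\<^sup>2 - 3) = (\<Sum>m\<in>?E. \<Sum>n\<in>?E. c m * d n * y ^ (m + q * n + (q\<^sup>2 - 3)))"
      unfolding power_add power_mult by (simp only: sum_distrib_left sum_distrib_right mult_ac)
  qed
  also have "\<dots> = (\<Sum>m\<in>?E. \<Sum>y\<in>UNIV. \<Sum>n\<in>?E. c m * d n * y ^ (m + q * n + (q\<^sup>2 - 3)))" by (rule sum.swap)
  also have "\<dots> = (\<Sum>m\<in>?E. \<Sum>n\<in>?E. c m * d n * (\<Sum>y\<in>UNIV. y ^ (m + q * n + (q\<^sup>2 - 3))))"
    by (intro sum.cong refl) (simp only: sum_distrib_left, rule sum.swap)
  also have "\<dots> = 0" by (intro sum.neutral ballI zero)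
  finally have lhs: "(\<Sum>y\<in>UNIV. f y * dual (y ^ q) * y ^ (q\<^sup>2 - 3)) = 0" .
  have ex: "- ((y ^ q - y)\<^sup>2) * y ^ k = 2 * y ^ (q + 1 + k) - y ^ (2 * q + k) - y ^ (2 + k)" for y :: 'a and k
  proof -
    have "y ^ (2 * q + k) = y ^ q * y ^ q * y ^ k" "y ^ (q + 1 + k) = y ^ q * y * y ^ k" "y ^ (2 + k) = y * y * y ^ k"
      by (simp_all only: mult_2 power_add power_one_right power2_eq_square)
    thus ?thesis by (simp only: power2_eq_square) (simp add: algebra_simps)
  qed
  have "(\<Sum>y\<in>UNIV. f y * dual (y ^ q) * y ^ (q\<^sup>2 - 3)) =
      (\<Sum>y\<in>UNIV. 2 * y ^ (q + 1 + (q\<^sup>2 - 3)) - y ^ (2 * q + (q\<^sup>2 - 3)) - y ^ (2 + (q\<^sup>2 - 3)) :: 'a)"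
    unfolding f_dual ex ..
  also have "\<dots> = 2 * (\<Sum>y\<in>UNIV. (y::'a) ^ (q + 1 + (q\<^sup>2 - 3))) - (\<Sum>y\<in>UNIV. (y::'a) ^ (2 * q + (q\<^sup>2 - 3)))
     - (\<Sum>y\<in>UNIV. (y::'a) ^ (2 + (q\<^sup>2 - 3)))"
    by (simp only: sum_subtractf sum_distrib_left)
  \<comment> \<open>Of the three terms of the square only y^2 reaches the exponent q^2 - 1, so the
    whole sum is 1 and not 0.\<close>
  also have "(\<Sum>y\<in>UNIV. (y::'a) ^ (2 + (q\<^sup>2 - 3))) = - 1"
  proof -
    have "2 + (q\<^sup>2 - 3) = q\<^sup>2 - 1" using Q by linarith
    thus ?thesis using Q by (simp add: sum_power_UNIV)
  qed
  also have "(\<Sum>y\<in>UNIV. (y::'a) ^ (q + 1 + (q\<^sup>2 - 3))) = 0"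
  proof -
    have "q + 1 + (q\<^sup>2 - 3) = (q\<^sup>2 - 1) + (q - 1)" using Q q3 by linarith
    moreover have "\<not> (q\<^sup>2 - 1) dvd (q - 1)" using Q q3 by (intro nat_dvd_not_less) linarith+
    ultimately show ?thesis by (simp only: sum_power_UNIV dvd_add_triv_left_iff simp_thms if_False)
  qed
  also have "(\<Sum>y\<in>UNIV. (y::'a) ^ (2 * q + (q\<^sup>2 - 3))) = 0"
  proof -
    have "2 * q + (q\<^sup>2 - 3) = (q\<^sup>2 - 1) + (2 * q - 2)" using Q q3 by linarith
    moreover have "\<not> (q\<^sup>2 - 1) dvd (2 * q - 2)" using Q q3 by (intro nat_dvd_not_less) linarith+
    ultimately show ?thesis by (simp only: sum_power_UNIV dvd_add_triv_left_iff simp_thms if_False)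
  qed
  finally show False using lhs by simp
qed

end

section \<open>Level sets of a homogeneous norm function\<close>

context unital_function
begin

lemma card_line_char: "of_nat (card {x. x ^ (q + 1) = f (m * x + b)}) = (1::'a)"
  using f_line[of m b] by auto

text \<open>For s in \<open>base\<close>, sum (s * N y - f y)^(q - 1) over y, where N y is the norm
  of y - b. This counts solutions of s * N y = f y: the points of a line, hence 1 in the field, if s
  is not 0, and q, hence 0, if s = 0. So the sum is - s^(q - 1) on all of \<open>base\<close>, and
  by degree the middle coefficients in s vanish.\<close>

lemma sum_norm_power_f_eq_0:
  assumes i: "0 < i" "i < q - 1"
  shows "(\<Sum>y\<in>UNIV. ((y - b) ^ (q + 1)) ^ i * f y ^ (q - 1 - i)) = 0"
proof -
  define N where "N y = (y - b) ^ (q + 1)" for y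
  define g where "g s = (\<Sum>y\<in>UNIV. (s * N y - f y) ^ (q - 1))" for s
  have N: "N y \<in> base" for y unfolding N_def by (rule norm_in_base)
  have g: "g s = (if s = 0 then 0 else - 1)" if s: "s \<in> base" for s
  proof -
    have "1 - (s * N y - f y) ^ (q - 1) = (if s * N y = f y then 1 else 0)" for y
      using power_q_minus_1_base[of "s * N y - f y"] base_diff[OF base_mult[OF s N] f_base, of y y] q_gt_1
      by (auto simp: power_0_left)
    hence "(\<Sum>y\<in>UNIV. 1 - (s * N y - f y) ^ (q - 1)) = (\<Sum>y\<in>UNIV. if s * N y = f y then 1 else 0)" by simp
    hence *: "- g s = of_nat (card {y. s * N y = f y})"
      by (simp add: sum_subtractf card_F g_def sum.If_cases power2_eq_square)
    show ?thesis
    proof (cases "s = 0")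
      case True
      have "0 = f y \<longleftrightarrow> y \<in> base" for y using f_zero[of y] by auto
      hence "card {y. s * N y = f y} = q" using True card_base by simp
      thus ?thesis using * True by simp
    next
      case False
      have "card {x. x ^ (q + 1) = s} = q + 1" using card_norm_fibre[OF s] False by simp
      hence "{x. x ^ (q + 1) = s} \<noteq> {}" by (metis card.empty add_is_0 zero_neq_one)
      then obtain m where m: "m ^ (q + 1) = s" by blast
      hence m0: "m \<noteq> 0" using False by auto
      \<comment> \<open>With s the norm of m, the substitution x = m * (y - b) turns the solutions
        into the points of the line of slope 1 / m and intercept b.\<close>
      have sN: "s * N y = (m * (y - b)) ^ (q + 1)" for y by (simp only: N_def m[symmetric] power_mult_distrib)
      have "card {y. s * N y = f y} = card {x. x ^ (q + 1) = f ((1 / m) * x + b)}"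
      proof (rule bij_betw_same_card[of "\<lambda>y. m * (y - b)"], rule bij_betw_byWitness[where f' = "\<lambda>x. (1 / m) * x + b"])
        show "(\<lambda>y. m * (y - b)) ` {y. s * N y = f y} \<subseteq> {x. x ^ (q + 1) = f ((1 / m) * x + b)}"
          unfolding sN using m0 by auto
        show "(\<lambda>x. (1 / m) * x + b) ` {x. x ^ (q + 1) = f ((1 / m) * x + b)} \<subseteq> {y. s * N y = f y}"
          unfolding sN using m0 by auto
      qed (use m0 in auto)
      hence "- g s = 1" using * by (simp only: card_line_char)
      thus ?thesis using False by (metis minus_equation_iff)
    qed
  qed
  define R where "R = (\<Sum>k\<le>q - 1. monom (of_nat ((q - 1) choose k) * (- 1) ^ (q - 1 - k) * (\<Sum>y\<in>UNIV. N y ^ k * f y ^ (q - 1 - k))) k) + monom 1 (q - 1)"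
  have "R = 0"
  proof (rule poly_eqI_degree[of base])
    fix s assume s: "s \<in> base"
    have "g s = (\<Sum>y\<in>UNIV. (s * N y + (- f y)) ^ (q - 1))" by (simp add: g_def)
    also have "\<dots> = (\<Sum>y\<in>UNIV. \<Sum>k\<le>q - 1. of_nat ((q - 1) choose k) * (s ^ k * N y ^ k) * ((- 1) ^ (q - 1 - k) * f y ^ (q - 1 - k)))"
      by (simp only: binomial_ring power_minus[of "f _"] power_mult_distrib)
    also have "\<dots> = (\<Sum>k\<le>q - 1. \<Sum>y\<in>UNIV. of_nat ((q - 1) choose k) * (s ^ k * N y ^ k) * ((- 1) ^ (q - 1 - k) * f y ^ (q - 1 - k)))"
      by (rule sum.swap)
    also have "\<dots> = poly R s - s ^ (q - 1)"
      by (simp add: R_def poly_sum poly_monom sum_distrib_left sum_distrib_right mult_ac)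
    finally have "poly R s = g s + s ^ (q - 1)" by simp
    also have "\<dots> = 0" using g[OF s] power_q_minus_1_base[OF s] q_gt_1 by (auto simp: power_0_left)
    finally show "poly R s = poly 0 s" by simp
  next
    have "degree R \<le> q - 1" unfolding R_def
      by (intro degree_add_le degree_sum_le degree_monom_le) (auto intro: order_trans[OF degree_monom_le])
    thus "degree R < card base" using q_gt_1 by (simp add: card_base)
  qed (use q_gt_1 in \<open>simp add: card_base\<close>)
  hence "coeff R i = 0" by simp
  hence "of_nat ((q - 1) choose i) * (- 1) ^ (q - 1 - i) * (\<Sum>y\<in>UNIV. N y ^ i * f y ^ (q - 1 - i)) = 0"
    using i by (simp add: R_def coeff_sum)
  moreover have "of_nat ((q - 1) choose i) = (- 1 :: 'a) ^ i"
    using binomial_mult_q_minus_1[of 1 i] i by simp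
  ultimately show ?thesis by (simp add: N_def del: power_Suc)
qed

text \<open>Summation over b extracts the coefficient of b^(\<alpha> + q * \<beta>) from the power
  of the norm. As i < q - 1, the exponents a + q * c are distinct and below q^2 - 1, so nothing
  wraps around.\<close>

lemma sum_norm_power_moment:
  fixes y :: 'a
  assumes i: "i < q - 1" and ab: "\<alpha> \<le> i" "\<beta> \<le> i"
  shows "(\<Sum>b\<in>UNIV. b ^ (q\<^sup>2 - 1 - (\<alpha> + q * \<beta>)) * ((y - b) ^ (q + 1)) ^ i) =
    - ((- 1) ^ \<alpha> * of_nat (i choose \<alpha>) * y ^ (i - \<alpha>) * ((- 1) ^ \<beta> * of_nat (i choose \<beta>) * (y ^ q) ^ (i - \<beta>)))"
proof -
  let ?c = "\<lambda>a c. (- 1) ^ a * of_nat (i choose a) * y ^ (i - a) * ((- 1) ^ c * of_nat (i choose c) * (y ^ q) ^ (i - c))"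
  have small: "a + q * c < q\<^sup>2 - 1" if "a \<le> i" "c \<le> i" for a c
  proof -
    have "a + q * c \<le> (q - 2) + q * (q - 2)" using that i by (intro add_mono mult_le_mono2) auto
    also have "\<dots> = (q + 1) * (q - 2)" by simp
    also have "\<dots> < (q + 1) * (q - 1)" using i by (intro mult_strict_left_mono) auto
    also have "\<dots> = q\<^sup>2 - 1" using q_gt_1 by (simp add: power2_eq_square algebra_simps)
    finally show ?thesis .
  qed
  have pw: "((y - b) ^ (q + 1)) ^ i = (\<Sum>a\<le>i. \<Sum>c\<le>i. ?c a c * b ^ (a + q * c))" for b
  proof -
    have "((y - b) ^ (q + 1)) ^ i = (- b + y) ^ i * (- (b ^ q) + y ^ q) ^ i"
      by (simp add: power_add power_mult_distrib frob_diff mult.commute)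
    also have "\<dots> = (\<Sum>a\<le>i. of_nat (i choose a) * ((- 1) ^ a * b ^ a) * y ^ (i - a)) *
        (\<Sum>c\<le>i. of_nat (i choose c) * ((- 1) ^ c * (b ^ q) ^ c) * (y ^ q) ^ (i - c))"
      by (simp only: binomial_ring power_minus[of b] power_minus[of "b ^ q"])
    also have "\<dots> = (\<Sum>a\<le>i. \<Sum>c\<le>i. ?c a c * b ^ (a + q * c))"
      unfolding power_add power_mult by (simp only: sum_product mult_ac)
    finally show ?thesis .
  qed
  have "(\<Sum>b\<in>UNIV. b ^ (q\<^sup>2 - 1 - (\<alpha> + q * \<beta>)) * ((y - b) ^ (q + 1)) ^ i) =
      (\<Sum>b\<in>UNIV. \<Sum>a\<le>i. \<Sum>c\<le>i. ?c a c * b ^ (q\<^sup>2 - 1 - (\<alpha> + q * \<beta>) + (a + q * c)))"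
    unfolding pw sum_distrib_left power_add[of _ "q\<^sup>2 - 1 - (\<alpha> + q * \<beta>)"] by (simp only: mult_ac)
  also have "\<dots> = (\<Sum>a\<le>i. \<Sum>b\<in>UNIV. \<Sum>c\<le>i. ?c a c * b ^ (q\<^sup>2 - 1 - (\<alpha> + q * \<beta>) + (a + q * c)))"
    by (rule sum.swap)
  also have "\<dots> = (\<Sum>a\<le>i. \<Sum>c\<le>i. ?c a c * (\<Sum>b\<in>UNIV. b ^ (q\<^sup>2 - 1 - (\<alpha> + q * \<beta>) + (a + q * c))))"
    by (intro sum.cong refl) (simp only: sum_distrib_left, rule sum.swap)
  also have "\<dots> = (\<Sum>a\<le>i. \<Sum>c\<le>i. if a = \<alpha> \<and> c = \<beta> then - ?c a c else 0)"
  proof (intro sum.cong refl)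
    fix a c assume "a \<in> {..i}" "c \<in> {..i}"
    hence ac: "a \<le> i" "c \<le> i" by auto
    let ?e = "q\<^sup>2 - 1 - (\<alpha> + q * \<beta>) + (a + q * c)"
    have pos: "?e > 0" using small[OF ab] by simp
    have lt: "?e < 2 * (q\<^sup>2 - 1)" using small[OF ab] small[OF ac] by linarith
    have "(q\<^sup>2 - 1) dvd ?e \<longleftrightarrow> a = \<alpha> \<and> c = \<beta>"
    proof
      assume "(q\<^sup>2 - 1) dvd ?e"
      then obtain k where k: "?e = (q\<^sup>2 - 1) * k" by auto
      have "k < 2"
      proof (rule ccontr)
        assume "\<not> k < 2"
        hence "(q\<^sup>2 - 1) * 2 \<le> (q\<^sup>2 - 1) * k" by (intro mult_le_mono2) simp
        thus False using k lt by linarith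
      qed
      moreover have "k \<noteq> 0" using k pos by (intro notI) simp
      ultimately have "?e = q\<^sup>2 - 1" using k by (simp add: less_2_cases_iff)
      hence eq: "a + q * c = \<alpha> + q * \<beta>" using small[OF ab] by linarith
      have "(a + q * c) mod q = a" "(\<alpha> + q * \<beta>) mod q = \<alpha>"
        "(a + q * c) div q = c" "(\<alpha> + q * \<beta>) div q = \<beta>" using ab ac i by auto
      thus "a = \<alpha> \<and> c = \<beta>" using eq by auto
    qed (use small[OF ab] in simp)
    thus "?c a c * (\<Sum>b\<in>UNIV. b ^ ?e) = (if a = \<alpha> \<and> c = \<beta> then - ?c a c else 0)"
      using pos by (simp add: sum_power_UNIV)
  qed
  also have "\<dots> = (\<Sum>a\<le>i. if a = \<alpha> then - ?c a \<beta> else 0)"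
    by (intro sum.cong refl) (use ab in \<open>auto simp: sum.delta\<close>)
  also have "\<dots> = - ?c \<alpha> \<beta>" using ab by (subst sum.delta) auto
  finally show ?thesis .
qed

context
  assumes hom: "t \<in> base \<Longrightarrow> f (t * y) = t * f y"
begin

text \<open>Extracting a coefficient in b from \<open>sum_norm_power_f_eq_0\<close> leaves a moment
  of a power of \<open>f\<close>. The choice \<beta> = i - \<alpha> gives it total degree congruent
  to 0 modulo q - 1 under scalars of \<open>base\<close>, so by homogeneity it collapses to the
  level set of value 1.\<close>

lemma moments_of_level_set:
  assumes i: "0 < i" "i < q - 1" and \<alpha>: "\<alpha> \<le> i"
  shows "of_nat (i choose \<alpha>) * (\<Sum>s\<in>{s. f s = 1}. s ^ (i - \<alpha> + q * \<alpha>)) = 0"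
proof -
  let ?S = "{s. f s = 1}"
  let ?k = "i - \<alpha> + q * \<alpha>"
  define \<beta> where "\<beta> = i - \<alpha>"
  have \<beta>: "\<beta> \<le> i" "i - \<beta> = \<alpha>" using \<alpha> by (auto simp: \<beta>_def)
  define W where "W = (\<Sum>y\<in>UNIV. f y ^ (q - 1 - i) * y ^ ?k)"
  have "0 = (\<Sum>b\<in>UNIV. b ^ (q\<^sup>2 - 1 - (\<alpha> + q * \<beta>)) * (\<Sum>y\<in>UNIV. ((y - b) ^ (q + 1)) ^ i * f y ^ (q - 1 - i)))"
    by (simp only: sum_norm_power_f_eq_0[OF i] mult_zero_right sum.neutral_const)
  also have "\<dots> = (\<Sum>y\<in>UNIV. \<Sum>b\<in>UNIV. f y ^ (q - 1 - i) * (b ^ (q\<^sup>2 - 1 - (\<alpha> + q * \<beta>)) * ((y - b) ^ (q + 1)) ^ i))"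
    by (simp only: sum_distrib_left mult_ac) (rule sum.swap)
  also have "\<dots> = (\<Sum>y\<in>UNIV. f y ^ (q - 1 - i) * - ((- 1) ^ \<alpha> * of_nat (i choose \<alpha>) * y ^ (i - \<alpha>) * ((- 1) ^ \<beta> * of_nat (i choose \<beta>) * (y ^ q) ^ (i - \<beta>))))"
    unfolding sum_distrib_left[symmetric] sum_norm_power_moment[OF i(2) \<alpha> \<beta>(1)] ..
  also have "\<dots> = - ((- 1) ^ \<alpha> * (- 1) ^ \<beta> * of_nat (i choose \<alpha>) * of_nat (i choose \<beta>)) * W"
    unfolding W_def \<beta>(2) power_add power_mult by (simp add: sum_distrib_left sum_negf mult_ac)
  finally have "of_nat (i choose \<alpha>) * W = 0"
    using binomial_symmetric[OF \<alpha>] by (auto simp: \<beta>_def)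
  moreover have "W = - (\<Sum>s\<in>?S. s ^ ?k)"
  proof -
    have l: "q - 1 - i > 0" using i by simp
    have "W = (\<Sum>y\<in>{y. f y \<noteq> 0}. f y ^ (q - 1 - i) * y ^ ?k)" unfolding W_def
      using l by (intro sum.mono_neutral_right) (auto simp: power_0_left)
    also have "\<dots> = (\<Sum>(t, s)\<in>(base - {0}) \<times> ?S. s ^ ?k)"
    \<comment> \<open>Every y with f y not 0 is uniquely t * s with t = f y in \<open>base\<close>
      and f s = 1.\<close>
    proof (rule sum.reindex_bij_witness[of _ "\<lambda>(t, s). t * s" "\<lambda>y. (f y, y / f y)"])
      fix y assume y: "y \<in> {y. f y \<noteq> 0}"
      have inv: "1 / f y \<in> base" using f_base[of y] by (simp add: base_iff power_divide)
      have "f (y / f y) = 1" using hom[OF inv, of y] y by simp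
      thus "(f y, y / f y) \<in> (base - {0}) \<times> ?S" using y f_base by simp
      have "f y ^ (q - 1 - i) * f y ^ ?k = f y ^ (q - 1)"
      proof -
        have "f y ^ (q * \<alpha>) = f y ^ \<alpha>" using f_base[of y] by (simp add: power_mult base_iff)
        hence "f y ^ ?k = f y ^ (i - \<alpha>) * f y ^ \<alpha>" by (simp only: power_add)
        also have "\<dots> = f y ^ i" using \<alpha> by (simp flip: power_add)
        finally have "f y ^ ?k = f y ^ i" .
        thus ?thesis using i by (simp flip: power_add)
      qed
      also have "\<dots> = 1" using y f_base by (intro power_q_minus_1_base) auto
      finally have "f y ^ (q - 1 - i) * f y ^ ?k = 1" .
      thus "(case (f y, y / f y) of (t, s) \<Rightarrow> s ^ ?k) = f y ^ (q - 1 - i) * y ^ ?k"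
        using y by (simp add: power_divide field_simps)
    qed (auto simp: hom)
    also have "\<dots> = (\<Sum>t\<in>base - {0}. \<Sum>s\<in>?S. s ^ ?k)" by (rule sum.cartesian_product[symmetric])
    also have "\<dots> = of_nat (q - 1) * (\<Sum>s\<in>?S. s ^ ?k)" using card_norm_fibre_base by simp
    also have "\<dots> = - (\<Sum>s\<in>?S. s ^ ?k)" using q_gt_1 by (simp add: of_nat_diff)
    finally show ?thesis .
  qed
  ultimately show ?thesis by simp
qed

text \<open>If s - s' = w were outside \<open>base\<close>, take a GF(q)-linear form
  \<open>l\<close> whose kernel is spanned by w. The vanishing moments make the number of s in the
  level set with l s = c, taken in the field, independent of c. By homogeneity the kernel contains
  exactly one such s, so \<open>l\<close> is onto \<open>base\<close>, hence injective on the q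
  elements; but l s = l s'.\<close>

lemma level_set_diff_in_base:
  assumes s: "f s = 1" "f s' = 1" shows "s - s' \<in> base"
proof (rule ccontr)
  assume nb: "s - s' \<notin> base"
  let ?S = "{s. f s = 1}"
  define w where "w = s - s'"
  have w: "w \<notin> base" using nb by (simp add: w_def)
  hence w0: "w \<noteq> 0" by auto
  \<comment> \<open>w * x^q - w^q * x has kernel w times \<open>base\<close>, but its q-th power is
    its negative; the factor \<open>\<epsilon>\<close>, also negated by Frobenius, moves the values
    into \<open>base\<close>.\<close>
  define \<epsilon> where "\<epsilon> = w - w ^ q"
  have \<epsilon>: "\<epsilon> \<noteq> 0" "\<epsilon> ^ q = - \<epsilon>" using w by (auto simp: \<epsilon>_def base_iff frob_diff)
  define u where "u = w * \<epsilon>"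
  define l where "l x = u * x ^ q + u ^ q * x" for x
  have l_alt: "l x = \<epsilon> * (w * x ^ q - w ^ q * x)" for x
    by (simp add: l_def u_def power_mult_distrib \<epsilon>(2) algebra_simps)
  have l_base: "l x \<in> base" for x
    by (simp add: l_def base_iff frob_add power_mult_distrib)
  have cardS: "card ?S = q" using f_fibre[of 1] by simp
  have sums: "(\<Sum>s\<in>?S. l s ^ i) = 0" if i: "0 < i" "i < q - 1" for i
  proof -
    have "(\<Sum>s\<in>?S. l s ^ i) = (\<Sum>s\<in>?S. \<Sum>\<alpha>\<le>i. of_nat (i choose \<alpha>) * (u * s ^ q) ^ \<alpha> * (u ^ q * s) ^ (i - \<alpha>))"
      unfolding l_def by (simp only: binomial_ring)
    also have "\<dots> = (\<Sum>\<alpha>\<le>i. \<Sum>s\<in>?S. of_nat (i choose \<alpha>) * (u * s ^ q) ^ \<alpha> * (u ^ q * s) ^ (i - \<alpha>))"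
      by (rule sum.swap)
    also have "\<dots> = (\<Sum>\<alpha>\<le>i. u ^ \<alpha> * (u ^ q) ^ (i - \<alpha>) * (of_nat (i choose \<alpha>) * (\<Sum>s\<in>?S. s ^ (i - \<alpha> + q * \<alpha>))))"
      unfolding power_add power_mult power_mult_distrib by (simp only: sum_distrib_left mult_ac)
    also have "\<dots> = 0" using moments_of_level_set[OF i] by (intro sum.neutral) auto
    finally show ?thesis .
  qed
  \<comment> \<open>The moments with 0 < k < q - 1 vanish, and the one with k = 0 is
    \<open>q\<close>, which is 0 in the field; only the leading moment is left, and c does not occur
    in it.\<close>
  have count: "of_nat (card {s\<in>?S. l s = c}) = - (\<Sum>s\<in>?S. l s ^ (q - 1))" if c: "c \<in> base" for c
  proof -
    have "1 - (l s - c) ^ (q - 1) = (if l s = c then 1 else 0)" for s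
      using power_q_minus_1_base[of "l s - c"] base_diff[OF l_base c, of s] q_gt_1
      by (auto simp: power_0_left)
    hence "(\<Sum>s\<in>?S. 1 - (l s - c) ^ (q - 1)) = (\<Sum>s\<in>?S. if l s = c then 1 else 0)" by simp
    hence "of_nat (card {s\<in>?S. l s = c}) = - (\<Sum>s\<in>?S. (l s - c) ^ (q - 1))"
      using cardS by (simp add: sum_subtractf sum.If_cases Int_def)
    also have "(\<Sum>s\<in>?S. (l s - c) ^ (q - 1)) = (\<Sum>s\<in>?S. \<Sum>k\<le>q - 1. of_nat ((q - 1) choose k) * l s ^ k * (- c) ^ (q - 1 - k))"
      by (simp only: diff_conv_add_uminus binomial_ring)
    also have "\<dots> = (\<Sum>k\<le>q - 1. \<Sum>s\<in>?S. of_nat ((q - 1) choose k) * l s ^ k * (- c) ^ (q - 1 - k))"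
      by (rule sum.swap)
    also have "\<dots> = (\<Sum>k\<le>q - 1. of_nat ((q - 1) choose k) * (- c) ^ (q - 1 - k) * (\<Sum>s\<in>?S. l s ^ k))"
      by (simp only: sum_distrib_left mult_ac)
    also have "\<dots> = (\<Sum>k\<in>{q - 1}. of_nat ((q - 1) choose k) * (- c) ^ (q - 1 - k) * (\<Sum>s\<in>?S. l s ^ k))"
    proof (rule sum.mono_neutral_right)
      show "\<forall>k\<in>{..q - 1} - {q - 1}. of_nat ((q - 1) choose k) * (- c) ^ (q - 1 - k) * (\<Sum>s\<in>?S. l s ^ k) = 0"
      proof
        fix k assume k: "k \<in> {..q - 1} - {q - 1}"
        have "(\<Sum>s\<in>?S. l s ^ k) = 0" using k sums[of k] cardS by (cases "k = 0") auto
        thus "of_nat ((q - 1) choose k) * (- c) ^ (q - 1 - k) * (\<Sum>s\<in>?S. l s ^ k) = 0" by simp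
      qed
    qed auto
    finally show ?thesis by simp
  qed
  have "{s\<in>?S. l s = 0} = {w / f w}"
  proof -
    have fw: "f w \<noteq> 0" using w f_zero by simp
    have "l x = 0 \<longleftrightarrow> x / w \<in> base" for x
      using \<epsilon>(1) w0 by (auto simp: l_alt base_iff power_divide field_simps)
    moreover have "x / w \<in> base \<and> f x = 1 \<longleftrightarrow> x = w / f w" for x
    proof
      assume x: "x / w \<in> base \<and> f x = 1"
      hence "f (x / w * w) = x / w * f w" by (intro hom) simp
      thus "x = w / f w" using x w0 fw by (simp add: field_simps)
    next
      assume x: "x = w / f w"
      have "1 / f w \<in> base" using f_base[of w] by (simp add: base_iff power_divide)
      moreover from this have "f (1 / f w * w) = 1 / f w * f w" by (rule hom)
      moreover have "x / w = 1 / f w" "x = 1 / f w * w" using x w0 by simp_all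
      ultimately show "x / w \<in> base \<and> f x = 1" using fw by simp
    qed
    ultimately show ?thesis by blast
  qed
  hence "(1::'a) = - (\<Sum>s\<in>?S. l s ^ (q - 1))" using count[of 0] by simp
  hence count1: "of_nat (card {s\<in>?S. l s = c}) = (1::'a)" if "c \<in> base" for c
    using count[OF that] by simp
  have "c \<in> l ` ?S" if "c \<in> base" for c
  proof (rule ccontr)
    assume "c \<notin> l ` ?S"
    hence "{s\<in>?S. l s = c} = {}" by auto
    hence "card {s\<in>?S. l s = c} = 0" by (simp only: card.empty)
    thus False using count1[OF that] by (simp only: of_nat_0 zero_neq_one)
  qed
  hence "l ` ?S = base" using l_base by auto
  hence "inj_on l ?S" by (intro eq_card_imp_inj_on) (simp_all add: cardS card_base)
  moreover have "l s - l s' = l w"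
    by (simp add: l_def w_def frob_diff algebra_simps)
  hence "l s = l s'" by (simp add: l_alt[of w] mult.commute)
  ultimately have "s = s'" using s by (auto simp: inj_on_def)
  thus False using nb by simp
qed

text \<open>For f y not 0, y / f y lies in the same coset of \<open>base\<close> as a fixed s0 of
  value 1, so x - x^q takes the same value at both. Solving for f y gives the formula.\<close>

lemma f_eq_trace_zero_multiple:
  "\<exists>k. k \<noteq> 0 \<and> k ^ q = - k \<and> (\<forall>y. f y = k * (y - y ^ q))"
proof -
  let ?S = "{s. f s = 1}"
  have cardS: "card ?S = q" using f_fibre[of 1] by simp
  hence "?S \<noteq> {}" using q_gt_1 by (metis card.empty not_less_zero)
  then obtain s0 where s0: "f s0 = 1" by blast
  have nz: "s0 - s0 ^ q \<noteq> 0" using s0 f_zero[of s0] by (auto simp: base_iff)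
  define k where "k = 1 / (s0 - s0 ^ q)"
  have "k ^ q = 1 / (s0 ^ q - s0)" by (simp add: k_def power_divide frob_diff)
  also have "\<dots> = - k" using minus_divide_right[of 1 "s0 - s0 ^ q"] by (simp add: k_def)
  finally have "k ^ q = - k" .
  moreover have "f y = k * (y - y ^ q)" for y
  proof (cases "f y = 0")
    case True
    thus ?thesis using f_zero[of y] by (simp add: base_iff)
  next
    case False
    have inv: "1 / f y \<in> base" using f_base[of y] by (simp add: base_iff power_divide)
    have "f (y / f y) = 1" using hom[OF inv, of y] False by simp
    hence "y / f y - s0 \<in> base" using s0 by (intro level_set_diff_in_base)
    hence "(y / f y) ^ q - s0 ^ q = y / f y - s0" by (simp add: base_iff frob_diff)
    hence "y / f y - y ^ q / f y = s0 - s0 ^ q"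
      using f_base[of y] by (simp add: base_iff power_divide) (metis diff_add_cancel add_diff_cancel diff_diff_eq2 add.commute)
    hence "y - y ^ q = (s0 - s0 ^ q) * f y" using False by (simp add: field_simps)
    thus ?thesis using nz by (simp add: k_def)
  qed
  ultimately show ?thesis using nz by (intro exI[of _ k]) (simp add: k_def)
qed

end

text \<open>The coefficient of y in \<open>f\<close> determines the multiplier: substituting t * y
  multiplies its defining sum by c * t^(q^2 - 2) = c / t, and the sum is not zero.\<close>

lemma f_classical:
  assumes scal: "\<And>t. t \<in> base \<Longrightarrow> t \<noteq> 0 \<Longrightarrow> \<exists>c. \<forall>y. f (t * y) = c * f y"
  shows "\<exists>k. k \<noteq> 0 \<and> k ^ q = - k \<and> (\<forall>y. f y = k * (y - y ^ q))"
proof (rule f_eq_trace_zero_multiple)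
  fix t y assume t: "t \<in> base"
  show "f (t * y) = t * f y"
  proof (cases "t = 0")
    case True
    thus ?thesis using f_zero[of 0] by simp
  next
    case t0: False
    show ?thesis
    proof (cases "q = 2")
      \<comment> \<open>For q = 2 the only nonzero scalar is 1.\<close>
      case True
      thus ?thesis using power_q_minus_1_base[OF t t0] by simp
    next
      case False
      hence q3: "q \<ge> 3" using q_gt_1 by linarith
      obtain c where c: "\<And>y. f (t * y) = c * f y" using scal[OF t t0] by blast
      define M where "M = (\<Sum>y\<in>UNIV. f y * y ^ (q\<^sup>2 - 2))"
      have "M = (\<Sum>y\<in>UNIV. f (t * y) * (t * y) ^ (q\<^sup>2 - 2))" unfolding M_def
        by (rule sum.reindex_bij_witness[of _ "\<lambda>y. t * y" "\<lambda>y. y / t"]) (use t0 in auto)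
      also have "\<dots> = c * t ^ (q\<^sup>2 - 2) * M"
        unfolding M_def c power_mult_distrib by (simp add: sum_distrib_left mult_ac)
      finally have "c * t ^ (q\<^sup>2 - 2) = 1" using linear_coefficient_neq_0[OF q3] by (simp add: M_def)
      hence "c * (t ^ (q\<^sup>2 - 2) * t) = t" by (simp only: mult.assoc[symmetric] mult_1)
      moreover have "t ^ (q\<^sup>2 - 2) * t = t ^ (q\<^sup>2 - 1)"
        using q2_gt by (subst power_Suc2[symmetric]) (simp add: Suc_diff_Suc numeral_2_eq_2)
      ultimately have "c = t" using power_card_minus_1[OF t0] by simp
      thus ?thesis using c by simp
    qed
  qed
qed

end

section \<open>Coordinates from a large torus\<close>

context square_field
begin

text \<open>Multiplication by a permutes \<open>K\<close>, so the product of all elements of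
  \<open>K\<close> absorbs the factor a^(card K).\<close>

lemma power_card_of_closed:
  fixes K :: "'a set"
  assumes "0 \<notin> K" and closed: "\<And>a b. a \<in> K \<Longrightarrow> b \<in> K \<Longrightarrow> a * b \<in> K" and a: "a \<in> K"
  shows "a ^ card K = 1"
proof -
  have a0: "a \<noteq> 0" using assms by auto
  have "(*) a ` K = K"
    by (rule card_subset_eq) (use closed a a0 in \<open>auto intro!: card_image simp: inj_on_def\<close>)
  hence "(\<Prod>b\<in>K. b) = (\<Prod>b\<in>(*) a ` K. b)" by simp
  also have "\<dots> = (\<Prod>b\<in>K. a * b)" by (rule prod.reindex_cong[of "(*) a"]) (use a0 in \<open>auto simp: inj_on_def\<close>)
  also have "\<dots> = a ^ card K * (\<Prod>b\<in>K. b)" by (simp add: prod.distrib)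
  finally show ?thesis using assms(1) by simp
qed

text \<open>The y-multipliers \<open>T\<close> act freely on the q - 1 nonzero points of the line x
  = 0, and the kernel \<open>K\<close> acts freely on the points with x not 0 of a horizontal line.
  So card T is at most q - 1 and card K at most q + 1, and the size of \<open>G\<close> forces
  equality. The orders identify \<open>T\<close> with the nonzero part of \<open>base\<close> and
  \<open>K\<close> with the elements of norm 1, so each horizontal section is a single norm
  fibre.\<close>

lemma norm_function_of_torus:
  fixes A :: "('a \<times> 'a) set"
  defines "G \<equiv> {(a, t). a \<noteq> 0 \<and> t \<noteq> 0 \<and> (\<forall>x y. (x, y) \<in> A \<longleftrightarrow> (a * x, t * y) \<in> A)}"
  assumes lines: "\<And>m b. card {x. (x, m * x + b) \<in> A} \<in> {1, q + 1}"
    and vert: "\<And>x. card {y. (x, y) \<in> A} = q"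
    and axis: "\<And>x. (x, 0) \<in> A \<longleftrightarrow> x = 0"
    and card_G: "card G \<ge> q\<^sup>2 - 1"
  obtains y1 f where "y1 \<noteq> 0" "unital_function q f"
    "\<And>x y. (x, y1 * y) \<in> A \<longleftrightarrow> x ^ (q + 1) = f y"
    "\<And>t. t ^ q = t \<Longrightarrow> t \<noteq> 0 \<Longrightarrow> \<exists>c. \<forall>y. f (t * y) = c * f y"
proof -
  define Y where "Y = {y. y \<noteq> 0 \<and> (0, y) \<in> A}"
  define T where "T = snd ` G"
  define K where "K = {a. (a, 1) \<in> G}"
  have fin: "finite X" for X :: "('a \<times> 'a) set" by (rule finite_subset[OF _ finite_class.finite_UNIV]) auto
  have card_Y: "card Y = q - 1"
  proof -
    have "{y. (0, y) \<in> A} = insert 0 Y" using axis[of 0] by (auto simp: Y_def)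
    hence "card (insert 0 Y) = q" using vert[of 0] by simp
    thus ?thesis by (simp add: Y_def card_insert_if)
  qed
  hence "Y \<noteq> {}" using q_gt_1 by (intro notI) simp
  then obtain y1 where y1: "y1 \<in> Y" by blast
  have y10: "y1 \<noteq> 0" using y1 by (simp add: Y_def)
  have GY: "t * y \<in> Y" if "t \<in> T" "y \<in> Y" for t y
  proof -
    obtain a where "(a, t) \<in> G" using \<open>t \<in> T\<close> by (auto simp: T_def)
    hence "t \<noteq> 0" "(0, y) \<in> A \<longleftrightarrow> (a * 0, t * y) \<in> A" unfolding G_def by blast+
    thus ?thesis using \<open>y \<in> Y\<close> by (simp add: Y_def)
  qed
  have inj_T: "inj_on (\<lambda>t. t * y1) T" using y10 by (auto simp: inj_on_def)
  have T_sub: "(\<lambda>t. t * y1) ` T \<subseteq> Y" using GY y1 by auto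
  have card_T: "card T \<le> q - 1"
    using card_mono[OF _ T_sub] card_image[OF inj_T] card_Y by simp
  \<comment> \<open>Otherwise all q * (q^2 - 1) points with x not 0 would lie on the q - 1
    horizontal lines through \<open>Y\<close>, each of which has at most q of them.\<close>
  have "\<exists>x c. x \<noteq> 0 \<and> (x, c) \<in> A \<and> (0, c) \<notin> A"
  proof (rule ccontr)
    assume no: "\<not> ?thesis"
    define W where "W = {(x, c) \<in> A. x \<noteq> 0}"
    have "card W = (\<Sum>x\<in>UNIV - {0}. card {X \<in> W. fst X = x})"
    proof -
      have "(\<Sum>x\<in>UNIV - {0}. \<Sum>X\<in>{X \<in> W. fst X = x}. 1) = (\<Sum>X\<in>W. 1 :: nat)"
        by (rule sum.group) (auto simp: W_def fin)
      thus ?thesis by simp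
    qed
    also have "\<dots> = (\<Sum>x\<in>UNIV - {0::'a}. q)"
    proof (rule sum.cong[OF refl])
      fix x :: 'a assume x: "x \<in> UNIV - {0}"
      have "card {X \<in> W. fst X = x} = card {y. (x, y) \<in> A}"
        by (rule bij_betw_same_card[of snd], rule bij_betw_byWitness[where f' = "\<lambda>y. (x, y)"])
          (use x in \<open>auto simp: W_def\<close>)
      thus "card {X \<in> W. fst X = x} = q" using vert by simp
    qed
    finally have "card W = (q\<^sup>2 - 1) * q" by (simp add: card_F)
    moreover have "card W \<le> (q - 1) * q"
    proof -
      have sub: "snd ` W \<subseteq> Y" using no axis by (force simp: W_def Y_def)
      have "card W = (\<Sum>c\<in>Y. card {X \<in> W. snd X = c})"
      proof -
        have "(\<Sum>c\<in>Y. \<Sum>X\<in>{X \<in> W. snd X = c}. 1) = (\<Sum>X\<in>W. 1 :: nat)"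
          by (rule sum.group) (use sub in \<open>auto simp: fin\<close>)
        thus ?thesis by simp
      qed
      also have "\<dots> \<le> (\<Sum>c\<in>Y. q)"
      proof (rule sum_mono)
        fix c assume c: "c \<in> Y"
        have "card {X \<in> W. snd X = c} = card ({x. (x, 0 * x + c) \<in> A} - {0})"
          by (rule bij_betw_same_card[of fst], rule bij_betw_byWitness[where f' = "\<lambda>x. (x, c)"])
            (auto simp: W_def)
        also have "\<dots> = card {x. (x, 0 * x + c) \<in> A} - 1"
          by (rule card_Diff_singleton) (use c in \<open>simp add: Y_def\<close>)
        also have "\<dots> \<le> q" using lines[of 0 c] by auto
        finally show "card {X \<in> W. snd X = c} \<le> q" .
      qed
      also have "\<dots> = (q - 1) * q" by (simp add: card_Y)
      finally show ?thesis .
    qed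
    ultimately have "q\<^sup>2 - 1 \<le> q - 1" using q_gt_1 by simp
    thus False using q2_gt q_gt_1 by linarith
  qed
  then obtain x0 c where x0: "x0 \<noteq> 0" "(x0, c) \<in> A" by blast
  have K_act: "(a * x, y) \<in> A" if "a \<in> K" "(x, y) \<in> A" for a x y
  proof -
    have "(x, y) \<in> A \<longleftrightarrow> (a * x, 1 * y) \<in> A" using \<open>a \<in> K\<close> unfolding K_def G_def by blast
    thus ?thesis using that by simp
  qed
  have K_nz: "0 \<notin> K" by (simp add: K_def G_def)
  have card_K: "card K \<le> q + 1"
  proof -
    have "card K = card ((\<lambda>a. a * x0) ` K)" using x0 by (intro card_image[symmetric]) (auto simp: inj_on_def)
    also have "\<dots> \<le> card {x. (x, 0 * x + c) \<in> A}" by (intro card_mono) (use K_act x0 in auto)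
    also have "\<dots> \<le> q + 1" using lines[of 0 c] by auto
    finally show ?thesis .
  qed
  have G_mult: "(a * a', t * t') \<in> G" if g: "(a, t) \<in> G" "(a', t') \<in> G" for a t a' t'
  proof -
    have "(x, y) \<in> A \<longleftrightarrow> (a * (a' * x), t * (t' * y)) \<in> A" for x y
      using g unfolding G_def by blast
    thus ?thesis using g by (simp add: G_def mult.assoc)
  qed
  have G_div: "(a / a', 1) \<in> G" if g: "(a, t) \<in> G" "(a', t) \<in> G" for a t a'
  proof -
    have nz: "a \<noteq> 0" "a' \<noteq> 0" "t \<noteq> 0" using g by (auto simp: G_def)
    have "(x, y) \<in> A \<longleftrightarrow> (a / a' * x, 1 * y) \<in> A" for x y
    proof -
      have "(x / a', y / t) \<in> A \<longleftrightarrow> (a * (x / a'), t * (y / t)) \<in> A" using g(1) unfolding G_def by blast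
      moreover have "(x / a', y / t) \<in> A \<longleftrightarrow> (a' * (x / a'), t * (y / t)) \<in> A" using g(2) unfolding G_def by blast
      ultimately show ?thesis using nz by simp
    qed
    thus ?thesis using nz by (simp add: G_def)
  qed
  \<comment> \<open>Division by a fixed element embeds each fibre of the projection onto
    \<open>T\<close> into \<open>K\<close>.\<close>
  have "card G \<le> card T * card K"
  proof -
    have "card G = (\<Sum>t\<in>T. card {g \<in> G. snd g = t})"
    proof -
      have "(\<Sum>t\<in>T. \<Sum>g\<in>{g \<in> G. snd g = t}. 1) = (\<Sum>g\<in>G. 1 :: nat)"
        by (rule sum.group) (auto simp: T_def fin)
      thus ?thesis by simp
    qed
    also have "\<dots> \<le> (\<Sum>t\<in>T. card K)"
    proof (rule sum_mono)
      fix t assume "t \<in> T"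
      then obtain a' where a': "(a', t) \<in> G" by (auto simp: T_def)
      have "a' \<noteq> 0" using a' by (simp add: G_def)
      show "card {g \<in> G. snd g = t} \<le> card K"
        by (rule card_inj_on_le[of "\<lambda>g. fst g / a'"])
          (use G_div[OF _ a'] \<open>a' \<noteq> 0\<close> in \<open>auto simp: inj_on_def K_def\<close>)
    qed
    finally show ?thesis by simp
  qed
  hence TK: "(q - 1) * (q + 1) \<le> card T * card K"
  proof -
    have "(q - 1) * (q + 1) = q\<^sup>2 - 1" using q_gt_1 by (simp add: power2_eq_square algebra_simps)
    thus ?thesis using card_G \<open>card G \<le> card T * card K\<close> by linarith
  qed
  have card_T': "card T = q - 1"
  proof -
    have "(q - 1) * (q + 1) \<le> card T * (q + 1)"
      using TK mult_le_mono2[OF card_K, of "card T"] by linarith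
    hence "q - 1 \<le> card T" by (subst (asm) mult_le_cancel2) simp
    thus ?thesis using card_T by linarith
  qed
  have card_K': "card K = q + 1"
  proof -
    have "(q - 1) * (q + 1) \<le> (q - 1) * card K" using TK card_T' by simp
    hence "q + 1 \<le> card K" using q_gt_1 by (subst (asm) mult_le_cancel1) simp
    thus ?thesis using card_K by linarith
  qed
  have K_eq: "K = {x. x ^ (q + 1) = 1}"
  proof (rule card_seteq)
    have "a * b \<in> K" if "a \<in> K" "b \<in> K" for a b using G_mult[of a 1 b 1] that by (simp add: K_def)
    thus "K \<subseteq> {x. x ^ (q + 1) = 1}" using power_card_of_closed[of K] K_nz card_K' by auto
    show "card {x::'a. x ^ (q + 1) = 1} \<le> card K" using card_roots_power_le[of "q + 1" "1::'a"] card_K' by simp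
  qed simp
  have T_eq: "T = base - {0}"
  proof -
    have "a * b \<in> T" if "a \<in> T" "b \<in> T" for a b using G_mult that by (force simp: T_def)
    moreover have "0 \<notin> T" by (auto simp: T_def G_def)
    ultimately have "T \<subseteq> {x. x ^ (q - 1) = 1}" using power_card_of_closed[of T] card_T' by auto
    hence "T \<subseteq> base - {0}" by (simp add: base_eq_roots)
    thus ?thesis using card_norm_fibre_base card_T' by (intro card_seteq) auto
  qed
  \<comment> \<open>After division by y1 the points on x = 0 are exactly \<open>base\<close>; this
    is the reason for the scaling by y1 in the conclusion.\<close>
  have Y_eq: "Y = (\<lambda>t. t * y1) ` (base - {0})"
    using card_seteq[OF _ T_sub] card_image[OF inj_T] card_T' card_Y T_eq by simp
  have zero_iff: "(0, y1 * y) \<in> A \<longleftrightarrow> y \<in> base" for y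
  proof (cases "y = 0")
    case False
    hence "(0, y1 * y) \<in> A \<longleftrightarrow> y1 * y \<in> Y" using y10 by (simp add: Y_def)
    also have "\<dots> \<longleftrightarrow> y \<in> base" using y10 False by (auto simp: Y_eq mult.commute)
    finally show ?thesis .
  qed (use axis in simp)
  \<comment> \<open>A section containing a nonzero x contains the q + 1 elements of its
    \<open>K\<close>-orbit and has no room for more; otherwise it is just {0}, the fibre of norm
    0.\<close>
  have "\<exists>c\<in>base. {x. (x, y1 * y) \<in> A} = {x. x ^ (q + 1) = c}" for y
  proof (cases "\<exists>x. x \<noteq> 0 \<and> (x, y1 * y) \<in> A")
    case True
    then obtain x where x: "x \<noteq> 0" "(x, y1 * y) \<in> A" by blast
    have "{z. z ^ (q + 1) = x ^ (q + 1)} = {x. (x, y1 * y) \<in> A}"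
    proof (rule card_seteq)
      show "{z. z ^ (q + 1) = x ^ (q + 1)} \<subseteq> {x. (x, y1 * y) \<in> A}"
      proof
        fix z assume "z \<in> {z. z ^ (q + 1) = x ^ (q + 1)}"
        hence "(z / x) ^ (q + 1) = 1" using x by (simp add: power_divide)
        hence "z / x \<in> K" unfolding K_eq by blast
        from K_act[OF this x(2)] show "z \<in> {x. (x, y1 * y) \<in> A}" using x by simp
      qed
      have "card {z. z ^ (q + 1) = x ^ (q + 1)} = q + 1"
        using card_norm_fibre[OF norm_in_base, of x] x by simp
      thus "card {x. (x, y1 * y) \<in> A} \<le> card {z. z ^ (q + 1) = x ^ (q + 1)}"
        using lines[of 0 "y1 * y"] by auto
    qed simp
    thus ?thesis using norm_in_base[of x] by blast
  next
    case False
    hence "{x. (x, y1 * y) \<in> A} \<subseteq> {0}" by auto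
    moreover have "{x. (x, y1 * y) \<in> A} \<noteq> {}"
    proof
      assume "{x. (x, y1 * y) \<in> A} = {}"
      hence "card {x. (x, 0 * x + y1 * y) \<in> A} = 0" by simp
      thus False using lines[of 0 "y1 * y"] by auto
    qed
    ultimately have "{x. (x, y1 * y) \<in> A} = {0}" by auto
    moreover have "{x::'a. x ^ (q + 1) = 0} = {0}" by auto
    ultimately show ?thesis using zero_in_base by blast
  qed
  then obtain f where f: "f y \<in> base" "{x. (x, y1 * y) \<in> A} = {x. x ^ (q + 1) = f y}" for y
    by metis
  have A_iff: "(x, y1 * y) \<in> A \<longleftrightarrow> x ^ (q + 1) = f y" for x y using f(2)[of y] by blast
  show thesis
  proof (rule that[OF y10 _ A_iff])
    show "unital_function q f"
    proof
      show "f y = 0 \<longleftrightarrow> y \<in> base" for y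
        using A_iff[of 0 y] zero_iff[of y] by auto
      show "card {x. x ^ (q + 1) = f (m * x + b)} \<in> {1, q + 1}" for m b
        unfolding A_iff[symmetric] using lines[of "y1 * m" "y1 * b"] by (simp add: distrib_left mult.assoc)
      show "card {y. f y = x ^ (q + 1)} = q" for x
      proof -
        have "card {y. f y = x ^ (q + 1)} = card {y. (x, y) \<in> A}"
        proof (rule bij_betw_same_card[of "\<lambda>y. y1 * y"], rule bij_betw_byWitness[where f' = "\<lambda>y. y / y1"])
          have "f (y / y1) = x ^ (q + 1)" if "(x, y) \<in> A" for y
            using A_iff[of x "y / y1"] that y10 by simp
          thus "(\<lambda>y. y / y1) ` {y. (x, y) \<in> A} \<subseteq> {y. f y = x ^ (q + 1)}" by blast
          have "(x, y1 * y) \<in> A" if "f y = x ^ (q + 1)" for y using A_iff[of x y] that by simp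
          thus "(*) y1 ` {y. f y = x ^ (q + 1)} \<subseteq> {y. (x, y) \<in> A}" by blast
        qed (use y10 in auto)
        thus ?thesis using vert by simp
      qed
    qed (rule f)
  next
    fix t :: 'a assume "t ^ q = t" "t \<noteq> 0"
    hence "t \<in> T" by (simp add: T_eq base_iff)
    then obtain a where a: "(a, t) \<in> G" by (auto simp: T_def)
    have "f (t * y) = a ^ (q + 1) * f y" for y
    proof -
      have "card {x. x ^ (q + 1) = f y} \<noteq> 0" using card_norm_fibre[OF f(1)[of y]] by simp
      hence "{x. x ^ (q + 1) = f y} \<noteq> {}" by (intro notI) (simp only: card.empty)
      then obtain x where x: "x ^ (q + 1) = f y" by blast
      hence "(x, y1 * y) \<in> A" using A_iff by blast
      hence "(a * x, t * (y1 * y)) \<in> A" using a unfolding G_def by blast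
      hence "(a * x, y1 * (t * y)) \<in> A" by (simp only: mult.left_commute)
      hence "(a * x) ^ (q + 1) = f (t * y)" using A_iff by blast
      thus ?thesis unfolding x[symmetric] by (simp only: power_mult_distrib)
    qed
    thus "\<exists>c. \<forall>y. f (t * y) = c * f y" by blast
  qed
qed

end

section \<open>Unitals in coordinates\<close>

definition comb :: "'a::field ^ 3 \<Rightarrow> 'a ^ 3 \<Rightarrow> 'a ^ 3 \<Rightarrow> 'a \<Rightarrow> 'a \<Rightarrow> 'a \<Rightarrow> 'a ^ 3" where
  "comb e1 e2 e3 x y z = x *s e1 + y *s e2 + z *s e3"

definition basis3 :: "'a::field ^ 3 \<Rightarrow> 'a ^ 3 \<Rightarrow> 'a ^ 3 \<Rightarrow> bool" where
  "basis3 e1 e2 e3 \<longleftrightarrow> (\<forall>x y z. comb e1 e2 e3 x y z = 0 \<longrightarrow> x = 0 \<and> y = 0 \<and> z = 0)"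

definition frame :: "'a::field ^ 3 \<Rightarrow> 'a ^ 3 \<Rightarrow> 'a ^ 3 \<Rightarrow> 'a ^ 3 ^ 3" where
  "frame e1 e2 e3 = transpose (vector [e1, e2, e3])"

lemma frame_mult: "frame e1 e2 e3 *v c = comb e1 e2 e3 (c $ 1) (c $ 2) (c $ 3)"
  by (simp add: frame_def comb_def vec_eq_iff matrix_vector_mult_def transpose_def sum_3 vector_3 mult.commute)

lemma comb_eq_iff:
  assumes "basis3 e1 e2 e3"
  shows "comb e1 e2 e3 x y z = comb e1 e2 e3 x' y' z' \<longleftrightarrow> x = x' \<and> y = y' \<and> z = z'"
proof
  assume "comb e1 e2 e3 x y z = comb e1 e2 e3 x' y' z'"
  hence "comb e1 e2 e3 (x - x') (y - y') (z - z') = 0"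
    by (simp add: comb_def vec.scale_left_diff_distrib algebra_simps)
  hence "x - x' = 0 \<and> y - y' = 0 \<and> z - z' = 0" using assms unfolding basis3_def by blast
  thus "x = x' \<and> y = y' \<and> z = z'" by simp
qed simp

lemma comb_scale: "k *s comb e1 e2 e3 x y z = comb e1 e2 e3 (k * x) (k * y) (k * z)"
  by (simp add: comb_def vec.scale_right_distrib)

lemma comb_eq_0_iff: "basis3 e1 e2 e3 \<Longrightarrow> comb e1 e2 e3 x y z = 0 \<longleftrightarrow> x = 0 \<and> y = 0 \<and> z = 0"
  by (auto simp: basis3_def comb_def)

lemma invertible_frame:
  assumes "basis3 e1 e2 e3" shows "invertible (frame e1 e2 e3)"
proof -
  have "c = c'" if "frame e1 e2 e3 *v c = frame e1 e2 e3 *v c'" for c c'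
  proof -
    have "c $ 1 = c' $ 1 \<and> c $ 2 = c' $ 2 \<and> c $ 3 = c' $ 3"
      using that by (simp add: frame_mult comb_eq_iff[OF assms])
    thus ?thesis by (simp add: vec_eq_iff forall_3)
  qed
  hence "inj ((*v) (frame e1 e2 e3))" by (rule injI)
  thus ?thesis using matrix_left_invertible_injective invertible_left_inverse by blast
qed

lemma comb_surj:
  assumes "basis3 e1 e2 e3" obtains x y z where "v = comb e1 e2 e3 x y z"
proof -
  obtain B where "frame e1 e2 e3 ** B = mat 1" using invertible_frame[OF assms] by (auto simp: invertible_def)
  hence "v = frame e1 e2 e3 *v (B *v v)" by (simp add: matrix_vector_mul_assoc)
  thus thesis using that by (simp add: frame_mult)
qed

lemma basis3_perm: "basis3 e1 e2 e3 \<Longrightarrow> basis3 e2 e1 e3" "basis3 e1 e2 e3 \<Longrightarrow> basis3 e3 e1 e2"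
proof -
  have "comb e2 e1 e3 x y z = comb e1 e2 e3 y x z" "comb e3 e1 e2 x y z = comb e1 e2 e3 y z x" for x y z
    by (simp_all add: comb_def add_ac)
  thus "basis3 e1 e2 e3 \<Longrightarrow> basis3 e2 e1 e3" "basis3 e1 e2 e3 \<Longrightarrow> basis3 e3 e1 e2"
    unfolding basis3_def by simp_all
qed

lemma span_pair: "vec.span {a, b :: 'a::field ^ 3} = {k *s a + l *s b | k l. True}"
proof -
  have "x \<in> vec.span {a, b} \<longleftrightarrow> (\<exists>k l. x = k *s a + l *s b)" for x
  proof
    assume "x \<in> vec.span {a, b}"
    then obtain k l where "x - k *s a = l *s b" by (auto simp: vec.span_breakdown_eq vec.span_singleton)
    hence "x = k *s a + l *s b" by (metis add.commute diff_add_cancel)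
    thus "\<exists>k l. x = k *s a + l *s b" by blast
  next
    assume "\<exists>k l. x = k *s a + l *s b"
    then obtain k l where "x = k *s a + l *s b" by blast
    moreover have "k *s a + l *s b \<in> vec.span {a, b}"
      by (intro vec.span_add vec.span_scale vec.span_base) simp_all
    ultimately show "x \<in> vec.span {a, b}" by simp
  qed
  thus ?thesis by blast
qed

lemma span_single_eq_iff:
  fixes v w :: "'a::field ^ 3"
  shows "v \<noteq> 0 \<Longrightarrow> vec.span {v} = vec.span {w} \<longleftrightarrow> (\<exists>k. k \<noteq> 0 \<and> v = k *s w)"
proof
  assume v: "v \<noteq> 0" and eq: "vec.span {v} = vec.span {w}"
  have "v \<in> vec.span {w}" using eq vec.span_base[of v "{v}"] by simp
  thus "\<exists>k. k \<noteq> 0 \<and> v = k *s w" using v by (auto simp: vec.span_singleton)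
next
  assume "\<exists>k. k \<noteq> 0 \<and> v = k *s w"
  then obtain k where k: "k \<noteq> 0" "v = k *s w" by blast
  have "w = (1 / k) *s v" using k by simp
  hence "w \<in> vec.span {v}" "v \<in> vec.span {w}"
    using k(2) vec.span_scale[OF vec.span_base[of v "{v}"], of "1 / k"]
      vec.span_scale[OF vec.span_base[of w "{w}"], of k] by auto
  thus "vec.span {v} = vec.span {w}" by (simp add: vec.span_eq)
qed

lemma span_scale_eq: "k \<noteq> 0 \<Longrightarrow> vec.span {k *s (v :: 'a::field ^ 3)} = vec.span {v}"
  by (cases "v = 0") (auto simp: span_single_eq_iff)

lemma pg_point_iff: "X \<in> pg_points \<longleftrightarrow> (\<exists>v :: 'a::field ^ 3. v \<noteq> 0 \<and> X = vec.span {v})"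
proof
  assume X: "X \<in> pg_points"
  obtain B where B: "B \<subseteq> X" "vec.independent B" "X \<subseteq> vec.span B" "card B = vec.dim X" by (rule vec.basis_exists)
  have "card B = 1" using B(4) X by (simp add: pg_points_def)
  then obtain v where v: "B = {v}" by (rule card_1_singletonE)
  have "vec.span {v} \<subseteq> X" using B(1) v X by (intro vec.span_minimal) (auto simp: pg_points_def)
  moreover have "v \<noteq> 0" using B(2) v vec.dependent_zero by auto
  ultimately show "\<exists>v. v \<noteq> 0 \<and> X = vec.span {v}" using B(3) v by blast
next
  assume "\<exists>v :: 'a ^ 3. v \<noteq> 0 \<and> X = vec.span {v}"
  then obtain v :: "'a ^ 3" where v: "v \<noteq> 0" "X = vec.span {v}" by blast
  have "vec.independent {v}" using v by (simp add: vec.independent_insert)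
  hence "vec.dim X = 1" using v vec.dim_eq_card_independent[of "{v}"] by simp
  thus "X \<in> pg_points" using v by (simp add: pg_points_def vec.subspace_span)
qed

lemma span_pair_line:
  fixes a b :: "'a::field ^ 3"
  assumes "\<And>k l. k *s a + l *s b = 0 \<Longrightarrow> k = 0 \<and> l = 0"
  shows "vec.span {a, b} \<in> pg_lines"
proof -
  have b0: "b \<noteq> 0" using assms[of 0 1] by auto
  have ab: "a \<notin> vec.span {b}"
  proof
    assume "a \<in> vec.span {b}"
    then obtain k where "a = k *s b" by (auto simp: vec.span_singleton)
    hence "1 *s a + (- k) *s b = 0" by simp
    thus False using assms[of 1 "- k"] by simp
  qed
  hence "a \<noteq> b" using vec.span_base[of b "{b}"] by auto
  moreover have "vec.independent {a, b}" using ab b0 by (simp add: vec.independent_insert)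
  ultimately have "vec.dim (vec.span {a, b}) = 2" using vec.dim_eq_card_independent[of "{a, b}"] by simp
  thus ?thesis by (simp add: pg_lines_def vec.subspace_span)
qed

lemma span_subset_iff: "vec.subspace L \<Longrightarrow> vec.span {v :: 'a::field ^ 3} \<subseteq> L \<longleftrightarrow> v \<in> L"
  using vec.span_minimal[of "{v}" L] vec.span_base[of v "{v}"] by blast

lemma exists_basis3:
  fixes e :: "'a::field ^ 3" assumes "e \<noteq> 0" obtains c1 c3 where "basis3 e c1 c3"
proof -
  have dim: "vec.span S \<noteq> UNIV" if "finite S" "card S < 3" for S :: "('a ^ 3) set"
  proof
    assume "vec.span S = UNIV"
    hence "vec.dim S = 3" using vec.dim_span[of S] vec_dim_card[where ?'a = 'a and ?'n = 3] by simp
    thus False using vec.dim_le_card'[OF that(1)] that(2) by simp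
  qed
  have "card {e} < 3" by simp
  then obtain c1 where c1: "c1 \<notin> vec.span {e}" using dim[of "{e}"] by auto
  have "card {c1, e} < 3" by (rule le_less_trans[OF card_insert_le_m1]) auto
  then obtain c3 where c3: "c3 \<notin> vec.span {c1, e}" using dim[of "{c1, e}"] by auto
  have "basis3 e c1 c3" unfolding basis3_def
  proof (intro allI impI)
    fix x y z assume 0: "comb e c1 c3 x y z = 0"
    have z: "z = 0"
    proof (rule ccontr)
      assume z: "z \<noteq> 0"
      have "z *s c3 = (- y) *s c1 + (- x) *s e" using 0 by (simp add: comb_def algebra_simps eq_neg_iff_add_eq_0)
      hence "z *s c3 \<in> vec.span {c1, e}" unfolding span_pair by blast
      hence "(1 / z) *s (z *s c3) \<in> vec.span {c1, e}" by (rule vec.span_scale)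
      thus False using z c3 by simp
    qed
    have y: "y = 0"
    proof (rule ccontr)
      assume y: "y \<noteq> 0"
      have "y *s c1 = (- x) *s e" using 0 z by (simp add: comb_def eq_neg_iff_add_eq_0 add.commute)
      moreover have "(- x) *s e \<in> vec.span {e}" by (intro vec.span_scale vec.span_base) simp
      ultimately have "y *s c1 \<in> vec.span {e}" by simp
      hence "(1 / y) *s (y *s c1) \<in> vec.span {e}" by (rule vec.span_scale)
      thus False using y c1 by simp
    qed
    show "x = 0 \<and> y = 0 \<and> z = 0" using 0 y z assms by (simp add: comb_def)
  qed
  thus thesis by (rule that)
qed

section \<open>Pencils of lines through a point of the unital\<close>

context square_field
begin

lemma pencil_line:
  fixes U :: "('a ^ 3) set set"
  assumes U: "is_unital q U" and B: "basis3 e c1 c3" and X: "vec.span {e} \<in> U"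
  shows "vec.span {e, l *s c1 + c3} \<in> pg_lines"
    and "card {Y\<in>U. Y \<subseteq> vec.span {e, l *s c1 + c3}} = 1 + card {w. vec.span {comb e c1 c3 w l 1} \<in> U}"
proof -
  let ?L = "vec.span {e, l *s c1 + c3}"
  have cmb: "k *s e + k' *s (l *s c1 + c3) = comb e c1 c3 k (k' * l) k'" for k k'
    by (simp add: comb_def vec.scale_right_distrib add.assoc)
  have e: "e = comb e c1 c3 1 0 0" by (simp add: comb_def)
  show "?L \<in> pg_lines" by (rule span_pair_line) (auto simp only: cmb comb_eq_0_iff[OF B])
  have sub: "vec.subspace ?L" by (rule vec.subspace_span)
  have nz: "comb e c1 c3 w l 1 \<noteq> 0" for w by (simp add: comb_eq_0_iff[OF B])
  have "{Y\<in>U. Y \<subseteq> ?L} = insert (vec.span {e}) ((\<lambda>w. vec.span {comb e c1 c3 w l 1}) ` {w. vec.span {comb e c1 c3 w l 1} \<in> U})"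
    (is "?A = insert _ (?g ` ?W)")
  proof (intro equalityI subsetI)
    fix Y assume Y: "Y \<in> ?A"
    hence "Y \<in> pg_points" using U by (auto simp: is_unital_def)
    then obtain v where v: "v \<noteq> 0" "Y = vec.span {v}" by (auto simp: pg_point_iff)
    hence "v \<in> ?L" using Y span_subset_iff[OF sub] by blast
    then obtain k k' where "v = k *s e + k' *s (l *s c1 + c3)" unfolding span_pair by blast
    hence vk: "v = comb e c1 c3 k (k' * l) k'" by (simp only: cmb)
    show "Y \<in> insert (vec.span {e}) (?g ` ?W)"
    proof (cases "k' = 0")
      case True
      have "v = k *s e" using vk True by (simp add: comb_def)
      thus ?thesis using v span_scale_eq[of k e] by (cases "k = 0") auto
    next
      case False
      have "v = k' *s comb e c1 c3 (k / k') l 1" using False by (simp add: vk comb_scale)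
      hence "Y = ?g (k / k')" using v span_scale_eq[OF False] by simp
      thus ?thesis using Y by blast
    qed
  next
    fix Y assume "Y \<in> insert (vec.span {e}) (?g ` ?W)"
    moreover have "comb e c1 c3 w l 1 \<in> ?L" for w
      using cmb[of w 1] unfolding span_pair by (metis (mono_tags, lifting) mem_Collect_eq mult_1)
    moreover have "e \<in> ?L" by (rule vec.span_base) simp
    ultimately show "Y \<in> ?A" using X span_subset_iff[OF sub] by auto
  qed
  moreover have "vec.span {e} \<notin> ?g ` ?W"
  proof
    assume "vec.span {e} \<in> ?g ` ?W"
    then obtain w where "vec.span {comb e c1 c3 w l 1} = vec.span {e}" by auto
    then obtain k where "comb e c1 c3 w l 1 = k *s comb e c1 c3 1 0 0"
      using span_single_eq_iff[OF nz] e by metis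
    thus False by (simp add: comb_scale comb_eq_iff[OF B])
  qed
  moreover have "inj ?g"
  proof (rule injI)
    fix w w' assume "?g w = ?g w'"
    then obtain k where "comb e c1 c3 w l 1 = k *s comb e c1 c3 w' l 1"
      using span_single_eq_iff[OF nz] by blast
    thus "w = w'" by (simp add: comb_scale comb_eq_iff[OF B])
  qed
  ultimately show "card ?A = 1 + card ?W"
    by (simp add: card_image inj_on_subset[OF \<open>inj ?g\<close>])
qed

lemma card_affine_points:
  fixes U :: "('a ^ 3) set set"
  assumes B: "basis3 e c1 c3"
  shows "card ((\<lambda>(l, w). vec.span {comb e c1 c3 w l 1}) ` {(l, w). vec.span {comb e c1 c3 w l 1} \<in> U})
    = (\<Sum>l\<in>UNIV. card {w. vec.span {comb e c1 c3 w l 1} \<in> U})"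
proof -
  let ?A = "{(l, w). vec.span {comb e c1 c3 w l 1} \<in> U}"
  let ?g = "\<lambda>(l, w). vec.span {comb e c1 c3 w l 1}"
  have nz: "comb e c1 c3 w l 1 \<noteq> 0" for w l by (simp add: comb_eq_0_iff[OF B])
  have "inj ?g"
  proof (rule injI)
    fix s s' assume eq: "?g s = ?g s'"
    obtain l w l' w' where s: "s = (l, w)" "s' = (l', w')" by (cases s, cases s')
    obtain k where "comb e c1 c3 w l 1 = k *s comb e c1 c3 w' l' 1"
      using span_single_eq_iff[OF nz] eq s by auto
    thus "s = s'" by (simp add: s comb_scale comb_eq_iff[OF B])
  qed
  hence "card (?g ` ?A) = card ?A" by (intro card_image) (auto intro: inj_on_subset)
  also have "card ?A = card (SIGMA l:UNIV. {w. vec.span {comb e c1 c3 w l 1} \<in> U})"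
    by (rule arg_cong[of _ _ card]) auto
  also have "\<dots> = (\<Sum>l\<in>UNIV. card {w. vec.span {comb e c1 c3 w l 1} \<in> U})" by (rule card_SigmaI) auto
  finally show ?thesis .
qed

lemma unital_finite: "is_unital q (U :: ('a ^ 3) set set) \<Longrightarrow> finite U"
  by (rule card_ge_0_finite) (simp add: is_unital_def)

text \<open>The q^2 lines through <e> other than the tangent <e, c1> share the q^3 remaining points
  of the unital, and each has at most q of them, so each has exactly q.\<close>

lemma pencil_card:
  fixes U :: "('a ^ 3) set set"
  assumes U: "is_unital q U" and B: "basis3 e c1 c3" and X: "vec.span {e} \<in> U"
    and tangent: "\<And>x y. vec.span {comb e c1 c3 x y 0} \<in> U \<Longrightarrow> y = 0"
  shows "card {w. vec.span {comb e c1 c3 w l 1} \<in> U} = q"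
proof -
  define n where "n l = card {w. vec.span {comb e c1 c3 w l 1} \<in> U}" for l
  let ?A = "{(l, w). vec.span {comb e c1 c3 w l 1} \<in> U}"
  let ?g = "\<lambda>(l, w). vec.span {comb e c1 c3 w l 1}"
  have e: "e = comb e c1 c3 1 0 0" by (simp add: comb_def)
  have nz: "comb e c1 c3 w l 1 \<noteq> 0" for w l by (simp add: comb_eq_0_iff[OF B])
  have "?g ` ?A = U - {vec.span {e}}"
  proof (intro equalityI subsetI)
    fix Y assume "Y \<in> ?g ` ?A"
    then obtain l w where Y: "Y \<in> U" "Y = vec.span {comb e c1 c3 w l 1}" by auto
    have "Y \<noteq> vec.span {e}"
    proof
      assume "Y = vec.span {e}"
      then obtain k where "comb e c1 c3 w l 1 = k *s comb e c1 c3 1 0 0"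
        using span_single_eq_iff[OF nz] e Y by metis
      thus False by (simp add: comb_scale comb_eq_iff[OF B])
    qed
    thus "Y \<in> U - {vec.span {e}}" using Y by simp
  next
    fix Y assume Y: "Y \<in> U - {vec.span {e}}"
    hence "Y \<in> pg_points" using U by (auto simp: is_unital_def)
    then obtain v where v: "v \<noteq> 0" "Y = vec.span {v}" by (auto simp: pg_point_iff)
    obtain x y z where xyz: "v = comb e c1 c3 x y z" by (rule comb_surj[OF B])
    have "z \<noteq> 0"
    proof
      assume z: "z = 0"
      hence "y = 0" using tangent[of x y] Y v xyz by simp
      hence "v = x *s e" using z xyz by (simp add: comb_def)
      thus False using Y v span_scale_eq[of x e] by (cases "x = 0") auto
    qed
    hence "v = z *s comb e c1 c3 (x / z) (y / z) 1" by (simp add: xyz comb_scale)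
    hence "Y = ?g (y / z, x / z)" using v span_scale_eq[OF \<open>z \<noteq> 0\<close>] by simp
    moreover have "(y / z, x / z) \<in> ?A" using Y calculation by simp
    ultimately show "Y \<in> ?g ` ?A" by (rule image_eqI)
  qed
  hence "(\<Sum>l\<in>UNIV. n l) = card (U - {vec.span {e}})" using card_affine_points[OF B, of U] by (simp add: n_def)
  also have "\<dots> = q ^ 3" using U X unital_finite[OF U] by (simp add: is_unital_def)
  finally have sum: "(\<Sum>l\<in>UNIV. n l) = q\<^sup>2 * q" by (simp add: power2_eq_square power3_eq_cube)
  have le: "n l \<le> q" for l
    using pencil_line[OF U B X, of l] U by (auto simp: is_unital_def n_def)
  show ?thesis
  proof (rule ccontr)
    assume "\<not> ?thesis"
    hence "n l < q" using le[of l] by (simp add: n_def)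
    hence "(\<Sum>l\<in>UNIV. n l) < (\<Sum>l\<in>(UNIV::'a set). q)" using le by (intro sum_strict_mono_ex1) auto
    thus False using sum by (simp add: card_F)
  qed
qed

text \<open>If all lines through \<open>X\<close> had q + 1 points, the q^2 lines indexed by l would
  already account for the q^3 points other than \<open>X\<close>, while <e, c1> would still carry q
  more.\<close>

lemma exists_tangent:
  fixes U :: "('a ^ 3) set set"
  assumes U: "is_unital q U" and X: "X \<in> U"
  shows "\<exists>L\<in>pg_lines. X \<subseteq> L \<and> (\<forall>Y\<in>U. Y \<subseteq> L \<longrightarrow> Y = X)"
proof (rule ccontr)
  assume no: "\<not> ?thesis"
  have "X \<in> pg_points" using U X by (auto simp: is_unital_def)
  then obtain e where e: "e \<noteq> 0" "X = vec.span {e}" by (auto simp: pg_point_iff)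
  obtain c1 c3 where B: "basis3 e c1 c3" using exists_basis3[OF e(1)] by blast
  have fin: "finite U" by (rule unital_finite[OF U])
  have secant: "card {Y\<in>U. Y \<subseteq> L} = q + 1" if L: "L \<in> pg_lines" "X \<subseteq> L" for L
  proof (rule ccontr)
    assume "card {Y\<in>U. Y \<subseteq> L} \<noteq> q + 1"
    hence "card {Y\<in>U. Y \<subseteq> L} = 1" using U L(1) by (auto simp: is_unital_def)
    then obtain Z where Z: "{Y\<in>U. Y \<subseteq> L} = {Z}" by (rule card_1_singletonE)
    hence "Z = X" using X L by blast
    hence "\<forall>Y\<in>U. Y \<subseteq> L \<longrightarrow> Y = X" using Z by blast
    thus False using no L by blast
  qed
  let ?A = "{(l, w). vec.span {comb e c1 c3 w l 1} \<in> U}"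
  let ?g = "\<lambda>(l, w). vec.span {comb e c1 c3 w l 1}"
  have "card {w. vec.span {comb e c1 c3 w l 1} \<in> U} = q" for l
  proof -
    have "X \<subseteq> vec.span {e, l *s c1 + c3}" unfolding e by (rule vec.span_mono) auto
    thus ?thesis using pencil_line[OF U B, of l] secant X e by simp
  qed
  hence cA: "card (?g ` ?A) = q ^ 3" by (simp add: card_affine_points[OF B] card_F power2_eq_square power3_eq_cube)
  have nz: "comb e c1 c3 w l 1 \<noteq> 0" for w l by (simp add: comb_eq_0_iff[OF B])
  have cmb: "k *s e + k' *s c1 = comb e c1 c3 k k' 0" for k k' by (simp add: comb_def)
  have off: "\<not> vec.span {comb e c1 c3 w l 1} \<subseteq> vec.span {e, c1}" for w l
  proof
    assume "vec.span {comb e c1 c3 w l 1} \<subseteq> vec.span {e, c1}"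
    hence "comb e c1 c3 w l 1 \<in> vec.span {e, c1}" by (simp add: span_subset_iff vec.subspace_span)
    then obtain k k' where "comb e c1 c3 w l 1 = comb e c1 c3 k k' 0" unfolding span_pair cmb by blast
    thus False by (simp add: comb_eq_iff[OF B])
  qed
  have XL: "X \<subseteq> vec.span {e, c1}" unfolding e by (rule vec.span_mono) auto
  have "?g ` ?A \<subseteq> U - {Y\<in>U. Y \<subseteq> vec.span {e, c1}}" using off by auto
  hence "q ^ 3 \<le> card (U - {Y\<in>U. Y \<subseteq> vec.span {e, c1}})" unfolding cA[symmetric] using fin by (intro card_mono) auto
  also have "\<dots> = card U - card {Y\<in>U. Y \<subseteq> vec.span {e, c1}}" using fin by (intro card_Diff_subset) auto
  also have "card {Y\<in>U. Y \<subseteq> vec.span {e, c1}} = q + 1"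
    by (rule secant[OF span_pair_line XL]) (simp add: cmb comb_eq_0_iff[OF B])
  finally have "q ^ 3 \<le> q ^ 3 - q" using U by (simp add: is_unital_def)
  moreover have "q ^ 3 > 0" using q_gt_1 by simp
  ultimately show False using q_gt_1 by linarith
qed

end

lemma image_span_single: "(*v) M ` vec.span {v :: 'a::field ^ 3} = vec.span {M *v v}"
  by (auto simp: vec.span_singleton image_image vector_scalar_commute)

lemma mult_comb:
  "M *v comb e1 e2 e3 x y z = comb (M *v e1) (M *v e2) (M *v e3) x y z"
  by (simp add: comb_def matrix_vector_right_distrib vector_scalar_commute)

section \<open>Frames from two tangents, the Hermitian equation and the diagonal stabiliser\<close>

context square_field
begin

text \<open>\<open>e1\<close> spans the intersection of tangents at the two points; the last two
  clauses say that the lines z = 0 and y = 0 are these tangents.\<close>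

lemma exists_frame:
  fixes U :: "('a ^ 3) set set"
  assumes U: "is_unital q U" and P: "P \<in> U" and R: "R \<in> U" and PR: "P \<noteq> R"
  shows "\<exists>e1 e2 e3. basis3 e1 e2 e3 \<and> P = vec.span {e2} \<and> R = vec.span {e3} \<and>
    (\<forall>x y. vec.span {comb e1 e2 e3 x y 0} \<in> U \<longrightarrow> x = 0) \<and>
    (\<forall>x z. vec.span {comb e1 e2 e3 x 0 z} \<in> U \<longrightarrow> x = 0)"
proof -
  obtain LP where LP: "LP \<in> pg_lines" "P \<subseteq> LP" "\<forall>Y\<in>U. Y \<subseteq> LP \<longrightarrow> Y = P"
    using exists_tangent[OF U P] by blast
  obtain LR where LR: "LR \<in> pg_lines" "R \<subseteq> LR" "\<forall>Y\<in>U. Y \<subseteq> LR \<longrightarrow> Y = R"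
    using exists_tangent[OF U R] by blast
  have sub: "vec.subspace LP" "vec.subspace LR" and dims: "vec.dim LP = 2" "vec.dim LR = 2"
    using LP(1) LR(1) by (auto simp: pg_lines_def)
  have "P \<in> pg_points" "R \<in> pg_points" using U P R by (auto simp: is_unital_def)
  then obtain e2 e3 where e2: "e2 \<noteq> 0" "P = vec.span {e2}" and e3: "e3 \<noteq> 0" "R = vec.span {e3}"
    by (auto simp: pg_point_iff)
  have e2L: "e2 \<in> LP" "e2 \<notin> LR" and e3L: "e3 \<in> LR" "e3 \<notin> LP"
    using LP LR P R PR span_subset_iff[OF sub(1)] span_subset_iff[OF sub(2)] e2(2) e3(2) by metis+
  \<comment> \<open>Two planes through the origin in a space of dimension 3 meet in more than
    0.\<close>
  have "vec.dim {x + y |x y. x \<in> LP \<and> y \<in> LR} \<le> 3"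
    using vec.dim_subset[OF subset_UNIV, of "{x + y |x y. x \<in> LP \<and> y \<in> LR}"]
      vec_dim_card[where ?'a = 'a and ?'n = 3] by simp
  hence "vec.dim (LP \<inter> LR) \<noteq> 0" using vec.dim_sums_Int[OF sub] dims by linarith
  hence "\<not> LP \<inter> LR \<subseteq> {0}" by (simp add: vec.dim_eq_0)
  then obtain e1 where e1: "e1 \<noteq> 0" "e1 \<in> LP" "e1 \<in> LR" by blast
  have "basis3 e1 e2 e3" unfolding basis3_def
  proof (intro allI impI)
    fix x y z assume 0: "comb e1 e2 e3 x y z = 0"
    have z: "z = 0"
    proof (rule ccontr)
      assume z: "z \<noteq> 0"
      have "z *s e3 = (- x) *s e1 + (- y) *s e2" using 0 by (simp add: comb_def algebra_simps eq_neg_iff_add_eq_0)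
      hence "z *s e3 \<in> LP" using e1 e2L sub by (simp add: vec.subspace_add vec.subspace_scale vec.subspace_diff vec.subspace_neg)
      hence "(1 / z) *s (z *s e3) \<in> LP" by (rule vec.subspace_scale[OF sub(1)])
      thus False using z e3L by simp
    qed
    have y: "y = 0"
    proof (rule ccontr)
      assume y: "y \<noteq> 0"
      have "y *s e2 = (- x) *s e1" using 0 z by (simp add: comb_def eq_neg_iff_add_eq_0 add.commute)
      hence "y *s e2 \<in> LR" using e1 sub by (simp add: vec.subspace_scale vec.subspace_neg)
      hence "(1 / y) *s (y *s e2) \<in> LR" by (rule vec.subspace_scale[OF sub(2)])
      thus False using y e2L by simp
    qed
    show "x = 0 \<and> y = 0 \<and> z = 0" using 0 y z e1 by (simp add: comb_def)
  qed
  note B = this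
  have "x = 0" if "vec.span {comb e1 e2 e3 x y 0} \<in> U" for x y
  proof -
    have "comb e1 e2 e3 x y 0 \<in> LP" using e1 e2L sub by (simp add: comb_def vec.subspace_add vec.subspace_scale)
    hence "vec.span {e2} = vec.span {comb e1 e2 e3 x y 0}" using LP(3) that e2(2) span_subset_iff[OF sub(1)] by metis
    then obtain k where k: "k \<noteq> 0" "e2 = k *s comb e1 e2 e3 x y 0" using span_single_eq_iff[OF e2(1)] by blast
    hence "comb e1 e2 e3 0 1 0 = comb e1 e2 e3 (k * x) (k * y) (k * 0)" unfolding comb_scale by (simp add: comb_def)
    thus ?thesis using k by (simp add: comb_eq_iff[OF B])
  qed
  moreover have "x = 0" if "vec.span {comb e1 e2 e3 x 0 z} \<in> U" for x z
  proof -
    have "comb e1 e2 e3 x 0 z \<in> LR" using e1 e3L sub by (simp add: comb_def vec.subspace_add vec.subspace_scale)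
    hence "vec.span {e3} = vec.span {comb e1 e2 e3 x 0 z}" using LR(3) that e3(2) span_subset_iff[OF sub(2)] by metis
    then obtain k where k: "k \<noteq> 0" "e3 = k *s comb e1 e2 e3 x 0 z" using span_single_eq_iff[OF e3(1)] by blast
    hence "comb e1 e2 e3 0 0 1 = comb e1 e2 e3 (k * x) (k * 0) (k * z)" unfolding comb_scale by (simp add: comb_def)
    thus ?thesis using k by (simp add: comb_eq_iff[OF B])
  qed
  ultimately show ?thesis using B e2 e3 by blast
qed

text \<open>The equation is the vanishing of a Hermitian form in the coordinates of the frame. Its
  matrix is carried back to standard coordinates by the inverse \<open>C\<close> of the frame, with
  the Frobenius conjugate on the second argument.\<close>

lemma classical_of_equation:
  fixes U :: "('a ^ 3) set set"
  assumes U: "U \<subseteq> pg_points" and B: "basis3 e1 e2 e3" and k: "k \<noteq> 0" "k ^ q = - k"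
    and eqn: "\<And>x y z. x \<noteq> 0 \<or> y \<noteq> 0 \<or> z \<noteq> 0 \<Longrightarrow>
      vec.span {comb e1 e2 e3 x y z} \<in> U \<longleftrightarrow> x ^ (q + 1) = k * (y * z ^ q - y ^ q * z)"
  shows "classical_unital q U"
proof -
  obtain C where C: "frame e1 e2 e3 ** C = mat 1" "C ** frame e1 e2 e3 = mat 1"
    using invertible_frame[OF B] by (auto simp: invertible_def)
  define conj_mat where "conj_mat M = (\<chi> i j. (M $ i $ j) ^ q)" for M :: "'a ^ 3 ^ 3"
  define conj_vec where "conj_vec v = (\<chi> i. (v $ i) ^ q)" for v :: "'a ^ 3"
  define dot where "dot v w = (\<Sum>i\<in>UNIV. v $ i * w $ i)" for v w :: "'a ^ 3"
  \<comment> \<open>The Gram matrix of x^(q + 1) - k * (y * z^q - y^q * z). The entries k and - k in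
    opposite positions make it Hermitian exactly because k^q = - k.\<close>
  define D :: "'a ^ 3 ^ 3" where "D = vector [vector [1, 0, 0], vector [0, 0, - k], vector [0, k, 0]]"
  define H where "H = transpose C ** (D ** conj_mat C)"
  have conj_mult: "conj_mat (M ** N) = conj_mat M ** conj_mat N" for M N
    by (simp add: conj_mat_def matrix_matrix_mult_def frob_sum power_mult_distrib vec_eq_iff)
  have conj_1: "conj_mat (mat 1) = mat 1"
    using q_gt_1 by (simp add: conj_mat_def mat_def vec_eq_iff)
  have conj_mult_vec: "conj_vec (M *v v) = conj_mat M *v conj_vec v" for M v
    by (simp add: conj_mat_def conj_vec_def matrix_vector_mult_def frob_sum power_mult_distrib vec_eq_iff)
  have dot_transpose: "dot v (transpose M *v w) = dot (M *v v) w" for M v w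
  proof -
    have "dot v (transpose M *v w) = (\<Sum>i\<in>UNIV. \<Sum>j\<in>UNIV. v $ i * (M $ j $ i * w $ j))"
      by (simp add: dot_def matrix_vector_mult_def transpose_def sum_distrib_left)
    also have "\<dots> = (\<Sum>j\<in>UNIV. \<Sum>i\<in>UNIV. v $ i * (M $ j $ i * w $ j))" by (rule sum.swap)
    also have "\<dots> = dot (M *v v) w"
      by (simp add: dot_def matrix_vector_mult_def sum_distrib_right sum_distrib_left mult_ac)
    finally show ?thesis .
  qed
  have form_dot: "hermitian_form q M v w = dot v (M *v conj_vec w)" for M v w
    by (simp add: hermitian_form_def dot_def matrix_vector_mult_def conj_vec_def sum_distrib_left mult.assoc)
  have form: "hermitian_form q H v w = dot (C *v v) (D *v conj_vec (C *v w))" for v w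
    unfolding form_dot H_def conj_mult_vec
    by (simp only: matrix_vector_mul_assoc[symmetric] dot_transpose)
  have form_self: "hermitian_form q H (comb e1 e2 e3 x y z) (comb e1 e2 e3 x y z) =
      x ^ (q + 1) - k * (y * z ^ q - y ^ q * z)" for x y z
  proof -
    have "C *v comb e1 e2 e3 x y z = C *v (frame e1 e2 e3 *v vector [x, y, z])"
      by (simp add: frame_mult vector_3)
    also have "\<dots> = vector [x, y, z]" by (simp only: matrix_vector_mul_assoc C matrix_vector_mul_lid)
    finally show ?thesis
      unfolding form
      by (simp add: dot_def D_def conj_vec_def matrix_vector_mult_def sum_3 vector_3 algebra_simps)
  qed
  have form_scale: "hermitian_form q H (a *s v) (b *s v) = a * b ^ q * hermitian_form q H v v" for a b v
    by (simp add: hermitian_form_def sum_distrib_left power_mult_distrib mult_ac)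
  have D_herm: "D $ j $ i = (D $ i $ j) ^ q" for i j
  proof -
    have "\<forall>i j. D $ j $ i = (D $ i $ j) ^ q"
      using k q_gt_1 unfolding forall_3 D_def by (simp add: vector_3 frob_minus)
    thus ?thesis by blast
  qed
  have herm: "hermitian_matrix q H" unfolding hermitian_matrix_def
  proof (intro allI)
    fix i j
    have ent: "H $ i $ j = (\<Sum>k\<in>UNIV. \<Sum>l\<in>UNIV. C $ k $ i * (D $ k $ l * (C $ l $ j) ^ q))" for i j
      by (simp add: H_def matrix_matrix_mult_def transpose_def conj_mat_def sum_distrib_left)
    have "(H $ i $ j) ^ q = (\<Sum>k\<in>UNIV. \<Sum>l\<in>UNIV. (C $ k $ i) ^ q * (D $ l $ k * C $ l $ j))"
      unfolding ent by (simp add: frob_sum power_mult_distrib D_herm[symmetric])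
    also have "\<dots> = (\<Sum>l\<in>UNIV. \<Sum>k\<in>UNIV. (C $ k $ i) ^ q * (D $ l $ k * C $ l $ j))" by (rule sum.swap)
    also have "\<dots> = H $ j $ i" unfolding ent by (simp add: mult_ac)
    finally show "H $ j $ i = (H $ i $ j) ^ q" by simp
  qed
  have inv: "invertible H"
  proof -
    have "invertible (transpose C)" unfolding invertible_def
      using C by (metis matrix_transpose_mul transpose_mat)
    moreover have "invertible (conj_mat C)" unfolding invertible_def
      using C conj_mult[of C "frame e1 e2 e3"] conj_mult[of "frame e1 e2 e3" C] conj_1 by metis
    moreover have "invertible D" using k by (simp add: invertible_det_nz det_3 D_def vector_3)
    ultimately show ?thesis unfolding H_def by (intro invertible_mult)
  qed
  have "U = absolute_points (hermitian_perp q H)"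
  proof (rule Set.set_eqI)
    fix X
    show "X \<in> U \<longleftrightarrow> X \<in> absolute_points (hermitian_perp q H)"
    proof (cases "X \<in> pg_points")
      case True
      then obtain v where v: "v \<noteq> 0" "X = vec.span {v}" by (auto simp: pg_point_iff)
      obtain x y z where xyz: "v = comb e1 e2 e3 x y z" by (rule comb_surj[OF B])
      have "x \<noteq> 0 \<or> y \<noteq> 0 \<or> z \<noteq> 0" using v xyz comb_eq_0_iff[OF B] by blast
      hence "X \<in> U \<longleftrightarrow> hermitian_form q H v v = 0" using eqn[of x y z] form_self[of x y z] v xyz by simp
      also have "\<dots> \<longleftrightarrow> X \<subseteq> hermitian_perp q H X"
      proof
        assume "hermitian_form q H v v = 0"
        thus "X \<subseteq> hermitian_perp q H X"
          by (auto simp: v hermitian_perp_def vec.span_singleton form_scale)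
      next
        assume "X \<subseteq> hermitian_perp q H X"
        moreover have "v \<in> X" using v by (simp add: vec.span_base)
        ultimately show "hermitian_form q H v v = 0" by (auto simp: hermitian_perp_def)
      qed
      finally show ?thesis using True by (simp add: absolute_points_def)
    qed (use U in \<open>auto simp: absolute_points_def\<close>)
  qed
  moreover have "unitary_polarity q (hermitian_perp q H)"
    using herm inv by (auto simp: unitary_polarity_def)
  ultimately show ?thesis by (auto simp: classical_unital_def)
qed

text \<open>A map fixing both points and the unital must preserve both tangents, hence their
  intersection <e1>. Otherwise the image of a tangent is another line through the fixed point and
  contains a second point of the unital, whose preimage lies on the tangent. The third diagonal
  entry is normalised to 1, which removes the scalar freedom.\<close>

lemma stabiliser_diagonal:
  fixes U :: "('a ^ 3) set set"
  assumes U: "is_unital q U" and B: "basis3 e1 e2 e3"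
    and P: "vec.span {e2} \<in> U" and R: "vec.span {e3} \<in> U"
    and tP: "\<And>x y. vec.span {comb e1 e2 e3 x y 0} \<in> U \<Longrightarrow> x = 0"
    and tR: "\<And>x z. vec.span {comb e1 e2 e3 x 0 z} \<in> U \<Longrightarrow> x = 0"
    and M: "invertible M" and inv: "\<And>v. v \<noteq> 0 \<Longrightarrow> vec.span {M *v v} \<in> U \<longleftrightarrow> vec.span {v} \<in> U"
    and MP: "vec.span {M *v e2} = vec.span {e2}" and MR: "vec.span {M *v e3} = vec.span {e3}"
  shows "\<exists>a t. a \<noteq> 0 \<and> t \<noteq> 0 \<and> (\<forall>x y z. vec.span {M *v comb e1 e2 e3 x y z} = vec.span {comb e1 e2 e3 (a * x) (t * y) z})"
proof -
  have inj: "inj ((*v) M)" using M matrix_left_invertible_injective invertible_left_inverse by blast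
  have M0: "M *v v \<noteq> 0" if "v \<noteq> 0" for v
    using injD[OF inj, of v 0] that by auto
  have nz: "e1 \<noteq> 0" "e2 \<noteq> 0" "e3 \<noteq> 0"
    using comb_eq_0_iff[OF B, of 1 0 0] comb_eq_0_iff[OF B, of 0 1 0] comb_eq_0_iff[OF B, of 0 0 1]
    by (auto simp: comb_def)
  obtain t' where t': "t' \<noteq> 0" "M *v e2 = t' *s e2" using span_single_eq_iff[OF M0[OF nz(2)]] MP by blast
  obtain s where s: "s \<noteq> 0" "M *v e3 = s *s e3" using span_single_eq_iff[OF M0[OF nz(3)]] MR by blast
  obtain \<alpha> \<beta> \<gamma> where abc: "M *v e1 = comb e1 e2 e3 \<alpha> \<beta> \<gamma>" by (rule comb_surj[OF B])
  have Mc: "M *v comb e1 e2 e3 x y z = comb e1 e2 e3 (\<alpha> * x) (\<beta> * x + t' * y) (\<gamma> * x + s * z)" for x y z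
    unfolding mult_comb abc t'(2) s(2)
    by (simp add: comb_def vec.scale_right_distrib vec.scale_left_distrib mult_ac add_ac)
  have perm: "comb e2 e1 e3 x y z = comb e1 e2 e3 y x z" "comb e3 e1 e2 x y z = comb e1 e2 e3 y z x" for x y z
    by (simp_all add: comb_def add_ac)
  have g0: "\<gamma> = 0"
  proof (rule ccontr)
    assume g: "\<gamma> \<noteq> 0"
    have "card {w. vec.span {comb e2 e1 e3 w (\<alpha> / \<gamma>) 1} \<in> U} = q"
      by (rule pencil_card[OF U basis3_perm(1)[OF B] P]) (rule tP, simp only: perm)
    hence "{w. vec.span {comb e2 e1 e3 w (\<alpha> / \<gamma>) 1} \<in> U} \<noteq> {}" using q_gt_1 by (intro notI) simp
    then obtain w where w: "vec.span {comb e1 e2 e3 (\<alpha> / \<gamma>) w 1} \<in> U" unfolding perm by blast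
    define y where "y = (\<gamma> * w - \<beta>) / t'"
    have "M *v comb e1 e2 e3 1 y 0 = \<gamma> *s comb e1 e2 e3 (\<alpha> / \<gamma>) w 1"
      using g t'(1) by (simp add: Mc comb_scale y_def)
    hence "vec.span {M *v comb e1 e2 e3 1 y 0} \<in> U" using w span_scale_eq[OF g] by simp
    hence "vec.span {comb e1 e2 e3 1 y 0} \<in> U" using inv comb_eq_0_iff[OF B, of 1 y 0] by simp
    thus False using tP by fastforce
  qed
  have b0: "\<beta> = 0"
  proof (rule ccontr)
    assume b: "\<beta> \<noteq> 0"
    have "card {w. vec.span {comb e3 e1 e2 w (\<alpha> / \<beta>) 1} \<in> U} = q"
      by (rule pencil_card[OF U basis3_perm(2)[OF B] R]) (rule tR, simp only: perm)
    hence "{w. vec.span {comb e3 e1 e2 w (\<alpha> / \<beta>) 1} \<in> U} \<noteq> {}" using q_gt_1 by (intro notI) simp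
    then obtain w where w: "vec.span {comb e1 e2 e3 (\<alpha> / \<beta>) 1 w} \<in> U" unfolding perm by blast
    have "M *v comb e1 e2 e3 1 0 (\<beta> * w / s) = \<beta> *s comb e1 e2 e3 (\<alpha> / \<beta>) 1 w"
      using b s(1) g0 by (simp add: Mc comb_scale)
    hence "vec.span {M *v comb e1 e2 e3 1 0 (\<beta> * w / s)} \<in> U" using w span_scale_eq[OF b] by simp
    hence "vec.span {comb e1 e2 e3 1 0 (\<beta> * w / s)} \<in> U" using inv comb_eq_0_iff[OF B, of 1 0 "\<beta> * w / s"] by simp
    thus False using tR by fastforce
  qed
  have "\<alpha> \<noteq> 0"
  proof
    assume "\<alpha> = 0"
    hence "M *v e1 = 0" using abc b0 g0 by (simp add: comb_def)
    thus False using M0 nz by blast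
  qed
  moreover have "vec.span {M *v comb e1 e2 e3 x y z} = vec.span {comb e1 e2 e3 (\<alpha> / s * x) (t' / s * y) z}" for x y z
  proof -
    have "M *v comb e1 e2 e3 x y z = s *s comb e1 e2 e3 (\<alpha> / s * x) (t' / s * y) z"
      using s(1) by (simp add: Mc b0 g0 comb_scale)
    thus ?thesis using span_scale_eq[OF s(1)] by simp
  qed
  ultimately show ?thesis using t'(1) s(1) by (intro exI[of _ "\<alpha> / s"] exI[of _ "t' / s"]) simp
qed

text \<open>Only an injection into the pairs (a, t) is needed. A pair determines its projectivity on
  all points, and projectivities are extensional, so equal pairs give equal maps.\<close>

lemma card_stabiliser_le:
  fixes U :: "('a ^ 3) set set"
  assumes U: "is_unital q U" and B: "basis3 e1 e2 e3"
    and P: "vec.span {e2} \<in> U" and R: "vec.span {e3} \<in> U"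
    and tP: "\<And>x y. vec.span {comb e1 e2 e3 x y 0} \<in> U \<Longrightarrow> x = 0"
    and tR: "\<And>x z. vec.span {comb e1 e2 e3 x 0 z} \<in> U \<Longrightarrow> x = 0"
  defines "A \<equiv> {(x, y). vec.span {comb e1 e2 e3 x y 1} \<in> U}"
  shows "card (carrier (two_point_stabiliser (preserving_group U) (vec.span {e2}) (vec.span {e3}))) \<le>
    card {(a, t). a \<noteq> 0 \<and> t \<noteq> 0 \<and> (\<forall>x y. (x, y) \<in> A \<longleftrightarrow> (a * x, t * y) \<in> A)}"
proof -
  let ?G = "carrier (two_point_stabiliser (preserving_group U) (vec.span {e2}) (vec.span {e3}))"
  let ?D = "{(a, t). a \<noteq> 0 \<and> t \<noteq> 0 \<and> (\<forall>x y. (x, y) \<in> A \<longleftrightarrow> (a * x, t * y) \<in> A)}"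
  let ?act = "\<lambda>g a t. \<forall>x y z. comb e1 e2 e3 x y z \<noteq> 0 \<longrightarrow>
      g (vec.span {comb e1 e2 e3 x y z}) = vec.span {comb e1 e2 e3 (a * x) (t * y) z}"
  have Upts: "U \<subseteq> pg_points" using U by (simp add: is_unital_def)
  have ex: "\<exists>a t. (a, t) \<in> ?D \<and> ?act g a t \<and> g \<in> extensional pg_points" if g: "g \<in> ?G" for g
  proof -
    obtain M where M: "invertible M" "g = projectivity_of M" and gU: "g ` U = U"
      and gP: "g (vec.span {e2}) = vec.span {e2}" and gR: "g (vec.span {e3}) = vec.span {e3}"
      using g by (auto simp: two_point_stabiliser_def preserving_group_def PGL3_def)
    have gv: "g (vec.span {v}) = vec.span {M *v v}" if "v \<noteq> 0" for v
    proof -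
      have "vec.span {v} \<in> pg_points" using that pg_point_iff by blast
      thus ?thesis by (simp add: M(2) projectivity_of_def image_span_single)
    qed
    have nz: "e2 \<noteq> 0" "e3 \<noteq> 0"
      using comb_eq_0_iff[OF B, of 0 1 0] comb_eq_0_iff[OF B, of 0 0 1] by (auto simp: comb_def)
    have gbij: "inj_on g pg_points" using projectivity_of_Bij[OF M(1)] M(2) by (auto simp: Bij_def bij_betw_def)
    have inv: "vec.span {M *v v} \<in> U \<longleftrightarrow> vec.span {v} \<in> U" if v: "v \<noteq> 0" for v
    proof
      assume "vec.span {M *v v} \<in> U"
      then obtain Y where Y: "Y \<in> U" "g (vec.span {v}) = g Y" using gU gv[OF v] by (metis imageE)
      moreover have "vec.span {v} \<in> pg_points" "Y \<in> pg_points" using v pg_point_iff Y Upts by blast+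
      ultimately show "vec.span {v} \<in> U" using gbij by (metis inj_onD)
    next
      assume "vec.span {v} \<in> U"
      thus "vec.span {M *v v} \<in> U" using gU gv[OF v] by (metis imageI)
    qed
    have MP: "vec.span {M *v e2} = vec.span {e2}" "vec.span {M *v e3} = vec.span {e3}"
      using gP gR gv[OF nz(1)] gv[OF nz(2)] by simp_all
    have "\<exists>a t. a \<noteq> 0 \<and> t \<noteq> 0 \<and>
        (\<forall>x y z. vec.span {M *v comb e1 e2 e3 x y z} = vec.span {comb e1 e2 e3 (a * x) (t * y) z})"
      by (rule stabiliser_diagonal[OF U B P R tP tR M(1) inv MP])
    then obtain a t where at0: "a \<noteq> 0 \<and> t \<noteq> 0 \<and>
        (\<forall>x y z. vec.span {M *v comb e1 e2 e3 x y z} = vec.span {comb e1 e2 e3 (a * x) (t * y) z})"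
      by (elim exE)
    hence at: "a \<noteq> 0" "t \<noteq> 0"
        "vec.span {M *v comb e1 e2 e3 x y z} = vec.span {comb e1 e2 e3 (a * x) (t * y) z}" for x y z
      by simp_all
    have "(x, y) \<in> A \<longleftrightarrow> (a * x, t * y) \<in> A" for x y
      using inv[of "comb e1 e2 e3 x y 1"] at(3)[of x y 1] comb_eq_0_iff[OF B, of x y 1] by (simp add: A_def)
    moreover have "?act g a t" using gv at(3) by simp
    moreover have "g \<in> extensional pg_points" by (simp add: M(2) projectivity_of_def)
    ultimately show ?thesis using at by blast
  qed
  define h where "h g = (SOME s. s \<in> ?D \<and> ?act g (fst s) (snd s))" for g
  have h: "h g \<in> ?D \<and> ?act g (fst (h g)) (snd (h g))" if "g \<in> ?G" for g
  proof -
    from ex[OF that] obtain a t where at: "(a, t) \<in> ?D \<and> ?act g a t \<and> g \<in> extensional pg_points"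
      by (elim exE)
    have "(a, t) \<in> ?D \<and> ?act g (fst (a, t)) (snd (a, t))"
      unfolding fst_conv snd_conv by (rule conjI[OF at[THEN conjunct1] at[THEN conjunct2, THEN conjunct1]])
    hence "\<exists>s. s \<in> ?D \<and> ?act g (fst s) (snd s)" by (rule exI[of _ "(a, t)"])
    thus ?thesis unfolding h_def by (rule someI_ex)
  qed
  show ?thesis
  proof (rule card_inj_on_le[of h])
    show "inj_on h ?G"
    proof (rule inj_onI)
      fix g g' assume g: "g \<in> ?G" "g' \<in> ?G" and eq: "h g = h g'"
      show "g = g'"
      proof (rule extensionalityI[of g pg_points g'])
        show "g \<in> extensional pg_points" using ex[OF g(1)] by (elim exE conjE)
        show "g' \<in> extensional pg_points" using ex[OF g(2)] by (elim exE conjE)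
        fix X :: "('a ^ 3) set" assume "X \<in> pg_points"
        then obtain v where v: "v \<noteq> 0" "X = vec.span {v}" by (auto simp: pg_point_iff)
        obtain x y z where xyz: "v = comb e1 e2 e3 x y z" by (rule comb_surj[OF B])
        have nz: "comb e1 e2 e3 x y z \<noteq> 0" using v xyz by simp
        have "g X = vec.span {comb e1 e2 e3 (fst (h g) * x) (snd (h g) * y) z}"
          unfolding v xyz using h[OF g(1), THEN conjunct2] nz by blast
        moreover have "g' X = vec.span {comb e1 e2 e3 (fst (h g') * x) (snd (h g') * y) z}"
          unfolding v xyz using h[OF g(2), THEN conjunct2] nz by blast
        ultimately show "g X = g' X" by (simp only: eq)
      qed
    qed
    show "h ` ?G \<subseteq> ?D" by (rule image_subsetI) (rule h[THEN conjunct1])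
    show "finite ?D" by (rule finite_subset[OF _ finite_class.finite_UNIV]) auto
  qed
qed

text \<open>Nothing is lost at infinity: the point <e1 + m * e2> of the line lies on z = 0, which
  meets the unital at most where x = 0, so all points of the unital on the line are affine.\<close>

lemma affine_line_card:
  fixes U :: "('a ^ 3) set set"
  assumes U: "is_unital q U" and B: "basis3 e1 e2 e3"
    and tP: "\<And>x y. vec.span {comb e1 e2 e3 x y 0} \<in> U \<Longrightarrow> x = 0"
  shows "card {x. vec.span {comb e1 e2 e3 x (m * x + b) 1} \<in> U} \<in> {1, q + 1}"
proof -
  let ?L = "vec.span {e1 + m *s e2, b *s e2 + e3}"
  let ?g = "\<lambda>x. vec.span {comb e1 e2 e3 x (m * x + b) 1}"
  let ?W = "{x. ?g x \<in> U}"
  have cmb: "k *s (e1 + m *s e2) + l *s (b *s e2 + e3) = comb e1 e2 e3 k (m * k + b * l) l" for k l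
    by (simp add: comb_def vec.scale_right_distrib vec.scale_left_distrib mult_ac add_ac)
  have L: "?L \<in> pg_lines" by (rule span_pair_line) (auto simp only: cmb comb_eq_0_iff[OF B])
  have sub: "vec.subspace ?L" by (rule vec.subspace_span)
  have nz: "comb e1 e2 e3 x y 1 \<noteq> 0" for x y by (simp add: comb_eq_0_iff[OF B])
  have "{Y\<in>U. Y \<subseteq> ?L} = ?g ` ?W"
  proof (intro equalityI subsetI)
    fix Y assume Y: "Y \<in> {Y\<in>U. Y \<subseteq> ?L}"
    hence "Y \<in> pg_points" using U by (auto simp: is_unital_def)
    then obtain v where v: "v \<noteq> 0" "Y = vec.span {v}" by (auto simp: pg_point_iff)
    hence "v \<in> ?L" using Y span_subset_iff[OF sub] by blast
    then obtain k l where vkl: "v = comb e1 e2 e3 k (m * k + b * l) l" unfolding span_pair cmb by blast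
    have l: "l \<noteq> 0"
    proof
      assume l: "l = 0"
      hence "k = 0" using tP[of k "m * k"] Y v vkl by simp
      thus False using v vkl l by (simp add: comb_def)
    qed
    hence "v = l *s comb e1 e2 e3 (k / l) (m * (k / l) + b) 1" by (simp add: vkl comb_scale distrib_left mult_ac)
    hence "Y = ?g (k / l)" using v span_scale_eq[OF l] by simp
    moreover have "k / l \<in> ?W" using Y calculation by simp
    ultimately show "Y \<in> ?g ` ?W" by (rule image_eqI)
  next
    fix Y assume "Y \<in> ?g ` ?W"
    then obtain x where x: "Y \<in> U" "Y = ?g x" by blast
    have "comb e1 e2 e3 x (m * x + b) 1 = x *s (e1 + m *s e2) + 1 *s (b *s e2 + e3)" by (simp only: cmb mult_1_right)
    hence "comb e1 e2 e3 x (m * x + b) 1 \<in> ?L" unfolding span_pair by blast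
    thus "Y \<in> {Y\<in>U. Y \<subseteq> ?L}" using x span_subset_iff[OF sub] by simp
  qed
  moreover have "inj ?g"
  proof (rule injI)
    fix x x' assume "?g x = ?g x'"
    then obtain k where "comb e1 e2 e3 x (m * x + b) 1 = k *s comb e1 e2 e3 x' (m * x' + b) 1"
      using span_single_eq_iff[OF nz] by blast
    thus "x = x'" by (simp add: comb_scale comb_eq_iff[OF B])
  qed
  ultimately have eq: "card {Y\<in>U. Y \<subseteq> ?L} = card ?W" by (simp add: card_image inj_on_subset[OF \<open>inj ?g\<close>])
  have "card {Y\<in>U. Y \<subseteq> ?L} \<in> {1, q + 1}" using U L unfolding is_unital_def by blast
  thus ?thesis unfolding eq .
qed

lemma classical_of_stabiliser:
  fixes U :: "('a ^ 3) set set"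
  assumes U: "is_unital q U" and PQ: "P \<in> U" "Q \<in> U" "P \<noteq> Q"
    and ord: "card (carrier (two_point_stabiliser (preserving_group U) P Q)) = q\<^sup>2 - 1"
  shows "classical_unital q U"
proof -
  obtain e1 e2 e3 where B: "basis3 e1 e2 e3" and P: "P = vec.span {e2}" and Q: "Q = vec.span {e3}"
    and tPQ: "\<forall>x y. vec.span {comb e1 e2 e3 x y 0} \<in> U \<longrightarrow> x = 0"
      "\<forall>x z. vec.span {comb e1 e2 e3 x 0 z} \<in> U \<longrightarrow> x = 0"
    using exists_frame[OF U PQ] by (elim exE conjE)
  have tP: "x = 0" if "vec.span {comb e1 e2 e3 x y 0} \<in> U" for x y using tPQ(1) that by blast
  have tQ: "x = 0" if "vec.span {comb e1 e2 e3 x 0 z} \<in> U" for x z using tPQ(2) that by blast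
  define A where "A = {(x, y). vec.span {comb e1 e2 e3 x y 1} \<in> U}"
  have lines: "card {x. (x, m * x + b) \<in> A} \<in> {1, q + 1}" for m b
    using affine_line_card[OF U B tP] by (simp add: A_def)
  have perm: "comb e2 e1 e3 x y z = comb e1 e2 e3 y x z" for x y z by (simp add: comb_def add_ac)
  have vert: "card {y. (x, y) \<in> A} = q" for x
    using pencil_card[OF U basis3_perm(1)[OF B], of x] PQ(1) tP unfolding P perm by (simp add: A_def)
  have axis: "(x, 0) \<in> A \<longleftrightarrow> x = 0" for x
    using tQ[of x 1] PQ(2) unfolding Q by (auto simp: A_def comb_def)
  have big: "q\<^sup>2 - 1 \<le> card {(a, t). a \<noteq> 0 \<and> t \<noteq> 0 \<and> (\<forall>x y. (x, y) \<in> A \<longleftrightarrow> (a * x, t * y) \<in> A)}"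
    using card_stabiliser_le[OF U B _ _ tP tQ] PQ ord unfolding P Q A_def by simp
  obtain y1 f where y1: "y1 \<noteq> 0" and f: "unital_function q f"
    and A_iff: "\<And>x y. (x, y1 * y) \<in> A \<longleftrightarrow> x ^ (q + 1) = f y"
    and scal: "\<And>t. t ^ q = t \<Longrightarrow> t \<noteq> 0 \<Longrightarrow> \<exists>c. \<forall>y. f (t * y) = c * f y"
    using norm_function_of_torus[OF lines vert axis big] by blast
  interpret u: unital_function q F f by (rule f)
  obtain k where k: "k \<noteq> 0" "k ^ q = - k" and fk: "\<And>y. f y = k * (y - y ^ q)"
    using u.f_classical scal unfolding base_iff by blast
  have comb': "comb e1 (y1 *s e2) e3 x y z = comb e1 e2 e3 x (y1 * y) z" for x y z
    by (simp add: comb_def mult.commute)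
  \<comment> \<open>Scaling \<open>e2\<close> by y1 absorbs the normalisation of the ordinates under
    which \<open>f\<close> is defined.\<close>
  have B': "basis3 e1 (y1 *s e2) e3" using y1 unfolding basis3_def comb' by (simp add: comb_eq_0_iff[OF B])
  show ?thesis
  proof (rule classical_of_equation[OF _ B' k])
    show "U \<subseteq> pg_points" using U by (simp add: is_unital_def)
    fix x y z :: 'a assume xyz: "x \<noteq> 0 \<or> y \<noteq> 0 \<or> z \<noteq> 0"
    \<comment> \<open>The affine equation is homogenised with z^(q + 1). On z = 0 it reduces to x =
      0, which leaves only the point \<open>P\<close>, in accordance with the tangent there.\<close>
    show "vec.span {comb e1 (y1 *s e2) e3 x y z} \<in> U \<longleftrightarrow> x ^ (q + 1) = k * (y * z ^ q - y ^ q * z)"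
    proof (cases "z = 0")
      case True
      have "vec.span {comb e1 (y1 *s e2) e3 x y z} \<in> U \<longleftrightarrow> x = 0"
      proof
        assume "x = 0"
        hence c: "comb e1 (y1 *s e2) e3 x y z = (y1 * y) *s e2" "y1 * y \<noteq> 0"
          using True xyz y1 unfolding comb' by (simp_all add: comb_def)
        show "vec.span {comb e1 (y1 *s e2) e3 x y z} \<in> U"
          using PQ(1) unfolding P c(1) span_scale_eq[OF c(2)] .
      qed (use tP True in \<open>auto simp: comb'\<close>)
      moreover have "q \<noteq> 0" using q_gt_1 by simp
      ultimately show ?thesis using True by (simp add: power_0_left)
    next
      case False
      hence nz: "z ^ (q + 1) \<noteq> 0" by simp
      have "comb e1 (y1 *s e2) e3 x y z = z *s comb e1 e2 e3 (x / z) (y1 * (y / z)) 1"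
        using False by (simp add: comb' comb_scale mult_ac)
      hence "vec.span {comb e1 (y1 *s e2) e3 x y z} \<in> U \<longleftrightarrow> (x / z, y1 * (y / z)) \<in> A"
        using span_scale_eq[OF False] by (simp add: A_def)
      also have "\<dots> \<longleftrightarrow> (x / z) ^ (q + 1) = k * (y / z - (y / z) ^ q)" unfolding A_iff fk ..
      also have "\<dots> \<longleftrightarrow> (x / z) ^ (q + 1) * z ^ (q + 1) = k * (y / z - (y / z) ^ q) * z ^ (q + 1)"
        unfolding mult_right_cancel[OF nz] ..
      also have "(x / z) ^ (q + 1) * z ^ (q + 1) = x ^ (q + 1)"
        unfolding power_mult_distrib[symmetric] using False by simp
      also have "k * (y / z - (y / z) ^ q) * z ^ (q + 1) = k * (y * z ^ q - y ^ q * z)"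
        using False by (simp add: power_divide field_simps)
      finally show ?thesis .
    qed
  qed
qed

end

theorem theorem3p1:
  fixes U :: "('a::{field,finite} ^ 3) set set"
    and P Q :: "('a ^ 3) set"
    and q :: nat
  assumes "primepow q"
    and "CARD('a) = q\<^sup>2"
    and "is_unital q U"
    and "P \<in> U" and "Q \<in> U" and "P \<noteq> Q"
    and "order (two_point_stabiliser (preserving_group U) P Q) = q\<^sup>2 - 1"
  shows "classical_unital q U"
proof -
  interpret square_field q "TYPE('a)" by unfold_locales (fact assms)+
  show ?thesis using assms by (intro classical_of_stabiliser) (auto simp: order_def)
qed

end
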